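(* Let $\Sigma(A,B,C,\mathbf{G})$ be an $L^\infty$-BIBO stable system node on $(U,X,Y)$ with finite-dimensional input space $U$ and finite-dimensional output space $Y$, and assume that the adjoint $A^*$ generates a $C_0$-semigroup on $X^*$. Then the dual system node $\Sigma(A^*,C^*,B^*,\overline{\mathbf{G}}(\overline{\,\cdot\,}))$ is $L^\infty$-BIBO stable.
   Context: All Banach spaces are over $\mathbb{C}$. For $\alpha\in\mathbb{R}$, $\mathbb{C}_\alpha:=\{z\in\mathbb{C}:\mathrm{Re}\,z>\alpha\}$. $\mathcal{L}(X,Y)$ denotes the bounded operators from $X$ to $Y$, $\mathrm{D}(A)$ the domain and $\rho(A)$ the resolvent set of $A$. System node: Let $U,X,Y$ be Banach spaces (input, state and output space). A system node on $(U,X,Y)$ is a collection $\Sigma(A,B,C,\mathbf{G})$ where $A:\mathrm{D}(A)\subset X\to X$ generates a strongly continuous semigroup $\mathbb{T}=(\mathbb{T}(t))_{t\ge0}$ on $X$ with growth bound $\omega(\mathbb{T})$, $B\in\mathcal{L}(U,X_{-1})$, $C\in\mathcal{L}(X_1,Y)$, and $\mathbf{G}:\mathbb{C}_{\omega(\mathbb{T})}\to\mathcal{L}(U,Y)$ is analytic with $\mathbf{G}(\alpha)-\mathbf{G}(\beta)=C[(\alpha\mathbb{I}-A)^{-1}-(\beta\mathbb{I}-A)^{-1}]B$ for all $\alpha,\beta\in\mathbb{C}_{\omega(\mathbb{T})}$. Here $X_1$ is $\mathrm{D}(A)$ with norm $\|x\|_{X_1}=\|(\beta\mathbb{I}-A)x\|_X$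 and $X_{-1}$ is the completion of $X$ in the norm $\|x\|_{X_{-1}}=\|(\beta\mathbb{I}-A)^{-1}x\|_X$, for a fixed $\beta\in\rho(A)$; $A$, its resolvent and $\mathbb{T}$ are extended to $X_{-1}$ where needed (the extension of $\mathbb{T}$ is $\mathbb{T}_{-1}$). The combined observation/feedthrough operator $C\&D:\mathrm{D}(C\&D)\subset X\times U\to Y$ is $C\&D\begin{bmatrix}x\\ u\end{bmatrix}=C[x-(\beta\mathbb{I}-A)^{-1}Bu]+\mathbf{G}(\beta)u$ for some $\beta\in\mathbb{C}_{\omega(\mathbb{T})}$, with $\mathrm{D}(C\&D)=\{\begin{bmatrix}x\\ u\end{bmatrix}\in X\times U: Ax+Bu\in X\}$. Generalised (distributional) solution: a triple $(u,x,y)$ with $u\in L^1_{\mathrm{loc}}([0,\infty),U)$, $x\in C([0,\infty),X_{-1})$ given by $x(t)=\mathbb{T}(t)x_0+\int_0^t\mathbb{T}_{-1}(t-s)Bu(s)\,\mathrm{d}s$ for some $x_0\in X$, and $y$ the $Y$-valued distribution $y(t)=\frac{\mathrm{d}^2}{\mathrm{d}t^2}\left((C\&D)\int_0^t(t-s)\begin{bmatrix}x(s)\\ u(s)\end{bmatrix}\mathrm{d}s\right)$, $t\ge0$ (distributional derivative). $L^\infty$-BIBO stability: $\Sigma(A,B,C,\mathbf{G})$ is $L^\infty$-BIBO stable if there exists $c>0$ such that for every generalised solution $(u,x,y)$ with $u\in L^\infty_{\mathrm{loc}}([0,\infty),U)$ and $x(0)=0$ one has $y\in L^\infty_{\mathrm{loc}}([0,\infty),Y)$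 and $\|y\|_{L^\infty([0,t],Y)}\le c\|u\|_{L^\infty([0,t],U)}$ for all $t>0$. Dual system node: $X^*$ denotes the dual space of bounded conjugate-linear functionals and $*$ the corresponding Banach space adjoint. If $A^*$ generates a strongly continuous semigroup $\mathbb{T}^*$ on $X^*$, the dual system node of $\Sigma(A,B,C,\mathbf{G})$ is the system node $\Sigma(A^*,C^*,B^*,\overline{\mathbf{G}}(\overline{\,\cdot\,}))$ on $(Y^*,X^*,U^* )$, where $\overline{\mathbf{G}}(\overline{\,\cdot\,})$ is the function $s\mapsto\mathbf{G}(\overline{s})^*\in\mathcal{L}(Y^*,U^* )$, and $(X_1)^*=(X^* )_{-1}$, $(X_{-1})^*=(X^* )_1$ (the spaces on the right being built from $A^*$), so that $C^*\in\mathcal{L}(Y^*,(X^* )_{-1})$ and $B^*\in\mathcal{L}((X^* )_1,U^* )$. *)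

theory Defs
  imports "HOL-Analysis.Analysis" "HOL-Probability.Essential_Supremum"
begin

section \<open>Complex Banach spaces\<close>

class complex_normed_vector = real_normed_vector +
  fixes scaleC :: "complex \<Rightarrow> 'a \<Rightarrow> 'a"  (infixr "*\<^sub>C" 75)
  assumes scaleC_add_right: "c *\<^sub>C (x + y) = c *\<^sub>C x + c *\<^sub>C y"
    and scaleC_add_left: "(c + d) *\<^sub>C x = c *\<^sub>C x + d *\<^sub>C x"
    and scaleC_scaleC: "c *\<^sub>C (d *\<^sub>C x) = (c * d) *\<^sub>C x"
    and scaleC_one: "1 *\<^sub>C x = x"
    and scaleR_scaleC: "r *\<^sub>R x = complex_of_real r *\<^sub>C x"
    and norm_scaleC: "norm (c *\<^sub>C x) = cmod c * norm x"

class cbanach = complex_normed_vector + banach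

global_interpretation complex_vector: vector_space
  "scaleC :: complex \<Rightarrow> 'a \<Rightarrow> 'a::complex_normed_vector"
  defines cspan = complex_vector.span
  by standard (simp_all add: scaleC_add_right scaleC_add_left scaleC_scaleC scaleC_one)

definition finite_dimensional :: "'a::complex_normed_vector set \<Rightarrow> bool"
  where "finite_dimensional V \<longleftrightarrow> (\<exists>S. finite S \<and> cspan S = V)"

lemma bounded_linear_scaleC: "bounded_linear (\<lambda>x::'a::complex_normed_vector. c *\<^sub>C x)"
proof (rule bounded_linear_intro)
  show "c *\<^sub>C (r *\<^sub>R x) = r *\<^sub>R (c *\<^sub>C x)" for r and x :: 'a
    by (simp add: scaleR_scaleC scaleC_scaleC mult.commute)
  show "norm (c *\<^sub>C x) \<le> norm x * cmod c" for x :: 'a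
    by (simp add: norm_scaleC)
qed (rule scaleC_add_right)

section \<open>The spaces of bounded operators and of bounded conjugate-linear functionals\<close>

typedef (overloaded) ('a, 'b) cblinfun  ("(_ \<Rightarrow>\<^sub>C\<^sub>L /_)" [22, 21] 21) =
  "{f :: 'a::complex_normed_vector \<Rightarrow>\<^sub>L 'b::complex_normed_vector.
      \<forall>c x. blinfun_apply f (c *\<^sub>C x) = c *\<^sub>C blinfun_apply f x}"
  by (rule exI[of _ 0]) simp

setup_lifting type_definition_cblinfun

lift_definition cblinfun_apply ::
    "('a::complex_normed_vector \<Rightarrow>\<^sub>C\<^sub>L 'b::complex_normed_vector) \<Rightarrow> 'a \<Rightarrow> 'b"
  is blinfun_apply .

declare [[coercion cblinfun_apply]]

instantiation cblinfun :: (complex_normed_vector, complex_normed_vector) complex_normed_vector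
begin

lift_definition zero_cblinfun :: "'a \<Rightarrow>\<^sub>C\<^sub>L 'b" is 0 by simp
lift_definition plus_cblinfun :: "('a \<Rightarrow>\<^sub>C\<^sub>L 'b) \<Rightarrow> ('a \<Rightarrow>\<^sub>C\<^sub>L 'b) \<Rightarrow> 'a \<Rightarrow>\<^sub>C\<^sub>L 'b" is "(+)"
  by (simp add: plus_blinfun.rep_eq scaleC_add_right)
lift_definition minus_cblinfun :: "('a \<Rightarrow>\<^sub>C\<^sub>L 'b) \<Rightarrow> ('a \<Rightarrow>\<^sub>C\<^sub>L 'b) \<Rightarrow> 'a \<Rightarrow>\<^sub>C\<^sub>L 'b" is "(-)"
  by (simp add: minus_blinfun.rep_eq complex_vector.scale_right_diff_distrib)
lift_definition uminus_cblinfun :: "('a \<Rightarrow>\<^sub>C\<^sub>L 'b) \<Rightarrow> 'a \<Rightarrow>\<^sub>C\<^sub>L 'b" is uminus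
  by (simp add: uminus_blinfun.rep_eq)
lift_definition scaleR_cblinfun :: "real \<Rightarrow> ('a \<Rightarrow>\<^sub>C\<^sub>L 'b) \<Rightarrow> 'a \<Rightarrow>\<^sub>C\<^sub>L 'b" is scaleR
  by (simp add: scaleR_blinfun.rep_eq scaleR_scaleC mult.commute)
lift_definition scaleC_cblinfun :: "complex \<Rightarrow> ('a \<Rightarrow>\<^sub>C\<^sub>L 'b) \<Rightarrow> 'a \<Rightarrow>\<^sub>C\<^sub>L 'b"
  is "\<lambda>c f. Blinfun (\<lambda>x. c *\<^sub>C blinfun_apply f x)"
  by (simp add: bounded_linear_Blinfun_apply mult.commute
      bounded_linear_compose[OF bounded_linear_scaleC blinfun.bounded_linear_right])
lift_definition norm_cblinfun :: "('a \<Rightarrow>\<^sub>C\<^sub>L 'b) \<Rightarrow> real" is norm .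
definition dist_cblinfun :: "('a \<Rightarrow>\<^sub>C\<^sub>L 'b) \<Rightarrow> ('a \<Rightarrow>\<^sub>C\<^sub>L 'b) \<Rightarrow> real"
  where "dist_cblinfun a b = norm (a - b)"
definition sgn_cblinfun :: "('a \<Rightarrow>\<^sub>C\<^sub>L 'b) \<Rightarrow> 'a \<Rightarrow>\<^sub>C\<^sub>L 'b"
  where "sgn_cblinfun x = scaleR (inverse (norm x)) x"
definition [code del]: "(uniformity :: (('a \<Rightarrow>\<^sub>C\<^sub>L 'b) \<times> ('a \<Rightarrow>\<^sub>C\<^sub>L 'b)) filter) =
  (INF e\<in>{0<..}. principal {(x, y). dist x y < e})"
definition [code del]: "open_cblinfun (S :: ('a \<Rightarrow>\<^sub>C\<^sub>L 'b) set) =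
  (\<forall>x\<in>S. \<forall>\<^sub>F (x', y) in uniformity. x' = x \<longrightarrow> y \<in> S)"

lemma cblinfun_apply_scaleC_aux:
  "cblinfun_apply (c *\<^sub>C f) x = c *\<^sub>C cblinfun_apply (f :: 'a \<Rightarrow>\<^sub>C\<^sub>L 'b) x"
  by transfer (simp add: bounded_linear_Blinfun_apply
      bounded_linear_compose[OF bounded_linear_scaleC blinfun.bounded_linear_right])

lemma cblinfun_eqI_aux:
  "(\<And>x. cblinfun_apply f x = cblinfun_apply g x) \<Longrightarrow> f = (g :: 'a \<Rightarrow>\<^sub>C\<^sub>L 'b)"
  by transfer (rule blinfun_eqI)

instance
proof
  fix f g h :: "'a \<Rightarrow>\<^sub>C\<^sub>L 'b" and r s :: real and c d :: complex
  show "f + g + h = f + (g + h)" by transfer (rule add.assoc)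
  show "f + g = g + f" by transfer (rule add.commute)
  show "0 + f = f" by transfer simp
  show "- f + f = 0" by transfer simp
  show "f - g = f + - g" by transfer simp
  show "r *\<^sub>R (f + g) = r *\<^sub>R f + r *\<^sub>R g" by transfer (rule scaleR_add_right)
  show "(r + s) *\<^sub>R f = r *\<^sub>R f + s *\<^sub>R f" by transfer (rule scaleR_add_left)
  show "r *\<^sub>R s *\<^sub>R f = (r * s) *\<^sub>R f" by transfer simp
  show "1 *\<^sub>R f = f" by transfer simp
  show "dist f g = norm (f - g)" by (rule dist_cblinfun_def)
  show "sgn f = inverse (norm f) *\<^sub>R f" by (rule sgn_cblinfun_def)
  show "(uniformity :: (('a \<Rightarrow>\<^sub>C\<^sub>L 'b) \<times> ('a \<Rightarrow>\<^sub>C\<^sub>L 'b)) filter) =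
      (INF e\<in>{0<..}. principal {(x, y). dist x y < e})"
    by (rule uniformity_cblinfun_def)
  show "open S = (\<forall>x\<in>S. \<forall>\<^sub>F (x', y) in uniformity. x' = x \<longrightarrow> y \<in> S)"
    for S :: "('a \<Rightarrow>\<^sub>C\<^sub>L 'b) set" by (rule open_cblinfun_def)
  show "(norm f = 0) = (f = 0)" by transfer simp
  show "norm (f + g) \<le> norm f + norm g" by transfer (rule norm_triangle_ineq)
  show "norm (r *\<^sub>R f) = \<bar>r\<bar> * norm f" by transfer simp
  have add: "cblinfun_apply (f + g) x = cblinfun_apply f x + cblinfun_apply g x"
    for f g :: "'a \<Rightarrow>\<^sub>C\<^sub>L 'b" and x by transfer (simp add: plus_blinfun.rep_eq)
  show "c *\<^sub>C (f + g) = c *\<^sub>C f + c *\<^sub>C g"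
    by (rule cblinfun_eqI_aux) (simp add: cblinfun_apply_scaleC_aux add scaleC_add_right)
  show "(c + d) *\<^sub>C f = c *\<^sub>C f + d *\<^sub>C f"
    by (rule cblinfun_eqI_aux) (simp add: cblinfun_apply_scaleC_aux add scaleC_add_left)
  show "c *\<^sub>C d *\<^sub>C f = (c * d) *\<^sub>C f"
    by (rule cblinfun_eqI_aux) (simp add: cblinfun_apply_scaleC_aux)
  show "1 *\<^sub>C f = f"
    by (rule cblinfun_eqI_aux) (simp add: cblinfun_apply_scaleC_aux)
  have "cblinfun_apply (r *\<^sub>R f) x = r *\<^sub>R cblinfun_apply f x" for x
    by transfer (simp add: scaleR_blinfun.rep_eq)
  then show "r *\<^sub>R f = complex_of_real r *\<^sub>C f"
    by (intro cblinfun_eqI_aux) (simp add: cblinfun_apply_scaleC_aux scaleR_scaleC)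
  show "norm (c *\<^sub>C f) = cmod c * norm f"
  proof transfer
    fix c :: complex and f :: "'a \<Rightarrow>\<^sub>L 'b"
    have bl: "bounded_linear (\<lambda>x. c *\<^sub>C blinfun_apply f x)"
      by (rule bounded_linear_compose[OF bounded_linear_scaleC blinfun.bounded_linear_right])
    have "onorm (\<lambda>x. c *\<^sub>C blinfun_apply f x) = onorm (\<lambda>x. cmod c *\<^sub>R blinfun_apply f x)"
      by (simp add: onorm_def norm_scaleC)
    also have "\<dots> = cmod c * onorm (blinfun_apply f)"
      by (subst onorm_scaleR) (auto intro: blinfun.bounded_linear_right)
    finally show "norm (Blinfun (\<lambda>x. c *\<^sub>C blinfun_apply f x)) = cmod c * norm f"
      by (simp add: norm_blinfun.rep_eq bounded_linear_Blinfun_apply[OF bl])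
  qed
qed

end

lemmas cblinfun_apply_scaleC = cblinfun_apply_scaleC_aux
lemmas cblinfun_eqI = cblinfun_eqI_aux

lemma dist_Rep_cblinfun: "dist (Rep_cblinfun f) (Rep_cblinfun g) = dist f g"
  by (simp add: dist_norm norm_cblinfun.rep_eq minus_cblinfun.rep_eq)

instance cblinfun :: (complex_normed_vector, cbanach) cbanach
proof
  fix X :: "nat \<Rightarrow> 'a \<Rightarrow>\<^sub>C\<^sub>L 'b"
  assume "Cauchy X"
  then have "Cauchy (\<lambda>n. Rep_cblinfun (X n))"
    by (simp add: Cauchy_def dist_Rep_cblinfun)
  then obtain L where L: "(\<lambda>n. Rep_cblinfun (X n)) \<longlonglongrightarrow> L"
    using convergent_eq_Cauchy by blast
  have pt: "(\<lambda>n. blinfun_apply (Rep_cblinfun (X n)) x) \<longlonglongrightarrow> blinfun_apply L x" for x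
    by (rule blinfun.tendsto[OF L tendsto_const])
  have "blinfun_apply L (c *\<^sub>C x) = c *\<^sub>C blinfun_apply L x" for c x
  proof (rule LIMSEQ_unique[OF pt])
    have "(\<lambda>n. c *\<^sub>C blinfun_apply (Rep_cblinfun (X n)) x) \<longlonglongrightarrow> c *\<^sub>C blinfun_apply L x"
      by (rule bounded_linear.tendsto[OF bounded_linear_scaleC pt])
    moreover have "blinfun_apply (Rep_cblinfun (X n)) (c *\<^sub>C x) =
        c *\<^sub>C blinfun_apply (Rep_cblinfun (X n)) x" for n
      using Rep_cblinfun[of "X n"] by simp
    ultimately show "(\<lambda>n. blinfun_apply (Rep_cblinfun (X n)) (c *\<^sub>C x))
        \<longlonglongrightarrow> c *\<^sub>C blinfun_apply L x" by simp
  qed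
  then have "Rep_cblinfun (Abs_cblinfun L) = L"
    by (simp add: Abs_cblinfun_inverse)
  with L have "X \<longlonglongrightarrow> Abs_cblinfun L"
    by (simp add: tendsto_iff flip: dist_Rep_cblinfun)
  then show "convergent X" by (auto simp: convergent_def)
qed

typedef (overloaded) 'a cdual =
  "{f :: 'a::complex_normed_vector \<Rightarrow>\<^sub>L complex.
      \<forall>c x. blinfun_apply f (c *\<^sub>C x) = cnj c * blinfun_apply f x}"
  by (rule exI[of _ 0]) simp

setup_lifting type_definition_cdual

lift_definition cdual_apply :: "'a::complex_normed_vector cdual \<Rightarrow> 'a \<Rightarrow> complex"
  is blinfun_apply .

declare [[coercion cdual_apply]]

instantiation cdual :: (complex_normed_vector) complex_normed_vector
begin

lift_definition zero_cdual :: "'a cdual" is 0 by simp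
lift_definition plus_cdual :: "'a cdual \<Rightarrow> 'a cdual \<Rightarrow> 'a cdual" is "(+)"
  by (simp add: plus_blinfun.rep_eq distrib_left)
lift_definition minus_cdual :: "'a cdual \<Rightarrow> 'a cdual \<Rightarrow> 'a cdual" is "(-)"
  by (simp add: minus_blinfun.rep_eq right_diff_distrib)
lift_definition uminus_cdual :: "'a cdual \<Rightarrow> 'a cdual" is uminus
  by (simp add: uminus_blinfun.rep_eq)
lift_definition scaleR_cdual :: "real \<Rightarrow> 'a cdual \<Rightarrow> 'a cdual" is scaleR
  by (simp add: scaleR_blinfun.rep_eq)
lift_definition scaleC_cdual :: "complex \<Rightarrow> 'a cdual \<Rightarrow> 'a cdual"
  is "\<lambda>c f. Blinfun (\<lambda>x. c * blinfun_apply f x)"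
  by (simp add: bounded_linear_Blinfun_apply mult.left_commute
      bounded_linear_const_mult blinfun.bounded_linear_right)
lift_definition norm_cdual :: "'a cdual \<Rightarrow> real" is norm .
definition dist_cdual :: "'a cdual \<Rightarrow> 'a cdual \<Rightarrow> real"
  where "dist_cdual a b = norm (a - b)"
definition sgn_cdual :: "'a cdual \<Rightarrow> 'a cdual"
  where "sgn_cdual x = scaleR (inverse (norm x)) x"
definition [code del]: "(uniformity :: ('a cdual \<times> 'a cdual) filter) =
  (INF e\<in>{0<..}. principal {(x, y). dist x y < e})"
definition [code del]: "open_cdual (S :: 'a cdual set) =
  (\<forall>x\<in>S. \<forall>\<^sub>F (x', y) in uniformity. x' = x \<longrightarrow> y \<in> S)"

lemma cdual_apply_scaleC_aux:
  "cdual_apply (c *\<^sub>C f) x = c * cdual_apply (f :: 'a cdual) x"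
  by transfer (simp add: bounded_linear_Blinfun_apply
      bounded_linear_const_mult blinfun.bounded_linear_right)

lemma cdual_eqI_aux: "(\<And>x. cdual_apply f x = cdual_apply g x) \<Longrightarrow> f = (g :: 'a cdual)"
  by transfer (rule blinfun_eqI)

instance
proof
  fix f g h :: "'a cdual" and r s :: real and c d :: complex
  show "f + g + h = f + (g + h)" by transfer (rule add.assoc)
  show "f + g = g + f" by transfer (rule add.commute)
  show "0 + f = f" by transfer simp
  show "- f + f = 0" by transfer simp
  show "f - g = f + - g" by transfer simp
  show "r *\<^sub>R (f + g) = r *\<^sub>R f + r *\<^sub>R g" by transfer (rule scaleR_add_right)
  show "(r + s) *\<^sub>R f = r *\<^sub>R f + s *\<^sub>R f" by transfer (rule scaleR_add_left)
  show "r *\<^sub>R s *\<^sub>R f = (r * s) *\<^sub>R f" by transfer simp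
  show "1 *\<^sub>R f = f" by transfer simp
  show "dist f g = norm (f - g)" by (rule dist_cdual_def)
  show "sgn f = inverse (norm f) *\<^sub>R f" by (rule sgn_cdual_def)
  show "(uniformity :: ('a cdual \<times> 'a cdual) filter) =
      (INF e\<in>{0<..}. principal {(x, y). dist x y < e})"
    by (rule uniformity_cdual_def)
  show "open S = (\<forall>x\<in>S. \<forall>\<^sub>F (x', y) in uniformity. x' = x \<longrightarrow> y \<in> S)"
    for S :: "'a cdual set" by (rule open_cdual_def)
  show "(norm f = 0) = (f = 0)" by transfer simp
  show "norm (f + g) \<le> norm f + norm g" by transfer (rule norm_triangle_ineq)
  show "norm (r *\<^sub>R f) = \<bar>r\<bar> * norm f" by transfer simp
  have add: "cdual_apply (f + g) x = cdual_apply f x + cdual_apply g x"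
    for f g :: "'a cdual" and x by transfer (simp add: plus_blinfun.rep_eq)
  show "c *\<^sub>C (f + g) = c *\<^sub>C f + c *\<^sub>C g"
    by (rule cdual_eqI_aux) (simp add: cdual_apply_scaleC_aux add distrib_left)
  show "(c + d) *\<^sub>C f = c *\<^sub>C f + d *\<^sub>C f"
    by (rule cdual_eqI_aux) (simp add: cdual_apply_scaleC_aux add distrib_right)
  show "c *\<^sub>C d *\<^sub>C f = (c * d) *\<^sub>C f"
    by (rule cdual_eqI_aux) (simp add: cdual_apply_scaleC_aux)
  show "1 *\<^sub>C f = f"
    by (rule cdual_eqI_aux) (simp add: cdual_apply_scaleC_aux)
  have "cdual_apply (r *\<^sub>R f) x = r *\<^sub>R cdual_apply f x" for x
    by transfer (simp add: scaleR_blinfun.rep_eq)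
  then show "r *\<^sub>R f = complex_of_real r *\<^sub>C f"
    by (intro cdual_eqI_aux) (simp add: cdual_apply_scaleC_aux scaleR_conv_of_real)
  show "norm (c *\<^sub>C f) = cmod c * norm f"
  proof transfer
    fix c :: complex and f :: "'a \<Rightarrow>\<^sub>L complex"
    have bl: "bounded_linear (\<lambda>x. c * blinfun_apply f x)"
      by (intro bounded_linear_const_mult blinfun.bounded_linear_right)
    have "onorm (\<lambda>x. c * blinfun_apply f x) = onorm (\<lambda>x. cmod c *\<^sub>R blinfun_apply f x)"
      by (simp add: onorm_def norm_mult)
    also have "\<dots> = cmod c * onorm (blinfun_apply f)"
      by (subst onorm_scaleR) (auto intro: blinfun.bounded_linear_right)
    finally show "norm (Blinfun (\<lambda>x. c * blinfun_apply f x)) = cmod c * norm f"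
      by (simp add: norm_blinfun.rep_eq bounded_linear_Blinfun_apply[OF bl])
  qed
qed

end

lemmas cdual_apply_scaleC = cdual_apply_scaleC_aux
lemmas cdual_eqI = cdual_eqI_aux

lemma cdual_apply_add: "cdual_apply (f + g) x = cdual_apply f x + cdual_apply g x"
  by transfer (simp add: plus_blinfun.rep_eq)

lemma cdual_apply_scaleR: "cdual_apply (r *\<^sub>R f) x = r *\<^sub>R cdual_apply f x"
  by transfer (simp add: scaleR_blinfun.rep_eq)

lemma dist_Rep_cdual: "dist (Rep_cdual f) (Rep_cdual g) = dist f g"
  by (simp add: dist_norm norm_cdual.rep_eq minus_cdual.rep_eq)

instance cdual :: (complex_normed_vector) cbanach
proof
  fix X :: "nat \<Rightarrow> 'a cdual"
  assume "Cauchy X"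
  then have "Cauchy (\<lambda>n. Rep_cdual (X n))"
    by (simp add: Cauchy_def dist_Rep_cdual)
  then obtain L where L: "(\<lambda>n. Rep_cdual (X n)) \<longlonglongrightarrow> L"
    using convergent_eq_Cauchy by blast
  have pt: "(\<lambda>n. blinfun_apply (Rep_cdual (X n)) x) \<longlonglongrightarrow> blinfun_apply L x" for x
    by (rule blinfun.tendsto[OF L tendsto_const])
  have "blinfun_apply L (c *\<^sub>C x) = cnj c * blinfun_apply L x" for c x
  proof (rule LIMSEQ_unique[OF pt])
    have "(\<lambda>n. cnj c * blinfun_apply (Rep_cdual (X n)) x) \<longlonglongrightarrow> cnj c * blinfun_apply L x"
      by (intro tendsto_intros pt)
    moreover have "blinfun_apply (Rep_cdual (X n)) (c *\<^sub>C x) =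
        cnj c * blinfun_apply (Rep_cdual (X n)) x" for n
      using Rep_cdual[of "X n"] by simp
    ultimately show "(\<lambda>n. blinfun_apply (Rep_cdual (X n)) (c *\<^sub>C x))
        \<longlonglongrightarrow> cnj c * blinfun_apply L x" by simp
  qed
  then have "Rep_cdual (Abs_cdual L) = L"
    by (simp add: Abs_cdual_inverse)
  with L have "X \<longlonglongrightarrow> Abs_cdual L"
    by (simp add: tendsto_iff flip: dist_Rep_cdual)
  then show "convergent X" by (auto simp: convergent_def)
qed

lemma bounded_linear_cadjoint_aux:
  fixes T :: "'a::complex_normed_vector \<Rightarrow>\<^sub>L 'b::complex_normed_vector"
  assumes T: "\<forall>c x. blinfun_apply T (c *\<^sub>C x) = c *\<^sub>C blinfun_apply T x"
  shows "bounded_linear (\<lambda>f. Abs_cdual (Rep_cdual f o\<^sub>L T))"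
proof (rule bounded_linear_intro[where K = "norm T"])
  have Rep: "Rep_cdual (Abs_cdual (Rep_cdual f o\<^sub>L T)) = Rep_cdual f o\<^sub>L T" for f
    using Rep_cdual[of f] T by (intro Abs_cdual_inverse) simp
  have app: "cdual_apply (Abs_cdual (Rep_cdual f o\<^sub>L T)) x = cdual_apply f (blinfun_apply T x)"
    for f x by (simp add: cdual_apply.rep_eq Rep)
  fix f g :: "'b cdual" and r :: real
  show "Abs_cdual (Rep_cdual (f + g) o\<^sub>L T) =
      Abs_cdual (Rep_cdual f o\<^sub>L T) + Abs_cdual (Rep_cdual g o\<^sub>L T)"
    by (intro cdual_eqI) (simp add: app cdual_apply_add)
  show "Abs_cdual (Rep_cdual (r *\<^sub>R f) o\<^sub>L T) = r *\<^sub>R Abs_cdual (Rep_cdual f o\<^sub>L T)"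
    by (intro cdual_eqI) (simp add: app cdual_apply_scaleR)
  show "norm (Abs_cdual (Rep_cdual f o\<^sub>L T)) \<le> norm f * norm T"
    by (simp add: norm_cdual.rep_eq Rep norm_blinfun_compose)
qed

definition cadjoint ::
    "('a::complex_normed_vector \<Rightarrow>\<^sub>C\<^sub>L 'b::complex_normed_vector) \<Rightarrow> 'b cdual \<Rightarrow>\<^sub>C\<^sub>L 'a cdual"
  where "cadjoint T =
    Abs_cblinfun (Blinfun (\<lambda>f. Abs_cdual (Rep_cdual f o\<^sub>L Rep_cblinfun T)))"

lemma cadjoint_apply: "cadjoint T f x = f (T x)"
  for T :: "'a::complex_normed_vector \<Rightarrow>\<^sub>C\<^sub>L 'b::complex_normed_vector"
proof -
  let ?T = "Rep_cblinfun T"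
  have T: "\<forall>c x. blinfun_apply ?T (c *\<^sub>C x) = c *\<^sub>C blinfun_apply ?T x"
    using Rep_cblinfun[of T] by simp
  have Rep: "Rep_cdual (Abs_cdual (Rep_cdual f o\<^sub>L ?T)) = Rep_cdual f o\<^sub>L ?T" for f
    using Rep_cdual[of f] T by (intro Abs_cdual_inverse) simp
  have app: "cdual_apply (Abs_cdual (Rep_cdual f o\<^sub>L ?T)) x = cdual_apply f (blinfun_apply ?T x)"
    for f x by (simp add: cdual_apply.rep_eq Rep)
  note bl = bounded_linear_Blinfun_apply[OF bounded_linear_cadjoint_aux[OF T]]
  have "\<forall>c f. Blinfun (\<lambda>f. Abs_cdual (Rep_cdual f o\<^sub>L ?T)) (c *\<^sub>C f) =
      c *\<^sub>C Blinfun (\<lambda>f. Abs_cdual (Rep_cdual f o\<^sub>L ?T)) f"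
    unfolding bl by (intro allI cdual_eqI) (simp add: app cdual_apply_scaleC)
  then have "Rep_cblinfun (cadjoint T) = Blinfun (\<lambda>f. Abs_cdual (Rep_cdual f o\<^sub>L ?T))"
    unfolding cadjoint_def by (intro Abs_cblinfun_inverse) simp
  then show ?thesis
    by (simp add: cblinfun_apply.rep_eq bl app)
qed

section \<open>Unbounded operators and strongly continuous semigroups\<close>

text \<open>An unbounded operator $A : D(A) \subset X \to X$ is represented by its graph;
  thus $D(A)$ is \<^term>\<open>Domain A\<close>.\<close>

type_synonym 'x operator = "('x \<times> 'x) set"

definition is_resolvent :: "'x::complex_normed_vector operator \<Rightarrow> complex \<Rightarrow> ('x \<Rightarrow>\<^sub>C\<^sub>L 'x) \<Rightarrow> bool"
  where "is_resolvent A \<mu> R \<longleftrightarrow>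
    (\<forall>(x, y)\<in>A. R (\<mu> *\<^sub>C x - y) = x) \<and> (\<forall>v. (R v, \<mu> *\<^sub>C R v - v) \<in> A)"

definition resolvent_set :: "'x::complex_normed_vector operator \<Rightarrow> complex set"
  where "resolvent_set A = {\<mu>. \<exists>R. is_resolvent A \<mu> R}"

definition resolvent :: "'x::complex_normed_vector operator \<Rightarrow> complex \<Rightarrow> 'x \<Rightarrow>\<^sub>C\<^sub>L 'x"
  where "resolvent A \<mu> = (THE R. is_resolvent A \<mu> R)"

definition operator_adjoint :: "'x::complex_normed_vector operator \<Rightarrow> 'x cdual operator"
  where "operator_adjoint A = {(f, g). \<forall>(x, y)\<in>A. cdual_apply f y = cdual_apply g x}"

definition C0_semigroup :: "(real \<Rightarrow> 'x::complex_normed_vector \<Rightarrow>\<^sub>C\<^sub>L 'x) \<Rightarrow> bool"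
  where "C0_semigroup T \<longleftrightarrow>
    (\<forall>x. T 0 x = x) \<and>
    (\<forall>s\<ge>0. \<forall>t\<ge>0. \<forall>x. T (s + t) x = T s (T t x)) \<and>
    (\<forall>x. continuous_on {0..} (\<lambda>t. T t x))"

definition generator :: "(real \<Rightarrow> 'x::complex_normed_vector \<Rightarrow>\<^sub>C\<^sub>L 'x) \<Rightarrow> 'x operator"
  where "generator T = {(x, y). ((\<lambda>h. (1 / h) *\<^sub>R (T h x - x)) \<longlongrightarrow> y) (at_right 0)}"

definition generates_C0_semigroup :: "'x::complex_normed_vector operator \<Rightarrow> bool"
  where "generates_C0_semigroup A \<longleftrightarrow> (\<exists>T. C0_semigroup T \<and> generator T = A)"

text \<open>The semigroup is determined by its generator on $[0,\infty)$ only; its values at negative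
  times are never used.\<close>

definition semigroup_of :: "'x::complex_normed_vector operator \<Rightarrow> real \<Rightarrow> 'x \<Rightarrow>\<^sub>C\<^sub>L 'x"
  where "semigroup_of A = (SOME T. C0_semigroup T \<and> generator T = A)"

text \<open>The growth bound is $-\infty$ for, e.g., nilpotent semigroups.\<close>

definition growth_bound :: "(real \<Rightarrow> 'x::complex_normed_vector \<Rightarrow>\<^sub>C\<^sub>L 'x) \<Rightarrow> ereal"
  where "growth_bound T =
    (INF \<omega>\<in>{\<omega>. \<exists>M. \<forall>t\<ge>0. norm (T t) \<le> M * exp (\<omega> * t)}. ereal \<omega>)"

definition half_plane :: "ereal \<Rightarrow> complex set"
  where "half_plane \<alpha> = {z. \<alpha> < ereal (Re z)}"

definition analytic_map :: "(complex \<Rightarrow> 'a::complex_normed_vector) \<Rightarrow> complex set \<Rightarrow> bool"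
  where "analytic_map F S \<longleftrightarrow>
    (\<forall>z\<in>S. \<exists>D. ((\<lambda>w. inverse (w - z) *\<^sub>C (F w - F z)) \<longlongrightarrow> D) (at z))"

section \<open>The spaces $X_1$ and $X_{-1}$\<close>

text \<open>As they depend on the operator $A$, the spaces $X_1$ and $X_{-1}$ are Banach spaces
  \<open>'x1\<close>, \<open>'xm\<close> together with embeddings \<open>i : X_1 \<rightarrow> X\<close> and \<open>j : X \<rightarrow> X_{-1}\<close>. Up to isometric
  isomorphism the conditions below determine them uniquely; lemmas \<open>is_X1_resolvent\<close> and
  \<open>is_Xm1_resolvent\<close> show that every densely
  defined operator with nonempty resolvent set admits such a realisation, on the type of $X$ itself.\<close>

definition is_X1 ::
    "'x operator \<Rightarrow> complex \<Rightarrow> ('x1::cbanach \<Rightarrow>\<^sub>C\<^sub>L 'x::cbanach) \<Rightarrow> bool"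
  where "is_X1 A \<beta> i \<longleftrightarrow>
    inj (cblinfun_apply i) \<and> range (cblinfun_apply i) = Domain A \<and>
    (\<forall>z y. (i z, y) \<in> A \<longrightarrow> norm z = norm (\<beta> *\<^sub>C i z - y))"

definition is_Xm1 ::
    "'x operator \<Rightarrow> complex \<Rightarrow> ('x::cbanach \<Rightarrow>\<^sub>C\<^sub>L 'xm::cbanach) \<Rightarrow> bool"
  where "is_Xm1 A \<beta> j \<longleftrightarrow>
    (\<forall>x. norm (j x) = norm (resolvent A \<beta> x)) \<and> closure (range (cblinfun_apply j)) = UNIV"

lemma is_resolvent_inj:
  assumes "is_resolvent A \<beta> R" "single_valued A" "R v = R w"
  shows "v = w"
proof -
  have "(R v, \<beta> *\<^sub>C R v - v) \<in> A" "(R w, \<beta> *\<^sub>C R w - w) \<in> A"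
    using assms(1) by (auto simp: is_resolvent_def)
  with assms(2,3) have "\<beta> *\<^sub>C R v - v = \<beta> *\<^sub>C R v - w"
    by (auto simp: single_valued_def)
  then show ?thesis by simp
qed

lemma range_is_resolvent:
  assumes "is_resolvent A \<beta> R"
  shows "range (cblinfun_apply R) = Domain A"
proof
  show "range (cblinfun_apply R) \<subseteq> Domain A"
    using assms by (auto simp: is_resolvent_def)
  show "Domain A \<subseteq> range (cblinfun_apply R)"
  proof
    fix x assume "x \<in> Domain A"
    then obtain y where "(x, y) \<in> A" by blast
    with assms have "x = R (\<beta> *\<^sub>C x - y)" by (auto simp: is_resolvent_def)
    then show "x \<in> range (cblinfun_apply R)" by blast
  qed
qed

lemma resolvent_eq:
  assumes "is_resolvent A \<beta> R"
  shows "resolvent A \<beta> = R"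
  unfolding resolvent_def
proof (rule the_equality, rule assms)
  fix S assume S: "is_resolvent A \<beta> S"
  show "S = R"
  proof (rule cblinfun_eqI)
    fix v
    have "(S v, \<beta> *\<^sub>C S v - v) \<in> A"
      using S by (simp add: is_resolvent_def)
    then have "R (\<beta> *\<^sub>C S v - (\<beta> *\<^sub>C S v - v)) = S v"
      using assms unfolding is_resolvent_def by blast
    then show "S v = R v" by simp
  qed
qed

lemma is_X1_resolvent:
  fixes A :: "'x::cbanach operator"
  assumes "\<beta> \<in> resolvent_set A" "single_valued A"
  shows "is_X1 A \<beta> (resolvent A \<beta>)"
proof -
  obtain R where R: "is_resolvent A \<beta> R"
    using assms(1) by (auto simp: resolvent_set_def)
  have "norm z = norm (\<beta> *\<^sub>C R z - y)" if "(R z, y) \<in> A" for z y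
  proof -
    have "R (\<beta> *\<^sub>C R z - y) = R z"
      using R that by (auto simp: is_resolvent_def)
    then show ?thesis
      using is_resolvent_inj[OF R assms(2)] by metis
  qed
  then show ?thesis
    unfolding resolvent_eq[OF R] is_X1_def range_is_resolvent[OF R]
    using is_resolvent_inj[OF R assms(2)] by (auto intro: injI)
qed

lemma is_Xm1_resolvent:
  fixes A :: "'x::cbanach operator"
  assumes "\<beta> \<in> resolvent_set A" "closure (Domain A) = UNIV"
  shows "is_Xm1 A \<beta> (resolvent A \<beta>)"
proof -
  obtain R where R: "is_resolvent A \<beta> R"
    using assms(1) by (auto simp: resolvent_set_def)
  show ?thesis
    unfolding resolvent_eq[OF R] is_Xm1_def range_is_resolvent[OF R] using assms(2) by simp
qed

text \<open>The continuous extension of \<open>L : V \<rightarrow> W\<close> along a dense embedding \<open>e : V \<rightarrow> V'\<close>.\<close>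

definition extension ::
    "('v::cbanach \<Rightarrow>\<^sub>C\<^sub>L 'w::cbanach) \<Rightarrow> ('v \<Rightarrow> 'z::cbanach) \<Rightarrow> 'w \<Rightarrow>\<^sub>C\<^sub>L 'z"
  where "extension e L = (THE E. \<forall>v. cblinfun_apply E (e v) = L v)"

section \<open>System nodes\<close>

record (overloaded) ('u, 'x1, 'x, 'xm, 'y) node =
  gen :: "('x::cbanach) operator"
  emb1 :: "'x1::cbanach \<Rightarrow>\<^sub>C\<^sub>L 'x"
  embm1 :: "'x \<Rightarrow>\<^sub>C\<^sub>L 'xm::cbanach"
  inp :: "'u::cbanach \<Rightarrow>\<^sub>C\<^sub>L 'xm"
  outp :: "'x1 \<Rightarrow>\<^sub>C\<^sub>L 'y::cbanach"
  transfer_fun :: "complex \<Rightarrow> 'u \<Rightarrow>\<^sub>C\<^sub>L 'y"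

definition node_domain :: "('u::cbanach, 'x1::cbanach, 'x::cbanach, 'xm::cbanach, 'y::cbanach) node \<Rightarrow> complex set"
  where "node_domain N = half_plane (growth_bound (semigroup_of (gen N)))"

text \<open>The extensions to $X_{-1}$ of $(\alpha - A)^{-1}$ (with values in $X$), of $A$ (defined on $X$)
  and of the semigroup.\<close>

definition ext_resolvent :: "('u::cbanach, 'x1::cbanach, 'x::cbanach, 'xm::cbanach, 'y::cbanach) node \<Rightarrow>
    complex \<Rightarrow> 'xm \<Rightarrow>\<^sub>C\<^sub>L 'x"
  where "ext_resolvent N \<alpha> = extension (embm1 N) (resolvent (gen N) \<alpha>)"

definition ext_gen :: "('u::cbanach, 'x1::cbanach, 'x::cbanach, 'xm::cbanach, 'y::cbanach) node \<Rightarrow>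
    'x \<Rightarrow>\<^sub>C\<^sub>L 'xm"
  where "ext_gen N = (THE E. \<forall>(x, y)\<in>gen N. cblinfun_apply E x = embm1 N y)"

definition ext_semigroup :: "('u::cbanach, 'x1::cbanach, 'x::cbanach, 'xm::cbanach, 'y::cbanach) node \<Rightarrow>
    real \<Rightarrow> 'xm \<Rightarrow>\<^sub>C\<^sub>L 'xm"
  where "ext_semigroup N t = extension (embm1 N) (\<lambda>x. embm1 N (semigroup_of (gen N) t x))"

definition system_node :: "('u::cbanach, 'x1::cbanach, 'x::cbanach, 'xm::cbanach, 'y::cbanach) node \<Rightarrow> bool"
  where "system_node N \<longleftrightarrow>
    generates_C0_semigroup (gen N) \<and>
    (\<exists>\<beta>\<in>resolvent_set (gen N). is_X1 (gen N) \<beta> (emb1 N) \<and> is_Xm1 (gen N) \<beta> (embm1 N)) \<and>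
    analytic_map (transfer_fun N) (node_domain N) \<and>
    (\<forall>\<alpha>\<in>node_domain N. \<forall>\<beta>\<in>node_domain N. \<forall>u. \<exists>z.
      emb1 N z = ext_resolvent N \<alpha> (inp N u) - ext_resolvent N \<beta> (inp N u) \<and>
      transfer_fun N \<alpha> u - transfer_fun N \<beta> u = outp N z)"

text \<open>The graph of $C\&D$; the value does not depend on the choice of $\beta$.\<close>

definition CD :: "('u::cbanach, 'x1::cbanach, 'x::cbanach, 'xm::cbanach, 'y::cbanach) node \<Rightarrow>
    (('x \<times> 'u) \<times> 'y) set"
  where "CD N = {((x, u), outp N z + transfer_fun N \<beta> u) | x u z \<beta>.
    ext_gen N x + inp N u \<in> range (cblinfun_apply (embm1 N)) \<and>
    \<beta> \<in> node_domain N \<and> emb1 N z = x - ext_resolvent N \<beta> (inp N u)}"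

section \<open>Distributions and generalised solutions\<close>

text \<open>Distributions on the open interval $(0,\infty)$ are given by their values on real-valued
  test functions, which determine those on complex-valued ones.\<close>

definition test_function :: "(real \<Rightarrow> real) \<Rightarrow> bool"
  where "test_function \<phi> \<longleftrightarrow>
    (\<forall>n. (deriv ^^ n) \<phi> differentiable_on UNIV) \<and>
    (\<exists>a b. 0 < a \<and> (\<forall>t. \<phi> t \<noteq> 0 \<longrightarrow> a \<le> t \<and> t \<le> b))"

type_synonym 'y distribution = "(real \<Rightarrow> real) \<Rightarrow> 'y"

definition regular_distribution :: "(real \<Rightarrow> 'y::banach) \<Rightarrow> 'y distribution"
  where "regular_distribution f \<phi> = integral {0..} (\<lambda>t. \<phi> t *\<^sub>R f t)"

definition distribution_deriv :: "'y::banach distribution \<Rightarrow> 'y distribution"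
  where "distribution_deriv y \<phi> = - y (deriv \<phi>)"

text \<open>Because Bochner integrals in the library require second countable spaces, integrals of
  vector-valued functions are Henstock--Kurzweil integrals, which extend Bochner integrals;
  \<^const>\<open>measurable_on\<close> is strong Lebesgue measurability.\<close>

definition L1_loc :: "(real \<Rightarrow> 'a::banach) \<Rightarrow> bool"
  where "L1_loc f \<longleftrightarrow>
    f measurable_on {0..} \<and> (\<forall>t>0. (\<lambda>s. norm (f s)) integrable_on {0..t})"

definition Linf_norm :: "real \<Rightarrow> (real \<Rightarrow> 'a::banach) \<Rightarrow> ereal"
  where "Linf_norm t f = esssup (lebesgue_on {0..t}) (\<lambda>s. ereal (norm (f s)))"

definition Linf_loc :: "(real \<Rightarrow> 'a::banach) \<Rightarrow> bool"
  where "Linf_loc f \<longleftrightarrow> f measurable_on {0..} \<and> (\<forall>t>0. Linf_norm t f < \<infinity>)"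

definition generalised_solution :: "('u::cbanach, 'x1::cbanach, 'x::cbanach, 'xm::cbanach, 'y::cbanach) node \<Rightarrow>
    (real \<Rightarrow> 'u) \<Rightarrow> (real \<Rightarrow> 'xm) \<Rightarrow> 'y distribution \<Rightarrow> bool"
  where "generalised_solution N u x y \<longleftrightarrow>
    L1_loc u \<and>
    continuous_on {0..} x \<and>
    (\<exists>x0. \<forall>t\<ge>0. x t = embm1 N (semigroup_of (gen N) t x0) +
      integral {0..t} (\<lambda>s. ext_semigroup N (t - s) (inp N (u s)))) \<and>
    (\<exists>h. (\<forall>t\<ge>0. \<exists>z.
            embm1 N z = integral {0..t} (\<lambda>s. (t - s) *\<^sub>R x s) \<and>
            ((z, integral {0..t} (\<lambda>s. (t - s) *\<^sub>R u s)), h t) \<in> CD N) \<and>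
         (\<forall>\<phi>. test_function \<phi> \<longrightarrow>
            y \<phi> = distribution_deriv (distribution_deriv (regular_distribution h)) \<phi>))"

section \<open>BIBO stability and the dual system node\<close>

definition Linf_BIBO_stable :: "('u::cbanach, 'x1::cbanach, 'x::cbanach, 'xm::cbanach, 'y::cbanach) node \<Rightarrow> bool"
  where "Linf_BIBO_stable N \<longleftrightarrow>
    (\<exists>c::real>0. \<forall>u x y. generalised_solution N u x y \<and> Linf_loc u \<and> x 0 = 0 \<longrightarrow>
      (\<exists>g. Linf_loc g \<and>
        (\<forall>\<phi>. test_function \<phi> \<longrightarrow> y \<phi> = regular_distribution g \<phi>) \<and>
        (\<forall>t>0. Linf_norm t g \<le> ereal c * Linf_norm t u)))"

text \<open>The identifications $(X^*)_1 = (X_{-1})^*$ and $(X^*)_{-1} = (X_1)^*$ are made by the adjoints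
  of the embeddings.\<close>

definition dual_node :: "('u::cbanach, 'x1::cbanach, 'x::cbanach, 'xm::cbanach, 'y::cbanach) node \<Rightarrow>
    ('y cdual, 'xm cdual, 'x cdual, 'x1 cdual, 'u cdual) node"
  where "dual_node N = \<lparr>
    gen = operator_adjoint (gen N),
    emb1 = cadjoint (embm1 N),
    embm1 = cadjoint (emb1 N),
    inp = cadjoint (outp N),
    outp = cadjoint (inp N),
    transfer_fun = (\<lambda>s. cadjoint (transfer_fun N (cnj s)))\<rparr>"

end

theory Submission
  imports Defs
begin

text \<open>
  For a constant direction \<open>a\<close> of the input, the output of a system node with zero initial state is
  the second distributional derivative of the convolution of the scalar input with a continuous
  kernel \<open>k a\<close>, the twice integrated impulse response. Since
  $k(t) a$ is built from $C (\beta - A)^{-1} \mathbb{T}(t) (\beta - A)^{-1} B a$, the kernel of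
  the dual node is the adjoint of \<open>k\<close>. When \<open>U\<close> and \<open>Y\<close> are
  finite-dimensional, the entries of a matrix of scalar kernels decide about stability, and passing
  to the adjoint only transposes and conjugates this matrix. Thus a bounded dual output is assembled
  from the outputs of the original node for the inputs \<open>cnj (w s) a\<close>, where \<open>w\<close> runs over the
  coordinates of the dual input.

  That the dual node is a system node rests on $\mathbb{T}^*(t) = \mathbb{T}(t)^*$ and on the equality
  of the growth bounds, for which $\|\mathbb{T}(t)^*\| = \|\mathbb{T}(t)\|$ is needed and hence the
  Hahn--Banach theorem.
\<close>

section \<open>Bounded operators and functionals\<close>

text \<open>Duality of input-output maps usually reverses time. Here every input is a finite sum of
  scalar functions times fixed vectors, and on such inputs both nodes act by forward convolution, so
  only the kernel has to be dualised and bounds on [0, t] carry over interval by interval. One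
  obstacle is that outputs are mere distributions and states live only in X_{-1}. The comparison
  therefore takes place at the continuous functions h of which outputs are second derivatives: they
  are determined by the input, because \<open>j\<close> is injective and C&D is single-valued, and
  fixed linear maps commute with the double derivative. The other obstacle is that C acts only on
  X_1 while B maps into X_{-1}. One factor (\<beta> - A)^{-1} is spent on each, and the two factors
  \<beta> - A that compensate for them are absorbed by the two integrations in time; this is why the
  kernel is continuous. The dual constant is a sum over pairs of frame vectors, weighted by their
  norms and by those of the coordinate functionals.\<close>

lemma scaleC_scaleR_commute: "c *\<^sub>C (r *\<^sub>R x) = r *\<^sub>R (c *\<^sub>C (x::'a::complex_normed_vector))"
  by (simp add: scaleR_scaleC scaleC_scaleC mult.commute)

lemma bounded_bilinear_scaleC:
  "bounded_bilinear (scaleC :: complex \<Rightarrow> 'a \<Rightarrow> 'a::complex_normed_vector)"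
proof
  show "\<exists>K. \<forall>c (x::'a). norm (c *\<^sub>C x) \<le> norm c * norm x * K"
    by (rule exI[of _ 1]) (simp add: norm_scaleC)
qed (simp_all add: scaleC_add_left scaleC_add_right scaleC_scaleR_commute,
     simp add: scaleR_scaleC scaleC_scaleC scaleR_conv_of_real)

lemmas bounded_linear_scaleC_left = bounded_bilinear.bounded_linear_left[OF bounded_bilinear_scaleC]
lemmas continuous_on_scaleC = bounded_bilinear.continuous_on[OF bounded_bilinear_scaleC]
lemmas tendsto_scaleC = bounded_bilinear.tendsto[OF bounded_bilinear_scaleC]

lemma cblinfun_scaleC_right [simp]:
  fixes f :: "'a::complex_normed_vector \<Rightarrow>\<^sub>C\<^sub>L 'b::complex_normed_vector"
  shows "f (c *\<^sub>C x) = c *\<^sub>C f x"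
  using Rep_cblinfun[of f] by (simp add: cblinfun_apply.rep_eq)

lemma bounded_bilinear_cblinfun_apply:
  "bounded_bilinear (cblinfun_apply :: ('a::complex_normed_vector \<Rightarrow>\<^sub>C\<^sub>L 'b::complex_normed_vector) \<Rightarrow> _)"
proof
  fix f g :: "'a \<Rightarrow>\<^sub>C\<^sub>L 'b" and x y r
  show "(f + g) x = f x + g x" "f (x + y) = f x + f y" "(r *\<^sub>R f) x = r *\<^sub>R f x" "f (r *\<^sub>R x) = r *\<^sub>R f x"
    by (simp_all add: cblinfun_apply.rep_eq plus_cblinfun.rep_eq scaleR_cblinfun.rep_eq
        blinfun.bilinear_simps)
  show "\<exists>K. \<forall>(f::'a \<Rightarrow>\<^sub>C\<^sub>L 'b) x. norm (cblinfun_apply f x) \<le> norm f * norm x * K"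
    by (rule exI[of _ 1]) (simp add: cblinfun_apply.rep_eq norm_cblinfun.rep_eq norm_blinfun)
qed

interpretation cblinfun: bounded_bilinear cblinfun_apply
  by (rule bounded_bilinear_cblinfun_apply)

lemma norm_cblinfun: "norm (f x) \<le> norm f * norm x"
  for f :: "'a::complex_normed_vector \<Rightarrow>\<^sub>C\<^sub>L 'b::complex_normed_vector"
  by (simp add: cblinfun_apply.rep_eq norm_cblinfun.rep_eq norm_blinfun)

lemma norm_cblinfun_bound:
  fixes f :: "'a::complex_normed_vector \<Rightarrow>\<^sub>C\<^sub>L 'b::complex_normed_vector"
  assumes "0 \<le> b" "\<And>x. norm (f x) \<le> b * norm x"
  shows "norm f \<le> b"
  unfolding norm_cblinfun.rep_eq using assms
  by (intro norm_blinfun_bound) (simp_all add: cblinfun_apply.rep_eq)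

lemma cdual_scaleC_right [simp]: "cdual_apply f (c *\<^sub>C x) = cnj c * cdual_apply f x"
  using Rep_cdual[of f] by (simp add: cdual_apply.rep_eq)

lemma bounded_bilinear_cdual_apply:
  "bounded_bilinear (cdual_apply :: 'a::complex_normed_vector cdual \<Rightarrow> _)"
proof
  fix f g :: "'a cdual" and x y r
  show "(f + g) x = f x + g x" "f (x + y) = f x + f y" "(r *\<^sub>R f) x = r *\<^sub>R f x" "f (r *\<^sub>R x) = r *\<^sub>R f x"
    by (simp_all add: cdual_apply.rep_eq plus_cdual.rep_eq scaleR_cdual.rep_eq
        blinfun.bilinear_simps)
  show "\<exists>K. \<forall>(f::'a cdual) x. norm (cdual_apply f x) \<le> norm f * norm x * K"
    by (rule exI[of _ 1]) (simp add: cdual_apply.rep_eq norm_cdual.rep_eq norm_blinfun)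
qed

interpretation cdual: bounded_bilinear cdual_apply
  by (rule bounded_bilinear_cdual_apply)

lemma norm_cdual: "cmod (cdual_apply f x) \<le> norm f * norm x"
  by (simp add: cdual_apply.rep_eq norm_cdual.rep_eq norm_blinfun)

lemma norm_cdual_bound:
  assumes "0 \<le> b" "\<And>x. norm (cdual_apply f x) \<le> b * norm x"
  shows "norm f \<le> b"
  unfolding norm_cdual.rep_eq using assms
  by (intro norm_blinfun_bound) (simp_all add: cdual_apply.rep_eq)

lemma cblinfun_exists:
  fixes L :: "'a::complex_normed_vector \<Rightarrow> 'b::complex_normed_vector"
  assumes "bounded_linear L" "\<And>c x. L (c *\<^sub>C x) = c *\<^sub>C L x"
  obtains F :: "'a \<Rightarrow>\<^sub>C\<^sub>L 'b" where "\<And>x. F x = L x"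
proof
  show "Abs_cblinfun (Blinfun L) x = L x" for x
    using assms by (simp add: cblinfun_apply.rep_eq Abs_cblinfun_inverse bounded_linear_Blinfun_apply)
qed

lemma cblinfun_exists_norm:
  fixes L :: "'a::complex_normed_vector \<Rightarrow> 'b::complex_normed_vector"
  assumes "\<And>x y. L (x + y) = L x + L y" "\<And>c x. L (c *\<^sub>C x) = c *\<^sub>C L x"
    and "\<And>x. norm (L x) \<le> norm x * K"
  obtains F :: "'a \<Rightarrow>\<^sub>C\<^sub>L 'b" where "\<And>x. F x = L x"
proof -
  have "bounded_linear L"
    using assms by (intro bounded_linear_intro) (auto simp: scaleR_scaleC)
  then show thesis using cblinfun_exists[of L] assms(2) that by blast
qed

lemma cdual_exists_norm:
  fixes L :: "'a::complex_normed_vector \<Rightarrow> complex"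
  assumes "\<And>x y. L (x + y) = L x + L y" "\<And>c x. L (c *\<^sub>C x) = cnj c * L x"
    and "\<And>x. norm (L x) \<le> norm x * K"
  obtains F :: "'a cdual" where "\<And>x. F x = L x"
proof
  have "bounded_linear L"
    using assms by (intro bounded_linear_intro) (auto simp: scaleR_scaleC scaleR_conv_of_real)
  then show "cdual_apply (Abs_cdual (Blinfun L)) x = L x" for x
    using assms by (simp add: cdual_apply.rep_eq Abs_cdual_inverse bounded_linear_Blinfun_apply)
qed

text \<open>Defined by choice, with \<open>ccompose_apply\<close> as its only interface; it serves
  to read a product of two resolvents as a bounded operator.\<close>

definition ccompose :: "('b::complex_normed_vector \<Rightarrow>\<^sub>C\<^sub>L 'c::complex_normed_vector) \<Rightarrow>
    ('a::complex_normed_vector \<Rightarrow>\<^sub>C\<^sub>L 'b) \<Rightarrow> 'a \<Rightarrow>\<^sub>C\<^sub>L 'c"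
  where "ccompose f g = (SOME h. \<forall>x. cblinfun_apply h x = f (g x))"

lemma ccompose_apply [simp]: "ccompose f g x = f (g x)"
proof -
  have "bounded_linear (\<lambda>x. f (g x))"
    by (rule bounded_linear_compose[OF cblinfun.bounded_linear_right cblinfun.bounded_linear_right])
  then obtain h where "\<forall>x. cblinfun_apply h x = f (g x)"
    using cblinfun_exists[of "\<lambda>x. f (g x)"] by auto
  then have "\<forall>x. ccompose f g x = f (g x)"
    unfolding ccompose_def by (rule someI)
  then show ?thesis by simp
qed

lemmas [simp] = cadjoint_apply cblinfun_apply_scaleC cdual_apply_scaleC
  cblinfun.add_left cblinfun.diff_left cblinfun.zero_left cblinfun.add_right cblinfun.diff_right
  cblinfun.zero_right cblinfun.scaleR_left cblinfun.scaleR_right cblinfun.minus_left cblinfun.minus_right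
  cdual.add_left cdual.diff_left cdual.zero_left cdual.add_right cdual.diff_right
  cdual.zero_right cdual.scaleR_left cdual.scaleR_right cdual.minus_left cdual.minus_right

section \<open>Adjoints of bounded operators\<close>

lemma norm_cadjoint_le: "norm (cadjoint T) \<le> norm T"
proof (rule norm_cblinfun_bound)
  fix f
  show "norm (cadjoint T f) \<le> norm T * norm f"
  proof (rule norm_cdual_bound)
    fix x
    have "norm (cdual_apply f (T x)) \<le> norm f * (norm T * norm x)"
      by (rule order_trans[OF norm_cdual]) (simp add: mult_left_mono norm_cblinfun)
    then show "norm (cdual_apply (cadjoint T f) x) \<le> norm T * norm f * norm x"
      by (simp add: ac_simps)
  qed simp
qed simp

lemma cadjoint_add: "cadjoint (S + T) = cadjoint S + cadjoint T"
  by (intro cblinfun_eqI cdual_eqI) simp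

lemma cadjoint_diff: "cadjoint (S - T) = cadjoint S - cadjoint T"
  by (intro cblinfun_eqI cdual_eqI) simp

lemma cadjoint_scaleC: "cadjoint (c *\<^sub>C T) = cnj c *\<^sub>C cadjoint T"
  by (intro cblinfun_eqI cdual_eqI) simp

lemma bounded_linear_cadjoint: "bounded_linear cadjoint"
  by (rule bounded_linear_intro[where K = 1])
     (simp_all add: cadjoint_add norm_cadjoint_le scaleR_scaleC cadjoint_scaleC)

section \<open>Agreement on, and extension from, dense subspaces\<close>

lemma continuous_eq_on_dense:
  fixes f g :: "'a::topological_space \<Rightarrow> 'b::t2_space"
  assumes "continuous_on UNIV f" "continuous_on UNIV g"
    and "closure S = UNIV" and "\<And>x. x \<in> S \<Longrightarrow> f x = g x"
  shows "f x = g x"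
proof -
  have "closed {x. f x = g x}"
    using assms by (intro closed_Collect_eq)
  then have "closure S \<subseteq> {x. f x = g x}"
    using assms(4) by (intro closure_minimal) auto
  then show ?thesis using assms(3) by auto
qed

lemma cblinfun_eq_on_dense:
  fixes F G :: "'a::complex_normed_vector \<Rightarrow>\<^sub>C\<^sub>L 'b::complex_normed_vector"
  assumes "closure (range e) = UNIV" "\<And>v. F (e v) = G (e v)"
  shows "F = G"
proof (rule cblinfun_eqI)
  show "F x = G x" for x
    by (rule continuous_eq_on_dense[OF _ _ assms(1)])
       (use assms(2) in \<open>auto intro!: cblinfun.continuous_on continuous_intros\<close>)
qed

text \<open>The bound by \<open>norm (e x)\<close> makes L factor through e. The closure of the set
  of pairs (e v, L v) is then the graph of the extension: density and completeness give it full
  domain, the bound makes it single-valued.\<close>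

lemma extension_exists:
  fixes e :: "'v::cbanach \<Rightarrow>\<^sub>C\<^sub>L 'w::cbanach" and L :: "'v \<Rightarrow> 'z::cbanach"
  assumes dense: "closure (range (cblinfun_apply e)) = UNIV"
    and add: "\<And>x y. L (x + y) = L x + L y" and scale: "\<And>c x. L (c *\<^sub>C x) = c *\<^sub>C L x"
    and bound: "\<And>x. norm (L x) \<le> K * norm (e x)"
  obtains E :: "'w \<Rightarrow>\<^sub>C\<^sub>L 'z" where "\<And>v. E (e v) = L v"
proof -
  \<comment> \<open>A nonnegative constant; K itself carries no sign.\<close>
  define K' where "K' = max K 0"
  have bound': "norm (L x) \<le> K' * norm (e x)" for x
    by (rule order_trans[OF bound]) (simp add: K'_def mult_right_mono)
  have diff: "L (x - y) = L x - L y" for x y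
    using add[of "x - y" y] by (simp add: algebra_simps)
  define P where "P w z \<longleftrightarrow> (\<exists>v. (\<lambda>n. e (v n)) \<longlonglongrightarrow> w \<and> (\<lambda>n. L (v n)) \<longlonglongrightarrow> z)" for w z
  have ex: "\<exists>z. P w z" for w
  proof -
    have "w \<in> closure (range (cblinfun_apply e))" using dense by simp
    then obtain u where u: "\<forall>n. u n \<in> range (cblinfun_apply e)" "u \<longlonglongrightarrow> w"
      unfolding closure_sequential by blast
    then have "\<forall>n. \<exists>v. u n = e v" by auto
    then obtain v where v: "\<And>n. u n = e (v n)" by metis
    have lim: "(\<lambda>n. e (v n)) \<longlonglongrightarrow> w" using u(2) unfolding v .
    then have "Cauchy (\<lambda>n. e (v n))" by (rule LIMSEQ_imp_Cauchy)
    have "Cauchy (\<lambda>n. L (v n))"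
      unfolding Cauchy_def
    proof (intro allI impI)
      fix r :: real assume "r > 0"
      \<comment> \<open>K' + 1 as divisor, since K' may vanish.\<close>
      then have "r / (K' + 1) > 0" by (simp add: K'_def)
      then obtain M where M: "\<And>m n. m \<ge> M \<Longrightarrow> n \<ge> M \<Longrightarrow> dist (e (v m)) (e (v n)) < r / (K' + 1)"
        using \<open>Cauchy (\<lambda>n. e (v n))\<close> unfolding Cauchy_def by blast
      have "dist (L (v m)) (L (v n)) < r" if "m \<ge> M" "n \<ge> M" for m n
      proof -
        have "dist (L (v m)) (L (v n)) \<le> (K' + 1) * dist (e (v m)) (e (v n))"
          using bound'[of "v m - v n"] by (simp add: dist_norm diff algebra_simps add_increasing)
        also have "\<dots> < (K' + 1) * (r / (K' + 1))"
          using M[OF that] by (intro mult_strict_left_mono) (auto simp: K'_def)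
        finally show ?thesis by (simp add: K'_def)
      qed
      then show "\<exists>M. \<forall>m\<ge>M. \<forall>n\<ge>M. dist (L (v m)) (L (v n)) < r" by blast
    qed
    then obtain z where "(\<lambda>n. L (v n)) \<longlonglongrightarrow> z"
      using Cauchy_convergent convergent_def by blast
    with lim show ?thesis unfolding P_def by blast
  qed
  have P_norm: "norm z \<le> K' * norm w" if P: "P w z" for w z
  proof -
    obtain v where v: "(\<lambda>n. e (v n)) \<longlonglongrightarrow> w" "(\<lambda>n. L (v n)) \<longlonglongrightarrow> z"
      using P unfolding P_def by blast
    show ?thesis
      by (rule LIMSEQ_le[OF tendsto_norm[OF v(2)] tendsto_mult_left[OF tendsto_norm[OF v(1)], of K']])
         (use bound' in auto)
  qed
  have P_add: "P (w + w') (z + z')" if "P w z" "P w' z'" for w w' z z'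
  proof -
    obtain v v' where v: "(\<lambda>n. e (v n)) \<longlonglongrightarrow> w" "(\<lambda>n. L (v n)) \<longlonglongrightarrow> z"
      and v': "(\<lambda>n. e (v' n)) \<longlonglongrightarrow> w'" "(\<lambda>n. L (v' n)) \<longlonglongrightarrow> z'"
      using \<open>P w z\<close> \<open>P w' z'\<close> unfolding P_def by blast
    show ?thesis unfolding P_def
      by (rule exI[of _ "\<lambda>n. v n + v' n"]) (simp add: add tendsto_add v v')
  qed
  have P_scale: "P (c *\<^sub>C w) (c *\<^sub>C z)" if "P w z" for c w z
  proof -
    obtain v where v: "(\<lambda>n. e (v n)) \<longlonglongrightarrow> w" "(\<lambda>n. L (v n)) \<longlonglongrightarrow> z"
      using \<open>P w z\<close> unfolding P_def by blast
    show ?thesis unfolding P_def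
      by (rule exI[of _ "\<lambda>n. c *\<^sub>C v n"])
         (simp add: scale bounded_linear.tendsto[OF bounded_linear_scaleC] v)
  qed
  have P_unique: "z = z'" if "P w z" "P w z'" for w z z'
  proof -
    have "P (w + (-1) *\<^sub>C w) (z + (-1) *\<^sub>C z')"
      by (intro P_add P_scale that)
    then have "norm (z - z') \<le> K' * norm (w - w)"
      by (intro P_norm) (simp add: complex_vector.scale_minus_left)
    then show ?thesis by simp
  qed
  define f where "f w = (THE z. P w z)" for w
  have f: "f w = z" if "P w z" for w z
    unfolding f_def using that P_unique by blast
  have Pf: "P w (f w)" for w
    using ex[of w] f by auto
  obtain E :: "'w \<Rightarrow>\<^sub>C\<^sub>L 'z" where E: "\<And>x. E x = f x"
  proof (rule cblinfun_exists_norm[of f K'])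
    show "f (x + y) = f x + f y" "f (c *\<^sub>C x) = c *\<^sub>C f x" for x y c
      using f P_add P_scale Pf by blast+
    show "norm (f x) \<le> norm x * K'" for x
      using P_norm[OF Pf] by (simp add: mult.commute)
  qed (rule that)
  have "P (e v) (L v)" for v
    unfolding P_def by (rule exI[of _ "\<lambda>_. v"]) simp
  then have "E (e v) = L v" for v using E f by simp
  then show thesis by (rule that)
qed

lemma extension_eq:
  fixes e :: "'v::cbanach \<Rightarrow>\<^sub>C\<^sub>L 'w::cbanach"
  assumes "closure (range (cblinfun_apply e)) = UNIV" "\<And>v. cblinfun_apply E (e v) = L v"
  shows "extension e L = E"
  unfolding extension_def
  by (rule the_equality) (use assms in \<open>auto intro!: cblinfun_eq_on_dense[OF assms(1)]\<close>)

lemma extension_apply: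
  fixes e :: "'v::cbanach \<Rightarrow>\<^sub>C\<^sub>L 'w::cbanach" and L :: "'v \<Rightarrow> 'z::cbanach"
  assumes "closure (range (cblinfun_apply e)) = UNIV"
    and "\<And>x y. L (x + y) = L x + L y" "\<And>c x. L (c *\<^sub>C x) = c *\<^sub>C L x"
    and "\<And>x. norm (L x) \<le> K * norm (e x)"
  shows "extension e L (e v) = L v"
proof -
  obtain E where "\<And>v. cblinfun_apply E (e v) = L v"
    using extension_exists[OF assms] by blast
  then show ?thesis using extension_eq[OF assms(1), of E L] by auto
qed

section \<open>The Hahn--Banach theorem\<close>

text \<open>Homogeneity is demanded for positive factors; q 0 = 0 then follows from q (2 0) = 2 q
  0.\<close>

definition sublinear :: "('a::real_vector \<Rightarrow> real) \<Rightarrow> bool"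
  where "sublinear q \<longleftrightarrow> (\<forall>x y. q (x + y) \<le> q x + q y) \<and> (\<forall>r x. r > 0 \<longrightarrow> q (r *\<^sub>R x) = r * q x)"

lemma sublinearD:
  assumes "sublinear q"
  shows "q (x + y) \<le> q x + q y" "r > 0 \<Longrightarrow> q (r *\<^sub>R x) = r * q x" "q 0 = 0" "- q (- x) \<le> q x"
proof -
  have sub: "q (x + y) \<le> q x + q y" for x y
    using assms by (auto simp: sublinear_def)
  have scale: "q (r *\<^sub>R x) = r * q x" if "r > 0" for r x
    using assms that by (auto simp: sublinear_def)
  show "q (x + y) \<le> q x + q y" "r > 0 \<Longrightarrow> q (r *\<^sub>R x) = r * q x"
    by (fact sub, fact scale)
  show "q 0 = 0" using scale[of 2 0] by simp
  then show "- q (- x) \<le> q x" using sub[of x "- x"] by simp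
qed

text \<open>Subtracting as much of \<open>b\<close> as possible in the direction \<open>a\<close>: this one construction gives both
  the functional to start from and the linearity of a minimal sublinear functional.\<close>

lemma sublinear_shrink:
  assumes q: "sublinear q" and b: "b \<le> q a"
    and lower: "\<And>t y. t \<ge> 0 \<Longrightarrow> - q (- y) \<le> q (y + t *\<^sub>R a) - t * b"
  shows "\<exists>q'. sublinear q' \<and> (\<forall>y. q' y \<le> q y) \<and> q' (- a) \<le> - b \<and> (\<forall>y. q' y \<le> q (y + a) - b)"
proof -
  \<comment> \<open>The candidate is the infimum over t \<ge> 0 of q (y + t a) - t b;
    \<open>lower\<close> keeps it finite.\<close>
  define S where "S y = (\<lambda>t. q (y + t *\<^sub>R a) - t * b) ` {0..}" for y
  define q' where "q' y = Inf (S y)" for y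
  have bdd: "bdd_below (S y)" for y
    unfolding S_def by (rule bdd_belowI2[where m = "- q (- y)"]) (use lower in auto)
  have le: "q' y \<le> q (y + t *\<^sub>R a) - t * b" if "t \<ge> 0" for t y
    unfolding q'_def by (rule cInf_lower[OF _ bdd]) (use that in \<open>auto simp: S_def\<close>)
  have ge: "c \<le> q' y" if "\<And>t. t \<ge> 0 \<Longrightarrow> c \<le> q (y + t *\<^sub>R a) - t * b" for c y
    unfolding q'_def by (rule cInf_greatest) (use that in \<open>auto simp: S_def\<close>)
  have sub: "sublinear q'"
    unfolding sublinear_def
  proof (intro conjI allI impI)
    fix x y
    have *: "q' (x + y) \<le> (q (x + s *\<^sub>R a) - s * b) + (q (y + t *\<^sub>R a) - t * b)" if "s \<ge> 0" "t \<ge> 0" for s t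
    proof -
      have "q' (x + y) \<le> q (x + y + (s + t) *\<^sub>R a) - (s + t) * b" using that by (intro le) auto
      also have "x + y + (s + t) *\<^sub>R a = (x + s *\<^sub>R a) + (y + t *\<^sub>R a)" by (simp add: algebra_simps)
      finally show ?thesis using sublinearD(1)[OF q, of "x + s *\<^sub>R a" "y + t *\<^sub>R a"]
        by (simp add: algebra_simps)
    qed
    have "q' (x + y) - (q (y + t *\<^sub>R a) - t * b) \<le> q' x" if "t \<ge> 0" for t
      by (rule ge) (use *[OF _ that] in \<open>fastforce simp: algebra_simps\<close>)
    then have "q' (x + y) - q' x \<le> q' y"
      by (intro ge) (fastforce simp: algebra_simps)
    then show "q' (x + y) \<le> q' x + q' y" by simp
  next
    \<comment> \<open>One inequality for all r > 0 suffices: used for 1 / r at r x it gives the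
      reverse one.\<close>
    have half: "q' (r *\<^sub>R x) \<le> r * q' x" if r: "r > 0" for r x
    proof -
      have "q' (r *\<^sub>R x) / r \<le> q' x"
      proof (rule ge)
        fix t :: real assume t: "t \<ge> 0"
        have "q' (r *\<^sub>R x) \<le> q (r *\<^sub>R x + (r * t) *\<^sub>R a) - r * t * b"
          using r t by (intro le) auto
        also have "r *\<^sub>R x + (r * t) *\<^sub>R a = r *\<^sub>R (x + t *\<^sub>R a)" by (simp add: algebra_simps)
        finally show "q' (r *\<^sub>R x) / r \<le> q (x + t *\<^sub>R a) - t * b"
          using r sublinearD(2)[OF q r, of "x + t *\<^sub>R a"] by (simp add: field_simps)
      qed
      then show ?thesis using r by (simp add: field_simps)
    qed
    fix r :: real and x assume r: "r > 0"
    have "q' (inverse r *\<^sub>R r *\<^sub>R x) \<le> inverse r * q' (r *\<^sub>R x)" by (rule half) (use r in simp)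
    then show "q' (r *\<^sub>R x) = r * q' x"
      using half[OF r, of x] r by (simp add: field_simps)
  qed
  \<comment> \<open>t = 0 gives q' \<le> q, t = 1 at -a gives q' (-a) \<le> q 0 - b, and t = 1 at y
    the last bound.\<close>
  show ?thesis
    using sub le[of 0] le[of 1 "- a"] le[of 1] sublinearD(3)[OF q] by (intro exI[of _ q']) auto
qed

text \<open>Zorn's lemma with the order reversed. A chain is bounded below by its pointwise infimum,
  which is finite because every sublinear q \<le> p satisfies q x \<ge> -q (-x) \<ge> -p
  (-x).\<close>

lemma minimal_sublinear_exists:
  assumes p: "sublinear p"
  obtains q where "sublinear q" "\<And>x. q x \<le> p x"
    "\<And>q'. sublinear q' \<Longrightarrow> (\<And>x. q' x \<le> q x) \<Longrightarrow> q' = q"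
proof -
  define A where "A = {q. sublinear q \<and> q \<le> p}"
  have "\<exists>m\<in>A. \<forall>q\<in>A. q \<le> m \<longrightarrow> q = m"
  proof (rule predicate_Zorn)
    show "partial_order_on A (relation_of (\<lambda>x y. y \<le> x) A)"
      by (rule partial_order_on_relation_ofI) auto
    fix C assume "C \<in> Chains (relation_of (\<lambda>x y. y \<le> x) A)"
    then have C: "C \<subseteq> A" "\<And>q q'. q \<in> C \<Longrightarrow> q' \<in> C \<Longrightarrow> q \<le> q' \<or> q' \<le> q"
      by (auto simp: Chains_def relation_of_def)
    show "\<exists>u\<in>A. \<forall>a\<in>C. u \<le> a"
    proof (cases "C = {}")
      case True then show ?thesis using p by (auto simp: A_def)
    next
      case False
      have subC: "sublinear q" "q x \<le> p x" if "q \<in> C" for q x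
        using C(1) that by (auto simp: A_def le_fun_def)
      define u where "u x = (INF q\<in>C. q x)" for x
      have bdd: "bdd_below ((\<lambda>q. q x) ` C)" for x
      proof (rule bdd_belowI2[where m = "- p (- x)"])
        show "- p (- x) \<le> q x" if "q \<in> C" for q
          using sublinearD(4)[OF subC(1)[OF that], of x] subC(2)[OF that, of "- x"] by simp
      qed
      have le: "u x \<le> q x" if "q \<in> C" for q x
        unfolding u_def by (rule cINF_lower[OF bdd that])
      have ge: "c \<le> u x" if "\<And>q. q \<in> C \<Longrightarrow> c \<le> q x" for c x
        unfolding u_def by (rule cINF_greatest[OF False]) (use that in auto)
      have "sublinear u"
        unfolding sublinear_def
      proof (intro conjI allI impI)
        fix x y
        \<comment> \<open>An infimum of sublinear functionals need not be subadditive; in a chain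
          the smaller of q and q' serves both arguments.\<close>
        have *: "u (x + y) \<le> q x + q' y" if "q \<in> C" "q' \<in> C" for q q'
        proof -
          have "q \<le> q' \<or> q' \<le> q" using C(2) that by blast
          then obtain r where r: "r \<in> C" "r \<le> q" "r \<le> q'"
            using \<open>q \<in> C\<close> \<open>q' \<in> C\<close> by auto
          have "r x \<le> q x" "r y \<le> q' y" using r by (auto simp: le_fun_def)
          then show ?thesis
            using le[OF r(1), of "x + y"] sublinearD(1)[OF subC(1)[OF r(1)], of x y] by simp
        qed
        have "u (x + y) - q' y \<le> u x" if "q' \<in> C" for q'
          by (rule ge) (use *[OF _ that] in \<open>fastforce simp: algebra_simps\<close>)
        then have "u (x + y) - u x \<le> u y"
          by (intro ge) (fastforce simp: algebra_simps)
        then show "u (x + y) \<le> u x + u y" by simp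
      next
        have half: "u (r *\<^sub>R x) \<le> r * u x" if r: "r > 0" for r x
        proof -
          have "u (r *\<^sub>R x) / r \<le> u x"
            using le[of _ "r *\<^sub>R x"] sublinearD(2)[OF subC(1) r] r
            by (intro ge) (fastforce simp: field_simps)
          then show ?thesis using r by (simp add: field_simps)
        qed
        fix r :: real and x assume r: "r > 0"
        have "u (inverse r *\<^sub>R r *\<^sub>R x) \<le> inverse r * u (r *\<^sub>R x)" by (rule half) (use r in simp)
        then show "u (r *\<^sub>R x) = r * u x"
          using half[OF r, of x] r by (simp add: field_simps)
      qed
      moreover obtain q where "q \<in> C" using False by blast
      then have "u \<le> p" using le subC(2) by (fastforce simp: le_fun_def intro: order_trans)
      ultimately show ?thesis using le by (auto simp: A_def le_fun_def)
    qed
  qed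
  then obtain m where m: "sublinear m" "m \<le> p"
    "\<And>q. sublinear q \<Longrightarrow> q \<le> p \<Longrightarrow> q \<le> m \<Longrightarrow> q = m"
    unfolding A_def by blast
  show thesis
  proof
    fix q' assume "sublinear q'" "\<And>x. q' x \<le> m x"
    moreover from this have "q' \<le> m" by (auto simp: le_fun_def)
    ultimately show "q' = m" using m order_trans by blast
  qed (use m in \<open>auto simp: le_fun_def\<close>)
qed

lemma real_norming_functional:
  fixes x :: "'a::real_normed_vector"
  obtains q :: "'a \<Rightarrow> real" where "\<And>y z. q (y + z) = q y + q z" "\<And>r y. r > 0 \<Longrightarrow> q (r *\<^sub>R y) = r * q y"
    "\<And>y. q y \<le> norm y" "q x = norm x"
proof -
  \<comment> \<open>The norm is shrunk in direction x by b = norm x. The bound at -x passes to every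
    smaller functional and, once that is additive, becomes q x \<ge> norm x.\<close>
  have "\<exists>q'. sublinear q' \<and> (\<forall>y. q' y \<le> norm y) \<and> q' (- x) \<le> - norm x \<and> (\<forall>y. q' y \<le> norm (y + x) - norm x)"
  proof (rule sublinear_shrink)
    show "sublinear (norm :: 'a \<Rightarrow> real)"
      by (auto simp: sublinear_def norm_triangle_ineq)
    show "- norm (- y) \<le> norm (y + t *\<^sub>R x) - t * norm x" if "t \<ge> 0" for t y
      using norm_triangle_ineq[of "y + t *\<^sub>R x" "- y"] that by simp
  qed simp
  then obtain p where p: "sublinear p" "\<And>y. p y \<le> norm y" "p (- x) \<le> - norm x" by blast
  obtain q where q: "sublinear q" "\<And>y. q y \<le> p y"
    and min: "\<And>q'. sublinear q' \<Longrightarrow> (\<And>y. q' y \<le> q y) \<Longrightarrow> q' = q"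
    using minimal_sublinear_exists[OF p(1)] by metis
  note qD = sublinearD[OF q(1)]
  have add: "q (y + a) = q y + q a" for y a
  proof -
    \<comment> \<open>With b = q a, minimality forces q' = q, so the last bound reads q y + q a
      \<le> q (y + a).\<close>
    have "\<exists>q'. sublinear q' \<and> (\<forall>y. q' y \<le> q y) \<and> q' (- a) \<le> - q a \<and> (\<forall>y. q' y \<le> q (y + a) - q a)"
    proof (rule sublinear_shrink[OF q(1)])
      show "- q (- y) \<le> q (y + t *\<^sub>R a) - t * q a" if "t \<ge> 0" for t y
      proof (cases "t = 0")
        case True then show ?thesis using qD(4)[of y] by simp
      next
        case False
        then show ?thesis
          using qD(1)[of "y + t *\<^sub>R a" "- y"] qD(2)[of t a] that by simp
      qed
    qed simp
    then obtain q' where q': "sublinear q'" "\<And>y. q' y \<le> q y" "\<And>y. q' y \<le> q (y + a) - q a" by blast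
    then have "q' = q" using min by blast
    then have "q y + q a \<le> q (y + a)" using q'(3)[of y] by simp
    then show ?thesis using qD(1)[of y a] by simp
  qed
  show thesis
  proof
    show "q y \<le> norm y" for y using q(2) p(2) by (rule order_trans)
    have "q (- x) \<le> - norm x" using q(2) p(3) by (rule order_trans)
    then have "norm x \<le> q x" using add[of x "- x"] qD(3) by simp
    then show "q x = norm x" using \<open>q x \<le> norm x\<close> by simp
  qed (use add qD(2) in auto)
qed

text \<open>A real functional q is the real part of the conjugate-linear functional y \<mapsto> q y
  + i q (i y); for a linear one the sign would be minus.\<close>

theorem norming_functional:
  fixes x :: "'a::complex_normed_vector"
  obtains f :: "'a cdual" where "norm f \<le> 1" "f x = norm x"
proof -
  obtain q where add: "\<And>y z. q (y + z) = q y + q z"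
    and scale0: "\<And>r y. r > 0 \<Longrightarrow> q (r *\<^sub>R y) = r * q y"
    and le: "\<And>y. q y \<le> norm y" and qx: "q x = norm x"
    using real_norming_functional[of x] by blast
  have q0: "q 0 = 0" using add[of 0 0] by simp
  have minus: "q (- y) = - q y" for y using add[of y "- y"] q0 by simp
  have scale: "q (r *\<^sub>R y) = r * q y" for r y
  proof (cases r "0::real" rule: linorder_cases)
    case less then show ?thesis using scale0[of "- r" y] minus[of "r *\<^sub>R y"] by simp
  qed (use scale0 q0 in auto)
  define g where "g y = Complex (q y) (q (\<i> *\<^sub>C y))" for y
  have g_add: "g (y + z) = g y + g z" for y z
    by (simp add: g_def add scaleC_add_right complex_eq_iff)
  have c_decomp: "c *\<^sub>C y = Re c *\<^sub>R y + Im c *\<^sub>R \<i> *\<^sub>C y" for c y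
  proof -
    have "c *\<^sub>C y = (complex_of_real (Re c) + complex_of_real (Im c) * \<i>) *\<^sub>C y"
      by (rule arg_cong[of _ _ "\<lambda>c. c *\<^sub>C y"]) (simp add: complex_eq_iff)
    then show ?thesis by (simp only: scaleC_add_left scaleR_scaleC scaleC_scaleC)
  qed
  have g_scale: "g (c *\<^sub>C y) = cnj c * g y" for c y
  proof -
    have "\<i> *\<^sub>C c *\<^sub>C y = Re c *\<^sub>R \<i> *\<^sub>C y + (- Im c) *\<^sub>R y"
      using c_decomp[of "\<i> * c" y] by (simp add: scaleC_scaleC add.commute)
    then have "q (\<i> *\<^sub>C c *\<^sub>C y) = Re c * q (\<i> *\<^sub>C y) - Im c * q y"
      by (simp only: add scale)
    moreover have "q (c *\<^sub>C y) = Re c * q y + Im c * q (\<i> *\<^sub>C y)"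
      by (subst c_decomp) (simp only: add scale)
    ultimately show ?thesis by (simp add: g_def complex_eq_iff)
  qed
  have g_norm: "cmod (g y) \<le> norm y" for y
  proof (cases "g y = 0")
    case False
    \<comment> \<open>Multiplying y by the phase cnj c makes g real; there it equals q, which is
      bounded by the norm.\<close>
    define c where "c = cnj (sgn (g y))"
    have c1: "cmod c = 1" using False by (simp add: c_def norm_sgn)
    have "g (cnj c *\<^sub>C y) = cmod (g y)"
      using False unfolding g_scale
      by (simp add: c_def sgn_eq complex_norm_square[symmetric] field_simps power2_eq_square)
    then have "q (cnj c *\<^sub>C y) = cmod (g y)" by (simp add: g_def complex_eq_iff)
    then show ?thesis using le[of "cnj c *\<^sub>C y"] c1 by (simp add: norm_scaleC)
  qed simp
  obtain f :: "'a cdual" where f: "\<And>y. f y = g y"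
    using cdual_exists_norm[of g 1] g_add g_scale g_norm by auto
  have "norm f \<le> 1" by (rule norm_cdual_bound) (use f g_norm in auto)
  moreover have "f x = norm x"
  proof -
    \<comment> \<open>The real part of g x already has size norm x, so the imaginary part
      vanishes.\<close>
    have "(cmod (g x))\<^sup>2 \<le> (Re (g x))\<^sup>2"
      using g_norm[of x] qx by (intro power_mono) (auto simp: g_def)
    then have "Im (g x) = 0" by (simp add: cmod_power2)
    then show ?thesis using f qx by (simp add: g_def complex_eq_iff)
  qed
  ultimately show thesis by (rule that)
qed

lemma norm_le_cadjoint: "norm T \<le> norm (cadjoint T)"
  for T :: "'a::complex_normed_vector \<Rightarrow>\<^sub>C\<^sub>L 'b::complex_normed_vector"
proof (rule norm_cblinfun_bound)
  fix x
  obtain f :: "'b cdual" where f: "norm f \<le> 1" "f (T x) = norm (T x)"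
    by (rule norming_functional)
  have "norm (T x) = cmod (cadjoint T f x)" by (simp add: f)
  also have "\<dots> \<le> norm (cadjoint T f) * norm x" by (rule norm_cdual)
  also have "\<dots> \<le> norm (cadjoint T) * norm f * norm x"
    by (intro mult_right_mono norm_cblinfun) simp
  also have "\<dots> \<le> norm (cadjoint T) * 1 * norm x"
    using f(1) by (intro mult_right_mono mult_left_mono) auto
  finally show "norm (T x) \<le> norm (cadjoint T) * norm x" by simp
qed (rule norm_ge_zero)

lemma norm_cadjoint: "norm (cadjoint T) = norm T"
  using norm_cadjoint_le norm_le_cadjoint by (rule antisym)

section \<open>Convolutions with a locally integrable scalar function\<close>

text \<open>With \<open>v\<close> the modulus of an integrable scalar function this replaces measurability arguments,
  which for functions with values in a Banach space would require a separable range.\<close>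

lemma integrable_weighted_limit:
  fixes f :: "real \<Rightarrow> 'a::banach" and v :: "real \<Rightarrow> real"
  assumes v: "v integrable_on {a..b}"
    and approx: "\<And>e. e > 0 \<Longrightarrow> \<exists>g. g integrable_on {a..b} \<and> (\<forall>x\<in>{a..b}. norm (f x - g x) \<le> e * v x)"
  shows "f integrable_on {a..b}"
  unfolding cbox_interval[symmetric] integrable_Cauchy
proof (intro allI impI)
  fix e :: real assume e: "e > 0"
  define V where "V = integral (cbox a b) v"
  have v0: "v x \<ge> 0" if "x \<in> cbox a b" for x
    using approx[of 1] that by (auto intro: order_trans[OF norm_ge_zero])
  have V0: "V \<ge> 0" unfolding V_def using v0 v by (intro integral_nonneg) auto
  \<comment> \<open>e/4 for replacing f by g and e/4 for the Riemann sums of g put every Riemann sum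
    of f within e/2 of one value. V + 1 bounds the sums of v over fine divisions.\<close>
  define e' where "e' = e / (4 * (V + 1))"
  have e': "e' > 0" "e' * (V + 1) = e / 4" using e V0 by (auto simp: e'_def field_simps)
  obtain g where g: "g integrable_on cbox a b" "\<And>x. x \<in> cbox a b \<Longrightarrow> norm (f x - g x) \<le> e' * v x"
    using approx[OF e'(1)] by auto
  obtain \<gamma>1 where \<gamma>1: "gauge \<gamma>1" "\<And>D. D tagged_division_of cbox a b \<Longrightarrow> \<gamma>1 fine D \<Longrightarrow>
      norm ((\<Sum>(x,K)\<in>D. measure lborel K *\<^sub>R g x) - integral (cbox a b) g) < e / 4"
    using has_integral[of g "integral (cbox a b) g" a b] g(1) e
    by (metis integrable_integral zero_less_divide_iff zero_less_numeral)
  obtain \<gamma>2 where \<gamma>2: "gauge \<gamma>2" "\<And>D. D tagged_division_of cbox a b \<Longrightarrow> \<gamma>2 fine D \<Longrightarrow>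
      norm ((\<Sum>(x,K)\<in>D. measure lborel K *\<^sub>R v x) - V) < 1"
    using has_integral[of v V a b] v unfolding V_def
    by (metis cbox_interval integrable_integral zero_less_one)
  have key: "norm ((\<Sum>(x,K)\<in>D. measure lborel K *\<^sub>R f x) - integral (cbox a b) g) < e / 2"
    if D: "D tagged_division_of cbox a b" "(\<lambda>x. \<gamma>1 x \<inter> \<gamma>2 x) fine D" for D
  proof -
    have fine: "\<gamma>1 fine D" "\<gamma>2 fine D" using D(2) by (auto simp: fine_def)
    have "norm ((\<Sum>(x,K)\<in>D. measure lborel K *\<^sub>R f x) - (\<Sum>(x,K)\<in>D. measure lborel K *\<^sub>R g x)) =
        norm (\<Sum>(x,K)\<in>D. measure lborel K *\<^sub>R (f x - g x))"
      by (simp add: sum_subtractf[symmetric] split_def scaleR_diff_right)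
    also have "\<dots> \<le> (\<Sum>(x,K)\<in>D. measure lborel K *\<^sub>R (e' * v x))"
    proof (rule sum_norm_le, clarify)
      fix x K assume "(x, K) \<in> D"
      then have "x \<in> cbox a b" using D(1) by (meson subsetD tag_in_interval)
      then show "norm (measure lborel K *\<^sub>R (f x - g x)) \<le> measure lborel K *\<^sub>R (e' * v x)"
        using g(2) by (simp add: mult_left_mono)
    qed
    also have "\<dots> = e' * (\<Sum>(x,K)\<in>D. measure lborel K *\<^sub>R v x)"
      by (simp add: sum_distrib_left split_def mult.left_commute)
    also have "\<dots> \<le> e' * (V + 1)"
      using \<gamma>2(2)[OF D(1) fine(2)] e'(1) by (intro mult_left_mono) auto
    finally have "norm ((\<Sum>(x,K)\<in>D. measure lborel K *\<^sub>R f x) - (\<Sum>(x,K)\<in>D. measure lborel K *\<^sub>R g x)) \<le> e / 4"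
      using e'(2) by simp
    then have "norm (((\<Sum>(x,K)\<in>D. measure lborel K *\<^sub>R f x) - (\<Sum>(x,K)\<in>D. measure lborel K *\<^sub>R g x)) +
        ((\<Sum>(x,K)\<in>D. measure lborel K *\<^sub>R g x) - integral (cbox a b) g)) < e / 4 + e / 4"
      using \<gamma>1(2)[OF D(1) fine(1)] by (intro norm_triangle_lt add_le_less_mono)
    then show ?thesis by simp
  qed
  show "\<exists>\<gamma>. gauge \<gamma> \<and> (\<forall>D1 D2. D1 tagged_division_of cbox a b \<and> \<gamma> fine D1 \<and>
      D2 tagged_division_of cbox a b \<and> \<gamma> fine D2 \<longrightarrow>
      norm ((\<Sum>(x,K)\<in>D1. measure lborel K *\<^sub>R f x) - (\<Sum>(x,K)\<in>D2. measure lborel K *\<^sub>R f x)) < e)"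
  proof (intro exI[of _ "\<lambda>x. \<gamma>1 x \<inter> \<gamma>2 x"] conjI allI impI)
    show "gauge (\<lambda>x. \<gamma>1 x \<inter> \<gamma>2 x)" using \<gamma>1(1) \<gamma>2(1) by (rule gauge_Int)
    fix D1 D2
    assume "D1 tagged_division_of cbox a b \<and> (\<lambda>x. \<gamma>1 x \<inter> \<gamma>2 x) fine D1 \<and>
      D2 tagged_division_of cbox a b \<and> (\<lambda>x. \<gamma>1 x \<inter> \<gamma>2 x) fine D2"
    then show "norm ((\<Sum>(x,K)\<in>D1. measure lborel K *\<^sub>R f x) - (\<Sum>(x,K)\<in>D2. measure lborel K *\<^sub>R f x)) < e"
      using key[of D1] key[of D2] norm_triangle_half_l[of _ "integral (cbox a b) g" e]
      by blast
  qed
qed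

text \<open>On a short interval around x the product is within e |w| of w \<phi>(x), which is
  integrable as a scalar function times a fixed vector. Bolzano's bisection principle glues these
  local approximants.\<close>

lemma integrable_scaleC_continuous_aux:
  fixes \<phi> :: "real \<Rightarrow> 'a::cbanach" and w :: "real \<Rightarrow> complex"
  assumes w: "\<And>a b. w absolutely_integrable_on {a..b}" and \<phi>: "continuous_on UNIV \<phi>"
  shows "(\<lambda>s. w s *\<^sub>C \<phi> s) integrable_on {a..b}"
proof (cases "a \<le> b")
  case True
  show ?thesis
  proof (rule integrable_weighted_limit[where v = "\<lambda>s. cmod (w s)"])
    show "(\<lambda>s. cmod (w s)) integrable_on {a..b}"
      using w by (simp add: absolutely_integrable_on_def)
    fix e :: real assume e: "e > 0"
    from True
    show "\<exists>g. g integrable_on {a..b} \<and> (\<forall>x\<in>{a..b}. norm (w x *\<^sub>C \<phi> x - g x) \<le> e * cmod (w x))"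
    proof (induction rule: Bolzano)
      case (trans a b c)
      then obtain g h where g: "g integrable_on {a..b}" "\<forall>x\<in>{a..b}. norm (w x *\<^sub>C \<phi> x - g x) \<le> e * cmod (w x)"
        and h: "h integrable_on {b..c}" "\<forall>x\<in>{b..c}. norm (w x *\<^sub>C \<phi> x - h x) \<le> e * cmod (w x)"
        by blast
      define k where "k x = (if x \<le> b then g x else h x)" for x
      have "k integrable_on {a..b}"
        by (rule integrable_eq[OF g(1)]) (simp add: k_def)
      \<comment> \<open>k and h differ at most at the common endpoint b.\<close>
      moreover have "k integrable_on {b..c}"
        by (rule integrable_spike_finite[OF _ _ h(1), of "{b}"]) (auto simp: k_def)
      ultimately have "k integrable_on {a..c}"
        using trans(3,4) by (intro Henstock_Kurzweil_Integration.integrable_combine[of a b c])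
      moreover have "\<forall>x\<in>{a..c}. norm (w x *\<^sub>C \<phi> x - k x) \<le> e * cmod (w x)"
        using g(2) h(2) by (auto simp: k_def)
      ultimately show ?case by blast
    next
      case (local x)
      obtain d where d: "d > 0" "\<And>y. dist y x < d \<Longrightarrow> dist (\<phi> y) (\<phi> x) < e"
        using \<phi> e unfolding continuous_on_iff by blast
      show ?case
      proof (intro exI[of _ d] conjI allI impI d(1))
        fix a b assume ab: "a \<le> x \<and> x \<le> b \<and> b - a < d"
        show "\<exists>g. g integrable_on {a..b} \<and> (\<forall>x\<in>{a..b}. norm (w x *\<^sub>C \<phi> x - g x) \<le> e * cmod (w x))"
        proof (intro exI[of _ "\<lambda>y. w y *\<^sub>C \<phi> x"] conjI ballI)
          have "w integrable_on {a..b}" using w by (simp add: absolutely_integrable_on_def)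
          then show "(\<lambda>y. w y *\<^sub>C \<phi> x) integrable_on {a..b}"
            using integrable_linear[OF _ bounded_linear_scaleC_left[of "\<phi> x"]] by (simp add: o_def)
          fix y assume "y \<in> {a..b}"
          then have "dist (\<phi> y) (\<phi> x) < e" using ab by (intro d(2)) (auto simp: dist_real_def)
          then have "cmod (w y) * norm (\<phi> y - \<phi> x) \<le> cmod (w y) * e"
            by (intro mult_left_mono) (auto simp: dist_norm)
          then show "norm (w y *\<^sub>C \<phi> y - w y *\<^sub>C \<phi> x) \<le> e * cmod (w y)"
            by (simp add: complex_vector.scale_right_diff_distrib[symmetric] norm_scaleC mult.commute)
        qed
      qed
    qed
  qed
qed (simp add: integrable_on_empty)

lemma integrable_scaleC_continuous:
  fixes \<phi> :: "real \<Rightarrow> 'a::cbanach" and w :: "real \<Rightarrow> complex"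
  assumes w: "w absolutely_integrable_on {a..b}" and \<phi>: "continuous_on {a..b} \<phi>"
  shows "(\<lambda>s. w s *\<^sub>C \<phi> s) integrable_on {a..b}"
proof (cases "a \<le> b")
  case True
  \<comment> \<open>Extension to the whole line: w by zero, \<phi> by its endpoint values.\<close>
  define w' where "w' s = (if s \<in> {a..b} then w s else 0)" for s
  define \<phi>' where "\<phi>' s = \<phi> (max a (min b s))" for s
  have "w' absolutely_integrable_on UNIV"
    unfolding w'_def using w absolutely_integrable_restrict_UNIV by blast
  then have "w' absolutely_integrable_on {c..d}" for c d
    by (rule set_integrable_subset) auto
  moreover have "continuous_on UNIV \<phi>'"
    unfolding \<phi>'_def using True
    by (intro continuous_on_compose2[OF \<phi>] continuous_intros) auto
  ultimately have "(\<lambda>s. w' s *\<^sub>C \<phi>' s) integrable_on {a..b}"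
    by (rule integrable_scaleC_continuous_aux)
  then show ?thesis
    by (rule integrable_eq) (simp add: w'_def \<phi>'_def)
qed (simp add: integrable_on_empty)

text \<open>The weight is scalar so that, for a continuous second factor, the integral exists in
  every Banach space by the criterion above.\<close>

definition conv :: "(real \<Rightarrow> complex) \<Rightarrow> (real \<Rightarrow> 'a::cbanach) \<Rightarrow> real \<Rightarrow> 'a"
  where "conv w \<phi> t = integral {0..t} (\<lambda>s. w s *\<^sub>C \<phi> (t - s))"

definition prim :: "(real \<Rightarrow> 'a::banach) \<Rightarrow> real \<Rightarrow> 'a"
  where "prim f t = integral {0..t} f"

definition locally_integrable :: "(real \<Rightarrow> complex) \<Rightarrow> bool"
  where "locally_integrable w \<longleftrightarrow> (\<forall>t. w absolutely_integrable_on {0..t})"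

section \<open>Primitives of continuous functions\<close>

lemma prim_has_vector_derivative:
  assumes "continuous_on {0..} f" "0 \<le> t" "t \<le> L"
  shows "(prim f has_vector_derivative f t) (at t within {0..L})"
  unfolding prim_def[abs_def] using assms
  by (intro integral_has_vector_derivative continuous_on_subset[OF assms(1)]) auto

lemma continuous_on_atLeast_if_bounded:
  fixes f :: "real \<Rightarrow> 'a::topological_space"
  assumes "\<And>L. L > 0 \<Longrightarrow> continuous_on {0..L} f"
  shows "continuous_on {0..} f"
  unfolding continuous_on_eq_continuous_within
proof
  fix t :: real assume "t \<in> {0..}"
  then have "continuous (at t within {0..t + 1}) f"
    using assms[of "t + 1"] by (simp add: continuous_on_eq_continuous_within)
  moreover have "at t within {0..t + 1} = at t within {0..}"
    by (rule at_within_nhd[of _ "{t - 1<..<t + 1}"]) auto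
  ultimately show "continuous (at t within {0..}) f" by (simp add: continuous_within)
qed

lemma continuous_on_prim:
  assumes "continuous_on {0..} f"
  shows "continuous_on {0..} (prim f)"
proof (rule continuous_on_atLeast_if_bounded)
  show "continuous_on {0..L} (prim f)" for L
    using prim_has_vector_derivative[OF assms]
    by (intro continuous_on_vector_derivative) auto
qed

lemma prim_0 [simp]: "prim f 0 = 0"
  by (simp add: prim_def)

lemma integrable_on_if_continuous_atLeast:
  fixes f :: "real \<Rightarrow> 'a::banach"
  assumes "continuous_on {0..} f"
  shows "f integrable_on {0..t}"
  by (intro integrable_continuous_real continuous_on_subset[OF assms]) auto

text \<open>Integration by parts: s \<mapsto> (t - s) prim q s vanishes at both ends.\<close>

lemma integral_prim:
  fixes q :: "real \<Rightarrow> 'a::banach"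
  assumes q: "continuous_on {0..} q" and t: "0 \<le> t"
  shows "integral {0..t} (\<lambda>s. (t - s) *\<^sub>R q s) = prim (prim q) t"
proof -
  have "((\<lambda>s. (t - s) *\<^sub>R q s - prim q s) has_integral (t - t) *\<^sub>R prim q t - (t - 0) *\<^sub>R prim q 0) {0..t}"
    by (rule fundamental_theorem_of_calculus[OF t])
       (auto intro!: derivative_eq_intros prim_has_vector_derivative q)
  then have "((\<lambda>s. (t - s) *\<^sub>R q s - prim q s) has_integral 0) {0..t}" by simp
  moreover have "(prim q has_integral prim (prim q) t) {0..t}"
    unfolding prim_def[of "prim q"]
    by (intro integrable_integral integrable_on_if_continuous_atLeast continuous_on_prim q)
  ultimately have "((\<lambda>s. (t - s) *\<^sub>R q s - prim q s + prim q s) has_integral 0 + prim (prim q) t) {0..t}"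
    by (rule has_integral_add)
  then show ?thesis by (simp add: integral_unique)
qed

lemma prim_norm_le:
  assumes f: "continuous_on {0..} f" and t: "0 \<le> t" and M: "\<And>s. 0 \<le> s \<Longrightarrow> s \<le> t \<Longrightarrow> norm (f s) \<le> M"
  shows "norm (prim f t) \<le> M * t"
  unfolding prim_def
  using integral_bound[of 0 t f M] continuous_on_subset[OF f, of "{0..t}"] t M by auto

lemma prim_linear:
  assumes f: "continuous_on {0..} f" and L: "bounded_linear L"
  shows "L (prim f t) = prim (\<lambda>s. L (f s)) t"
  unfolding prim_def
  using integral_linear[OF integrable_on_if_continuous_atLeast[OF f] L] by (simp add: o_def)

section \<open>Convolution with a fixed weight: linearity, continuity, integration\<close>

context
  fixes w :: "real \<Rightarrow> complex"
  assumes w: "locally_integrable w"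
begin

lemma w_absolutely_integrable: "w absolutely_integrable_on {a..b}" if "0 \<le> a"
proof -
  have "w absolutely_integrable_on {0..b}" using w by (simp add: locally_integrable_def)
  then show ?thesis by (rule set_integrable_subset) (use that in auto)
qed

lemma conv_integrable_sub:
  fixes \<phi> :: "real \<Rightarrow> 'a::cbanach"
  assumes "continuous_on {0..} \<phi>" "0 \<le> a" "b \<le> t"
  shows "(\<lambda>s. w s *\<^sub>C \<phi> (t - s)) integrable_on {a..b}"
proof (rule integrable_scaleC_continuous[OF w_absolutely_integrable[OF assms(2)]])
  show "continuous_on {a..b} (\<lambda>s. \<phi> (t - s))"
    by (rule continuous_on_compose2[OF assms(1)]) (use assms in \<open>auto intro!: continuous_intros\<close>)
qed

lemma conv_integrable:
  fixes \<phi> :: "real \<Rightarrow> 'a::cbanach"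
  assumes "continuous_on {0..} \<phi>"
  shows "(\<lambda>s. w s *\<^sub>C \<phi> (t - s)) integrable_on {0..t}"
  using conv_integrable_sub[OF assms, of 0 t t] by simp

lemma conv_add:
  assumes "continuous_on {0..} \<phi>" "continuous_on {0..} \<psi>"
  shows "conv w (\<lambda>\<tau>. \<phi> \<tau> + \<psi> \<tau>) t = conv w \<phi> t + conv w \<psi> t"
  unfolding conv_def scaleC_add_right by (intro integral_add conv_integrable assms)

lemma conv_diff:
  assumes "continuous_on {0..} \<phi>" "continuous_on {0..} \<psi>"
  shows "conv w (\<lambda>\<tau>. \<phi> \<tau> - \<psi> \<tau>) t = conv w \<phi> t - conv w \<psi> t"
  unfolding conv_def complex_vector.scale_right_diff_distrib by (intro integral_diff conv_integrable assms)

lemma conv_cblinfun: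
  fixes L :: "'a::cbanach \<Rightarrow>\<^sub>C\<^sub>L 'b::cbanach"
  assumes "continuous_on {0..} \<phi>"
  shows "L (conv w \<phi> t) = conv w (\<lambda>\<tau>. L (\<phi> \<tau>)) t"
  unfolding conv_def
  using integral_linear[OF conv_integrable[OF assms] cblinfun.bounded_linear_right[of L]]
  by (simp add: o_def)

lemma conv_scaleC:
  fixes \<phi> :: "real \<Rightarrow> 'a::cbanach"
  assumes "continuous_on {0..} \<phi>"
  shows "conv w (\<lambda>\<tau>. c *\<^sub>C \<phi> \<tau>) t = c *\<^sub>C conv w \<phi> t"
  unfolding conv_def
  using integral_linear[OF conv_integrable[OF assms, of t] bounded_linear_scaleC[of c]]
  by (simp add: o_def scaleC_scaleC mult.commute)

text \<open>The convolution at t' is split at t. On [0, t] the increment of \<phi> is compared with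
  \<psi>; on [t, t'] only the values of \<phi> on [0, t' - t] enter, weighted by the mass of w
  there.\<close>

lemma conv_estimate:
  fixes \<phi> \<psi> :: "real \<Rightarrow> 'a::cbanach"
  assumes \<phi>: "continuous_on {0..} \<phi>" and \<psi>: "continuous_on {0..} \<psi>" and t: "0 \<le> t" "t \<le> t'"
    and \<epsilon>1: "\<And>\<tau>. 0 \<le> \<tau> \<Longrightarrow> \<tau> \<le> t \<Longrightarrow> norm (\<phi> (\<tau> + (t' - t)) - \<phi> \<tau> - \<psi> \<tau>) \<le> \<epsilon>1"
    and \<epsilon>2: "\<And>\<tau>. 0 \<le> \<tau> \<Longrightarrow> \<tau> \<le> t' - t \<Longrightarrow> norm (\<phi> \<tau>) \<le> \<epsilon>2"
  shows "norm (conv w \<phi> t' - conv w \<phi> t - conv w \<psi> t) \<le>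
    integral {0..t} (\<lambda>s. cmod (w s)) * \<epsilon>1 + integral {t..t'} (\<lambda>s. cmod (w s)) * \<epsilon>2"
proof -
  have w_int: "(\<lambda>s. cmod (w s)) integrable_on {a..b}" if "0 \<le> a" for a b
    using w_absolutely_integrable[OF that] by (simp add: absolutely_integrable_on_def)
  have int1: "(\<lambda>s. w s *\<^sub>C \<phi> (t' - s)) integrable_on {0..t}"
    and int2: "(\<lambda>s. w s *\<^sub>C \<phi> (t' - s)) integrable_on {t..t'}"
    using t by (auto intro!: conv_integrable_sub \<phi>)
  have "conv w \<phi> t' = integral {0..t} (\<lambda>s. w s *\<^sub>C \<phi> (t' - s)) + integral {t..t'} (\<lambda>s. w s *\<^sub>C \<phi> (t' - s))"
    unfolding conv_def
    using Henstock_Kurzweil_Integration.integral_combine[OF t conv_integrable[OF \<phi>]] by simp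
  moreover have "integral {0..t} (\<lambda>s. w s *\<^sub>C \<phi> (t' - s)) - conv w \<phi> t - conv w \<psi> t =
      integral {0..t} (\<lambda>s. w s *\<^sub>C (\<phi> (t' - s) - \<phi> (t - s) - \<psi> (t - s)))"
    unfolding conv_def complex_vector.scale_right_diff_distrib
    by (simp add: integral_diff integrable_diff int1 conv_integrable \<phi> \<psi>)
  moreover have "norm (integral {0..t} (\<lambda>s. w s *\<^sub>C (\<phi> (t' - s) - \<phi> (t - s) - \<psi> (t - s)))) \<le>
      integral {0..t} (\<lambda>s. cmod (w s) * \<epsilon>1)"
  proof (rule integral_norm_bound_integral)
    show "(\<lambda>s. w s *\<^sub>C (\<phi> (t' - s) - \<phi> (t - s) - \<psi> (t - s))) integrable_on {0..t}"
      unfolding complex_vector.scale_right_diff_distrib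
      by (intro integrable_diff int1 conv_integrable \<phi> \<psi>)
    show "(\<lambda>s. cmod (w s) * \<epsilon>1) integrable_on {0..t}"
      using w_int by (intro integrable_on_mult_left) auto
    fix s assume "s \<in> {0..t}"
    then show "norm (w s *\<^sub>C (\<phi> (t' - s) - \<phi> (t - s) - \<psi> (t - s))) \<le> cmod (w s) * \<epsilon>1"
      using \<epsilon>1[of "t - s"] by (simp add: norm_scaleC mult_left_mono)
  qed
  moreover have "norm (integral {t..t'} (\<lambda>s. w s *\<^sub>C \<phi> (t' - s))) \<le> integral {t..t'} (\<lambda>s. cmod (w s) * \<epsilon>2)"
  proof (rule integral_norm_bound_integral[OF int2])
    show "(\<lambda>s. cmod (w s) * \<epsilon>2) integrable_on {t..t'}"
      using w_int t by (intro integrable_on_mult_left) auto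
    fix s assume "s \<in> {t..t'}"
    then show "norm (w s *\<^sub>C \<phi> (t' - s)) \<le> cmod (w s) * \<epsilon>2"
      using \<epsilon>2[of "t' - s"] by (simp add: norm_scaleC mult_left_mono)
  qed
  ultimately show ?thesis
    using norm_triangle_ineq[of "integral {0..t} (\<lambda>s. w s *\<^sub>C \<phi> (t' - s)) - conv w \<phi> t - conv w \<psi> t"
        "integral {t..t'} (\<lambda>s. w s *\<^sub>C \<phi> (t' - s))"]
    by (simp add: algebra_simps)
qed

text \<open>Uniform continuity of the primitive of |w| on a compact interval.\<close>

lemma weight_modulus:
  assumes "L > 0" "e > 0"
  obtains d where "d > 0" "\<And>t t'. 0 \<le> t \<Longrightarrow> t \<le> t' \<Longrightarrow> t' \<le> L \<Longrightarrow> t' - t < d \<Longrightarrow>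
    integral {t..t'} (\<lambda>s. cmod (w s)) \<le> e"
proof -
  let ?W = "\<lambda>t. integral {0..t} (\<lambda>s. cmod (w s))"
  have int: "(\<lambda>s. cmod (w s)) integrable_on {0..t}" for t
    using w_absolutely_integrable[of 0 t] by (simp add: absolutely_integrable_on_def)
  have "continuous_on {0..L} ?W"
    by (rule indefinite_integral_continuous_1[OF int])
  then have "uniformly_continuous_on {0..L} ?W"
    by (rule compact_uniformly_continuous) simp
  then obtain d where d: "d > 0" "\<And>t t'. t \<in> {0..L} \<Longrightarrow> t' \<in> {0..L} \<Longrightarrow> dist t' t < d \<Longrightarrow> dist (?W t') (?W t) < e"
    unfolding uniformly_continuous_on_def using assms(2) by metis
  show thesis
  proof (rule that[OF d(1)])
    fix t t' assume t: "0 \<le> t" "t \<le> t'" "t' \<le> L" "t' - t < d"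
    then have "dist (?W t') (?W t) < e" by (intro d(2)) (auto simp: dist_real_def)
    moreover have "?W t + integral {t..t'} (\<lambda>s. cmod (w s)) = ?W t'"
      using t int by (intro Henstock_Kurzweil_Integration.integral_combine) auto
    ultimately show "integral {t..t'} (\<lambda>s. cmod (w s)) \<le> e"
      by (simp add: dist_real_def)
  qed
qed

lemma continuous_modulus:
  fixes f :: "real \<Rightarrow> 'a::real_normed_vector"
  assumes "continuous_on {0..} f" "e > 0"
  obtains d where "d > 0" "\<And>t t'. 0 \<le> t \<Longrightarrow> 0 \<le> t' \<Longrightarrow> t \<le> L \<Longrightarrow> t' \<le> L \<Longrightarrow> \<bar>t' - t\<bar> < d \<Longrightarrow> norm (f t' - f t) \<le> e"
proof -
  have "uniformly_continuous_on {0..L} f"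
    by (rule compact_uniformly_continuous[OF continuous_on_subset[OF assms(1)]]) auto
  then obtain d where d: "d > 0" "\<And>t t'. t \<in> {0..L} \<Longrightarrow> t' \<in> {0..L} \<Longrightarrow> dist t' t < d \<Longrightarrow> dist (f t') (f t) < e"
    unfolding uniformly_continuous_on_def using assms(2) by metis
  then show thesis by (intro that[OF d(1)]) (force simp: dist_norm)
qed

lemma continuous_bound:
  fixes f :: "real \<Rightarrow> 'a::real_normed_vector"
  assumes "continuous_on {0..} f"
  obtains M where "M > 0" "\<And>t. 0 \<le> t \<Longrightarrow> t \<le> L \<Longrightarrow> norm (f t) \<le> M"
proof -
  have "bounded (f ` {0..L})"
    by (intro compact_imp_bounded compact_continuous_image continuous_on_subset[OF assms]) auto
  then show thesis using that unfolding bounded_pos by auto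
qed

text \<open>Used with \<open>r h = 1\<close> and \<open>\<psi> = 0\<close> for the continuity of the convolution, and with \<open>r h = h\<close> and
  \<open>\<psi>\<close> the first-order Taylor term of \<open>\<phi>\<close> for its derivative.\<close>

lemma conv_uniform:
  fixes \<phi> :: "real \<Rightarrow> 'a::cbanach" and \<psi> :: "real \<Rightarrow> real \<Rightarrow> 'a" and r :: "real \<Rightarrow> real"
  assumes \<phi>: "continuous_on {0..} \<phi>" and \<psi>: "\<And>h. continuous_on {0..} (\<psi> h)"
    and L: "L > 0" and e: "e > 0" and r: "\<And>h. h \<ge> 0 \<Longrightarrow> r h \<ge> 0"
    and \<epsilon>1: "\<And>e. e > 0 \<Longrightarrow> \<exists>d>0. \<forall>h \<tau>. 0 \<le> h \<and> h < d \<and> 0 \<le> \<tau> \<and> \<tau> + h \<le> L \<longrightarrow>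
      norm (\<phi> (\<tau> + h) - \<phi> \<tau> - \<psi> h \<tau>) \<le> e * r h"
    and \<epsilon>2: "M > 0" "\<And>h \<tau>. 0 \<le> \<tau> \<Longrightarrow> \<tau> \<le> h \<Longrightarrow> h \<le> L \<Longrightarrow> norm (\<phi> \<tau>) \<le> M * r h"
  shows "\<exists>d>0. \<forall>t t'. 0 \<le> t \<and> t \<le> t' \<and> t' \<le> L \<and> t' - t < d \<longrightarrow>
    norm (conv w \<phi> t' - conv w \<phi> t - conv w (\<psi> (t' - t)) t) \<le> e * r (t' - t)"
proof -
  define V where "V = integral {0..L} (\<lambda>s. cmod (w s))"
  have int: "(\<lambda>s. cmod (w s)) integrable_on {0..t}" for t
    using w_absolutely_integrable[of 0 t] by (simp add: absolutely_integrable_on_def)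
  have V: "V \<ge> 0" unfolding V_def by (intro integral_nonneg int) simp
  \<comment> \<open>Half of e for each of the two parts of \<open>conv_estimate\<close>; V + 1 keeps
    the divisor positive.\<close>
  define e1 where "e1 = e / (2 * (V + 1))"
  have e1: "e1 > 0" "(V + 1) * e1 = e / 2" using e V by (auto simp: e1_def field_simps)
  obtain d1 where d1: "d1 > 0" "\<And>h \<tau>. 0 \<le> h \<Longrightarrow> h < d1 \<Longrightarrow> 0 \<le> \<tau> \<Longrightarrow> \<tau> + h \<le> L \<Longrightarrow>
      norm (\<phi> (\<tau> + h) - \<phi> \<tau> - \<psi> h \<tau>) \<le> e1 * r h"
    using \<epsilon>1[OF e1(1)] by blast
  have eM: "e / (2 * M) > 0" using e \<epsilon>2(1) by simp
  obtain d2 where d2: "d2 > 0" "\<And>t t'. 0 \<le> t \<Longrightarrow> t \<le> t' \<Longrightarrow> t' \<le> L \<Longrightarrow> t' - t < d2 \<Longrightarrow>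
      integral {t..t'} (\<lambda>s. cmod (w s)) \<le> e / (2 * M)"
    using weight_modulus[OF L eM] by blast
  show ?thesis
  proof (intro exI[of _ "min d1 d2"] conjI allI impI)
    show "min d1 d2 > 0" using d1(1) d2(1) by simp
    fix t t' assume t: "0 \<le> t \<and> t \<le> t' \<and> t' \<le> L \<and> t' - t < min d1 d2"
    have "norm (conv w \<phi> t' - conv w \<phi> t - conv w (\<psi> (t' - t)) t) \<le>
      integral {0..t} (\<lambda>s. cmod (w s)) * (e1 * r (t' - t)) +
      integral {t..t'} (\<lambda>s. cmod (w s)) * (M * r (t' - t))"
      using t by (intro conv_estimate \<phi> \<psi> d1(2) \<epsilon>2(2)) auto
    also have "\<dots> \<le> (V + 1) * (e1 * r (t' - t)) + e / (2 * M) * (M * r (t' - t))"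
    proof (intro add_mono mult_right_mono)
      have "integral {0..t} (\<lambda>s. cmod (w s)) \<le> V"
        unfolding V_def using t int by (intro integral_subset_le) auto
      then show "integral {0..t} (\<lambda>s. cmod (w s)) \<le> V + 1" by simp
    qed (use t r d2(2) e1(1) \<epsilon>2(1) in auto)
    also have "\<dots> = ((V + 1) * e1) * r (t' - t) + e / 2 * r (t' - t)"
      using \<epsilon>2(1) by simp
    finally show "norm (conv w \<phi> t' - conv w \<phi> t - conv w (\<psi> (t' - t)) t) \<le> e * r (t' - t)"
      unfolding e1(2) by (simp add: algebra_simps)
  qed
qed

lemma continuous_on_conv:
  fixes \<phi> :: "real \<Rightarrow> 'a::cbanach"
  assumes \<phi>: "continuous_on {0..} \<phi>"
  shows "continuous_on {0..} (conv w \<phi>)"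
proof (rule continuous_on_atLeast_if_bounded)
  fix L :: real assume L: "L > 0"
  show "continuous_on {0..L} (conv w \<phi>)"
    unfolding continuous_on_iff
  proof (intro ballI allI impI)
    fix x e :: real assume x: "x \<in> {0..L}" and e: "e > 0"
    obtain M where M: "M > 0" "\<And>t. 0 \<le> t \<Longrightarrow> t \<le> L \<Longrightarrow> norm (\<phi> t) \<le> M"
      using continuous_bound[OF \<phi>] by blast
    have "\<exists>d>0. \<forall>t t'. 0 \<le> t \<and> t \<le> t' \<and> t' \<le> L \<and> t' - t < d \<longrightarrow>
      norm (conv w \<phi> t' - conv w \<phi> t - conv w (\<lambda>_. 0) t) \<le> (e / 2) * 1"
    proof (rule conv_uniform[OF \<phi> _ L, where M = M])
      fix e :: real assume "e > 0"
      then obtain d where "d > 0" "\<And>t t'. 0 \<le> t \<Longrightarrow> 0 \<le> t' \<Longrightarrow> t \<le> L \<Longrightarrow> t' \<le> L \<Longrightarrow> \<bar>t' - t\<bar> < d \<Longrightarrow> norm (\<phi> t' - \<phi> t) \<le> e"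
        using continuous_modulus[OF \<phi>, of e L] by blast
      then show "\<exists>d>0. \<forall>h \<tau>. 0 \<le> h \<and> h < d \<and> 0 \<le> \<tau> \<and> \<tau> + h \<le> L \<longrightarrow> norm (\<phi> (\<tau> + h) - \<phi> \<tau> - 0) \<le> e * 1"
        by (intro exI[of _ d]) auto
    qed (use e M in auto)
    then obtain d where d: "d > 0" "\<And>t t'. 0 \<le> t \<Longrightarrow> t \<le> t' \<Longrightarrow> t' \<le> L \<Longrightarrow> t' - t < d \<Longrightarrow>
        norm (conv w \<phi> t' - conv w \<phi> t) \<le> e / 2"
      by (auto simp: conv_def)
    show "\<exists>d>0. \<forall>x'\<in>{0..L}. dist x' x < d \<longrightarrow> dist (conv w \<phi> x') (conv w \<phi> x) < e"
    proof (intro exI[of _ d] conjI ballI impI d(1))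
      fix x' assume x': "x' \<in> {0..L}" "dist x' x < d"
      have "norm (conv w \<phi> x' - conv w \<phi> x) \<le> e / 2"
      proof (cases "x \<le> x'")
        case True then show ?thesis using x x' by (intro d(2)) (auto simp: dist_real_def)
      next
        case False
        then have "norm (conv w \<phi> x - conv w \<phi> x') \<le> e / 2"
          using x x' by (intro d(2)) (auto simp: dist_real_def)
        then show ?thesis by (simp add: norm_minus_commute)
      qed
      then show "dist (conv w \<phi> x') (conv w \<phi> x) < e" using e by (simp add: dist_norm)
    qed
  qed
qed

lemma prim_taylor:
  fixes f :: "real \<Rightarrow> 'a::banach"
  assumes f: "continuous_on {0..} f" and h: "0 \<le> \<tau>" "0 \<le> h"
    and e: "\<And>s. \<tau> \<le> s \<Longrightarrow> s \<le> \<tau> + h \<Longrightarrow> norm (f s - f \<tau>) \<le> e"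
  shows "norm (prim f (\<tau> + h) - prim f \<tau> - h *\<^sub>R f \<tau>) \<le> e * h"
proof -
  have int: "f integrable_on {\<tau>..\<tau> + h}"
    by (intro integrable_continuous_real continuous_on_subset[OF f]) (use h in auto)
  have "prim f \<tau> + integral {\<tau>..\<tau> + h} f = prim f (\<tau> + h)"
    unfolding prim_def using h
    by (intro Henstock_Kurzweil_Integration.integral_combine integrable_on_if_continuous_atLeast f) auto
  then have "prim f (\<tau> + h) - prim f \<tau> - h *\<^sub>R f \<tau> = integral {\<tau>..\<tau> + h} (\<lambda>s. f s - f \<tau>)"
    using h int by (subst integral_diff) (auto simp: algebra_simps)
  also have "norm \<dots> \<le> e * (\<tau> + h - \<tau>)"
    by (intro integral_bound continuous_intros continuous_on_subset[OF f]) (use h e in auto)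
  finally show ?thesis by simp
qed

text \<open>\<open>conv w (prim f)\<close> has derivative \<open>conv w f\<close>: since prim f 0 =
  0, the boundary contribution is at most of order h times the mass of w on a short interval. The
  fundamental theorem then takes the place of an exchange of integrals.\<close>

lemma prim_conv:
  fixes f :: "real \<Rightarrow> 'a::cbanach"
  assumes f: "continuous_on {0..} f" and t: "0 \<le> t"
  shows "prim (conv w f) t = conv w (prim f) t"
proof (cases "t = 0")
  case False
  define L where "L = t"
  have L: "L > 0" using t False by (simp add: L_def)
  note F = continuous_on_prim[OF f]
  note Jf = continuous_on_conv[OF f]
  have deriv: "(conv w (prim f) has_vector_derivative conv w f x) (at x within {0..L})" if x: "x \<in> {0..L}" for x
    unfolding has_vector_derivative_def has_derivative_within_alt
  proof (intro conjI allI impI bounded_linear_scaleR_left)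
    fix e :: real assume e: "e > 0"
    obtain M where M: "M > 0" "\<And>t. 0 \<le> t \<Longrightarrow> t \<le> L \<Longrightarrow> norm (f t) \<le> M"
      using continuous_bound[OF f] by blast
    have "\<exists>d>0. \<forall>t t'. 0 \<le> t \<and> t \<le> t' \<and> t' \<le> L \<and> t' - t < d \<longrightarrow>
      norm (conv w (prim f) t' - conv w (prim f) t - conv w (\<lambda>\<tau>. (t' - t) *\<^sub>R f \<tau>) t) \<le> (e / 2) * (t' - t)"
    proof (rule conv_uniform[OF F _ L, where M = M and \<psi> = "\<lambda>h \<tau>. h *\<^sub>R f \<tau>" and r = "\<lambda>h. h"])
      fix e :: real assume "e > 0"
      then obtain d where d: "d > 0" "\<And>t t'. 0 \<le> t \<Longrightarrow> 0 \<le> t' \<Longrightarrow> t \<le> L \<Longrightarrow> t' \<le> L \<Longrightarrow> \<bar>t' - t\<bar> < d \<Longrightarrow> norm (f t' - f t) \<le> e"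
        using continuous_modulus[OF f, of e L] by blast
      show "\<exists>d>0. \<forall>h \<tau>. 0 \<le> h \<and> h < d \<and> 0 \<le> \<tau> \<and> \<tau> + h \<le> L \<longrightarrow>
          norm (prim f (\<tau> + h) - prim f \<tau> - h *\<^sub>R f \<tau>) \<le> e * h"
        by (intro exI[of _ d] conjI allI impI prim_taylor f d) auto
    next
      \<comment> \<open>Near 0 the primitive is at most M h, the rate needed on the piece
        [t, t'].\<close>
      fix h \<tau> :: real assume *: "0 \<le> \<tau>" "\<tau> \<le> h" "h \<le> L"
      have "norm (prim f \<tau>) \<le> M * \<tau>" using * by (intro prim_norm_le f M(2)) auto
      also have "\<dots> \<le> M * h" using M(1) * by simp
      finally show "norm (prim f \<tau>) \<le> M * h" .
    qed (use e M in \<open>auto intro!: continuous_intros f\<close>)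
    then obtain d1 where d1: "d1 > 0" "\<And>t t'. 0 \<le> t \<Longrightarrow> t \<le> t' \<Longrightarrow> t' \<le> L \<Longrightarrow> t' - t < d1 \<Longrightarrow>
        norm (conv w (prim f) t' - conv w (prim f) t - (t' - t) *\<^sub>R conv w f t) \<le> (e / 2) * (t' - t)"
      by (auto simp: scaleR_scaleC conv_scaleC f)
    obtain d2 where d2: "d2 > 0" "\<And>t t'. 0 \<le> t \<Longrightarrow> 0 \<le> t' \<Longrightarrow> t \<le> L \<Longrightarrow> t' \<le> L \<Longrightarrow> \<bar>t' - t\<bar> < d2 \<Longrightarrow>
        norm (conv w f t' - conv w f t) \<le> e / 2"
      using continuous_modulus[OF Jf, of "e / 2" L] e by auto
    show "\<exists>d>0. \<forall>y\<in>{0..L}. norm (y - x) < d \<longrightarrow>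
      norm (conv w (prim f) y - conv w (prim f) x - (y - x) *\<^sub>R conv w f x) \<le> e * norm (y - x)"
    proof (intro exI[of _ "min d1 d2"] conjI ballI impI)
      show "min d1 d2 > 0" using d1(1) d2(1) by simp
      fix y assume y: "y \<in> {0..L}" "norm (y - x) < min d1 d2"
      show "norm (conv w (prim f) y - conv w (prim f) x - (y - x) *\<^sub>R conv w f x) \<le> e * norm (y - x)"
      proof (cases "x \<le> y")
        case True
        then have "norm (conv w (prim f) y - conv w (prim f) x - (y - x) *\<^sub>R conv w f x) \<le> e / 2 * (y - x)"
          using x y by (intro d1(2)) auto
        also have "\<dots> \<le> e * norm (y - x)" using True e by simp
        finally show ?thesis .
      next
        case False
        then have 1: "norm (conv w (prim f) x - conv w (prim f) y - (x - y) *\<^sub>R conv w f y) \<le> e / 2 * (x - y)"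
          using x y by (intro d1(2)) auto
        \<comment> \<open>For y < x the expansion is centred at y; continuity of
          \<open>conv w f\<close> moves the derivative from y to x.\<close>
        have "norm (conv w f y - conv w f x) \<le> e / 2" using x y by (intro d2(2)) auto
        then have 2: "norm ((x - y) *\<^sub>R (conv w f y - conv w f x)) \<le> (x - y) * (e / 2)"
          using False by (simp add: mult_left_mono)
        have "conv w (prim f) y - conv w (prim f) x - (y - x) *\<^sub>R conv w f x =
          - (conv w (prim f) x - conv w (prim f) y - (x - y) *\<^sub>R conv w f y) - (x - y) *\<^sub>R (conv w f y - conv w f x)"
          by (simp add: algebra_simps)
        also have "norm \<dots> \<le> e / 2 * (x - y) + (x - y) * (e / 2)"
          by (rule order_trans[OF norm_triangle_ineq4 add_mono])
             (use 1 2 in \<open>simp_all only: norm_minus_cancel\<close>)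
        also have "\<dots> = e * norm (y - x)" using False by simp
        finally show ?thesis .
      qed
    qed
  qed
  have "(conv w f has_integral conv w (prim f) L - conv w (prim f) 0) {0..L}"
    using L by (intro fundamental_theorem_of_calculus deriv) auto
  then show ?thesis
    by (simp add: L_def prim_def integral_unique conv_def[of w _ 0])
qed (simp add: conv_def prim_def)

end

section \<open>Strongly continuous semigroups\<close>

lemma right_difference_quotient:
  fixes f :: "real \<Rightarrow> 'a::real_normed_vector"
  assumes "(f has_vector_derivative D) (at x within {x..L})" "x < L"
  shows "((\<lambda>h. (1 / h) *\<^sub>R (f (x + h) - f x)) \<longlongrightarrow> D) (at_right 0)"
proof -
  have "((\<lambda>y. (1 / norm (y - x)) *\<^sub>R (f y - (f x + (y - x) *\<^sub>R D))) \<longlongrightarrow> 0) (at_right x)"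
    using assms unfolding has_vector_derivative_def has_derivative_within
    by (simp add: at_within_Icc_at_right)
  then have "((\<lambda>h. (1 / norm h) *\<^sub>R (f (h + x) - (f x + h *\<^sub>R D))) \<longlongrightarrow> 0) (at_right 0)"
    by (subst (asm) filterlim_at_right_to_0) simp
  then have "((\<lambda>h. (1 / h) *\<^sub>R (f (x + h) - f x) - D) \<longlongrightarrow> 0) (at_right 0)"
  proof (rule Lim_transform_eventually)
    show "\<forall>\<^sub>F h in at_right 0. (1 / norm h) *\<^sub>R (f (h + x) - (f x + h *\<^sub>R D)) =
        (1 / h) *\<^sub>R (f (x + h) - f x) - D"
      unfolding eventually_at_right_field
      by (intro exI[of _ 1]) (auto simp: algebra_simps)
  qed
  then show ?thesis using Lim_null by blast
qed

text \<open>A resolvent at one point is carried along because it stands in for closedness: by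
  \<open>A_iff\<close> the generator is the set of pairs with x = R (\<beta> x - y), a condition
  preserved by limits and integrals.\<close>

locale C0_generator =
  fixes T :: "real \<Rightarrow> 'x::cbanach \<Rightarrow>\<^sub>C\<^sub>L 'x" and A \<beta> R
  assumes C0: "C0_semigroup T" and generator: "generator T = A" and res: "is_resolvent A \<beta> R"
begin

lemma T_0 [simp]: "T 0 x = x"
  and T_add: "0 \<le> s \<Longrightarrow> 0 \<le> t \<Longrightarrow> T (s + t) x = T s (T t x)"
  and T_continuous: "continuous_on {0..} (\<lambda>t. T t x)"
  using C0 by (auto simp: C0_semigroup_def)

lemma generator_iff: "(x, y) \<in> A \<longleftrightarrow> ((\<lambda>h. (1 / h) *\<^sub>R (T h x - x)) \<longlongrightarrow> y) (at_right 0)"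
  using generator by (auto simp: generator_def)

lemma single_valued_A: "single_valued A"
  unfolding single_valued_def generator_iff
  using tendsto_unique[OF trivial_limit_at_right_real] by blast

lemma resolvent_in_A: "(R v, \<beta> *\<^sub>C R v - v) \<in> A"
  using res by (simp add: is_resolvent_def)

lemma A_iff: "(x, y) \<in> A \<longleftrightarrow> x = R (\<beta> *\<^sub>C x - y)"
proof
  assume "(x, y) \<in> A"
  then show "x = R (\<beta> *\<^sub>C x - y)" using res by (auto simp: is_resolvent_def)
next
  assume "x = R (\<beta> *\<^sub>C x - y)"
  then show "(x, y) \<in> A" using resolvent_in_A[of "\<beta> *\<^sub>C x - y"] by simp
qed

lemma A_add: "(x, y) \<in> A \<Longrightarrow> (x', y') \<in> A \<Longrightarrow> (x + x', y + y') \<in> A"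
  unfolding generator_iff
  using tendsto_add[of "\<lambda>h. (1 / h) *\<^sub>R (T h x - x)" y "at_right 0" "\<lambda>h. (1 / h) *\<^sub>R (T h x' - x')" y']
  by (simp add: algebra_simps)

lemma A_scaleC: "(x, y) \<in> A \<Longrightarrow> (c *\<^sub>C x, c *\<^sub>C y) \<in> A"
  unfolding generator_iff
  using bounded_linear.tendsto[OF bounded_linear_scaleC, of "\<lambda>h. (1 / h) *\<^sub>R (T h x - x)" y "at_right 0" c]
  by (simp add: scaleC_scaleR_commute complex_vector.scale_right_diff_distrib)

lemma A_diff: "(x, y) \<in> A \<Longrightarrow> (x', y') \<in> A \<Longrightarrow> (x - x', y - y') \<in> A"
  using A_add[of x y "(-1) *\<^sub>C x'" "(-1) *\<^sub>C y'"] A_scaleC[of x' y' "-1"] by simp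

lemma T_commute: "0 \<le> s \<Longrightarrow> 0 \<le> t \<Longrightarrow> T s (T t x) = T t (T s x)"
  using T_add[of s t x] T_add[of t s x] by (simp add: add.commute)

lemma A_T:
  assumes "(x, y) \<in> A" "0 \<le> t"
  shows "(T t x, T t y) \<in> A"
  unfolding generator_iff
proof (rule Lim_transform_eventually)
  show "((\<lambda>h. T t ((1 / h) *\<^sub>R (T h x - x))) \<longlongrightarrow> T t y) (at_right 0)"
    using assms(1) unfolding generator_iff by (intro cblinfun.tendsto tendsto_const)
  show "\<forall>\<^sub>F h in at_right 0. T t ((1 / h) *\<^sub>R (T h x - x)) = (1 / h) *\<^sub>R (T h (T t x) - T t x)"
    unfolding eventually_at_right_field
    using assms(2) by (intro exI[of _ 1]) (simp add: T_commute)
qed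

lemma R_T: "R (T t v) = T t (R v)" if "0 \<le> t"
proof -
  have "T t (R v) = R (\<beta> *\<^sub>C T t (R v) - T t (\<beta> *\<^sub>C R v - v))"
    using A_T[OF resolvent_in_A that] unfolding A_iff .
  then show ?thesis by simp
qed

section \<open>Orbits, their primitives and the generator\<close>

abbreviation orbit :: "'x \<Rightarrow> real \<Rightarrow> 'x"
  where "orbit x \<equiv> \<lambda>t. cblinfun_apply (T t) x"

lemma T_prim: "T h (prim (orbit x) t) = prim (orbit x) (t + h) - prim (orbit x) h"
  if "0 \<le> h" "0 \<le> t"
proof -
  note int = integrable_on_if_continuous_atLeast[OF T_continuous]
  have "T h (prim (orbit x) t) = prim (\<lambda>s. T h (T s x)) t"
    by (rule prim_linear[OF T_continuous cblinfun.bounded_linear_right])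
  also have "\<dots> = integral {0..t} (\<lambda>s. T (s + h) x)"
    unfolding prim_def
    by (rule integral_cong) (use that in \<open>simp add: T_add[symmetric] add.commute\<close>)
  also have "\<dots> = integral {h..t + h} (orbit x)"
  proof (rule integral_unique)
    have "orbit x integrable_on {h..t + h}"
      by (intro integrable_continuous_real continuous_on_subset[OF T_continuous]) (use that in auto)
    then show "((\<lambda>s. T (s + h) x) has_integral integral {h..t + h} (orbit x)) {0..t}"
      using has_integral_shift_cbox_iff[of "orbit x" h _ 0 t]
      by (simp add: has_integral_integral o_def add.commute)
  qed
  also have "\<dots> = prim (orbit x) (t + h) - prim (orbit x) h"
    using Henstock_Kurzweil_Integration.integral_combine[of 0 h "t + h" "orbit x"] int that
    by (simp add: prim_def algebra_simps)
  finally show ?thesis .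
qed

text \<open>The difference quotient of T(h) at this integral is that of the primitive at t minus
  that at 0.\<close>

lemma prim_orbit_in_A: "(prim (orbit x) t, T t x - x) \<in> A" if "0 \<le> t"
  unfolding generator_iff
proof (rule Lim_transform_eventually)
  have D: "(prim (orbit x) has_vector_derivative T s x) (at s within {s..s + 1})" if "0 \<le> s" for s
    using that
    by (intro has_vector_derivative_within_subset[OF prim_has_vector_derivative[OF T_continuous, of s "s + 1"]]) auto
  show "((\<lambda>h. (1 / h) *\<^sub>R (prim (orbit x) (t + h) - prim (orbit x) t) -
      (1 / h) *\<^sub>R (prim (orbit x) (0 + h) - prim (orbit x) 0)) \<longlongrightarrow> T t x - x) (at_right 0)"
    using right_difference_quotient[OF D[OF that]] right_difference_quotient[OF D[of 0]]
    by (intro tendsto_diff) auto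
  show "\<forall>\<^sub>F h in at_right 0. (1 / h) *\<^sub>R (prim (orbit x) (t + h) - prim (orbit x) t) -
      (1 / h) *\<^sub>R (prim (orbit x) (0 + h) - prim (orbit x) 0) =
      (1 / h) *\<^sub>R (T h (prim (orbit x) t) - prim (orbit x) t)"
    unfolding eventually_at_right_field
    using that by (intro exI[of _ 1]) (auto simp: T_prim algebra_simps)
qed

text \<open>The generator is applied to the primitive of the orbit of x in two ways: by
  \<open>prim_orbit_in_A\<close>, and through R, since x = R v with v = \<beta> x - y and R passes
  under the integral. Single-valuedness equates the results.\<close>

lemma T_eq_prim:
  assumes "(x, y) \<in> A" "0 \<le> t"
  shows "T t x = x + prim (orbit y) t"
proof -
  have x: "x = R (\<beta> *\<^sub>C x - y)" using assms(1) by (simp add: A_iff)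
  define v where "v = \<beta> *\<^sub>C x - y"
  have "R (prim (orbit v) t) = prim (\<lambda>s. R (T s v)) t"
    by (rule prim_linear[OF T_continuous cblinfun.bounded_linear_right])
  also have "\<dots> = prim (orbit x) t"
    unfolding prim_def by (rule integral_cong) (simp add: R_T, simp add: x[folded v_def, symmetric])
  finally have "prim (orbit x) t = R (prim (orbit v) t)" ..
  then have "(prim (orbit x) t, \<beta> *\<^sub>C prim (orbit x) t - prim (orbit v) t) \<in> A"
    using resolvent_in_A by simp
  then have "T t x - x = \<beta> *\<^sub>C prim (orbit x) t - prim (orbit v) t"
    using prim_orbit_in_A[OF assms(2)] single_valued_A unfolding single_valued_def by blast
  also have "prim (orbit v) t = \<beta> *\<^sub>C prim (orbit x) t - prim (orbit y) t"
  proof -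
    note int = integrable_on_if_continuous_atLeast[OF T_continuous]
    have "prim (orbit v) t = integral {0..t} (\<lambda>s. \<beta> *\<^sub>C T s x - T s y)"
      by (simp add: prim_def v_def)
    also have "\<dots> = integral {0..t} (\<lambda>s. \<beta> *\<^sub>C T s x) - prim (orbit y) t"
      unfolding prim_def
      by (intro integral_diff int integrable_on_if_continuous_atLeast
          bounded_linear.continuous_on[OF bounded_linear_scaleC T_continuous])
    also have "integral {0..t} (\<lambda>s. \<beta> *\<^sub>C T s x) = \<beta> *\<^sub>C prim (orbit x) t"
      using prim_linear[OF T_continuous bounded_linear_scaleC, of \<beta> x t] by (simp add: prim_def)
    finally show ?thesis .
  qed
  finally show ?thesis by (simp add: algebra_simps)
qed

lemma T_has_vector_derivative:
  assumes "(x, y) \<in> A" "0 \<le> t" "t \<le> L"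
  shows "(orbit x has_vector_derivative T t y) (at t within {0..L})"
proof (rule has_vector_derivative_transform[of t "{0..L}" "orbit x" "\<lambda>t. x + prim (orbit y) t"])
  show "((\<lambda>t. x + prim (orbit y) t) has_vector_derivative T t y) (at t within {0..L})"
    using has_vector_derivative_add[OF has_vector_derivative_const
        prim_has_vector_derivative[OF T_continuous assms(2,3)], of x]
    by simp
qed (use assms T_eq_prim[OF assms(1)] in auto)

text \<open>The means (1 / h) prim (orbit x) h lie in the domain and tend to x as h \<rightarrow>
  0.\<close>

lemma Domain_dense: "closure (Domain A) = UNIV"
proof -
  have "x \<in> closure (Domain A)" for x
    unfolding closure_sequential
  proof (intro exI conjI allI)
    have D: "(prim (orbit x) has_vector_derivative T 0 x) (at 0 within {0..1})"
      by (rule prim_has_vector_derivative[OF T_continuous]) auto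
    then have lim: "((\<lambda>h. (1 / h) *\<^sub>R prim (orbit x) h) \<longlongrightarrow> x) (at_right 0)"
      using right_difference_quotient[OF D] by simp
    have seq: "filterlim (\<lambda>n. 1 / real (Suc n)) (at_right 0) sequentially"
      using LIMSEQ_inverse_real_of_nat
      unfolding filterlim_at inverse_eq_divide by (auto intro!: always_eventually)
    show "(\<lambda>n. (1 / (1 / real (Suc n))) *\<^sub>R prim (orbit x) (1 / real (Suc n))) \<longlonglongrightarrow> x"
      by (rule filterlim_compose[OF lim seq])
    show "(1 / (1 / real (Suc n))) *\<^sub>R prim (orbit x) (1 / real (Suc n)) \<in> Domain A" for n
      using A_scaleC[OF prim_orbit_in_A[of "1 / real (Suc n)" x], of "of_real (1 / (1 / real (Suc n)))"]
      unfolding scaleR_scaleC by (intro DomainI) simp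
  qed
  then show ?thesis by auto
qed

text \<open>The inverse of -A is the integral of T over [0, \<infinity>), here summed as T(n) V x
  with V x the integral over [0, 1], so that convergence is that of a geometric series.\<close>

lemma zero_in_resolvent_set_if_exp_stable:
  assumes \<epsilon>: "\<epsilon> > 0" and M: "\<And>t. t \<ge> 0 \<Longrightarrow> norm (T t) \<le> M * exp (- \<epsilon> * t)"
  shows "0 \<in> resolvent_set A"
proof -
  define V where "V x = prim (orbit x) 1" for x
  define q where "q = exp (- \<epsilon>)"
  have q: "0 < q" "q < 1" using \<epsilon> by (auto simp: q_def)
  have M0: "M \<ge> 0" using order_trans[OF norm_ge_zero M[of 0]] by simp
  have T_norm: "norm (T t x) \<le> M * exp (- \<epsilon> * t) * norm x" if "t \<ge> 0" for t x
    by (rule order_trans[OF norm_cblinfun mult_right_mono[OF M[OF that]]]) simp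
  have T_nat: "norm (T (real n) x) \<le> M * q ^ n * norm x" for n x
    using T_norm[of "real n" x] by (simp add: q_def exp_of_nat_mult[symmetric] mult.commute)
  have V_norm: "norm (V x) \<le> M * norm x" for x
  proof -
    have "norm (V x) \<le> (M * norm x) * 1"
      unfolding V_def
    proof (rule prim_norm_le[OF T_continuous])
      fix s :: real assume s: "0 \<le> s" "s \<le> 1"
      have "norm (T s x) \<le> M * exp (- \<epsilon> * s) * norm x" using T_norm s by simp
      also have "\<dots> \<le> M * 1 * norm x" using M0 s \<epsilon> by (intro mult_right_mono mult_left_mono) auto
      finally show "norm (T s x) \<le> M * norm x" by simp
    qed simp
    then show ?thesis by simp
  qed
  have V_add: "V (x + y) = V x + V y" for x y
    unfolding V_def prim_def
    by (simp add: integral_add integrable_on_if_continuous_atLeast T_continuous)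
  have V_scale: "V (c *\<^sub>C x) = c *\<^sub>C V x" for c x
    using prim_linear[OF T_continuous bounded_linear_scaleC, of c x 1]
    by (simp add: V_def)
  define a where "a x n = T (real n) (V x)" for x n
  have a_norm: "norm (a x n) \<le> M * (M * norm x) * q ^ n" for x n
  proof -
    have "norm (a x n) \<le> M * q ^ n * norm (V x)" unfolding a_def by (rule T_nat)
    also have "\<dots> \<le> M * q ^ n * (M * norm x)" using M0 q V_norm by (intro mult_left_mono) auto
    finally show ?thesis by (simp add: mult.commute mult.left_commute)
  qed
  have geo: "summable (\<lambda>n. M * (M * norm x) * q ^ n)" for x
    using q by (intro summable_mult summable_geometric) auto
  have a_summable: "summable (a x)" for x
    by (rule summable_comparison_test[OF _ geo[of x]]) (use a_norm in auto)
  obtain P :: "'x \<Rightarrow>\<^sub>C\<^sub>L 'x" where P: "\<And>x. P x = suminf (a x)"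
  proof (rule cblinfun_exists_norm[of "\<lambda>x. suminf (a x)" "M * M / (1 - q)"])
    show "suminf (a (x + y)) = suminf (a x) + suminf (a y)" for x y
    proof -
      have "a (x + y) = (\<lambda>n. a x n + a y n)" by (simp add: a_def V_add fun_eq_iff)
      then show ?thesis by (simp add: suminf_add[OF a_summable a_summable])
    qed
    show "suminf (a (c *\<^sub>C x)) = c *\<^sub>C suminf (a x)" for c x
    proof -
      have "a (c *\<^sub>C x) = (\<lambda>n. c *\<^sub>C a x n)" by (simp add: a_def V_scale fun_eq_iff)
      then show ?thesis by (simp add: bounded_linear.suminf[OF bounded_linear_scaleC a_summable])
    qed
    show "norm (suminf (a x)) \<le> norm x * (M * M / (1 - q))" for x
    proof -
      have "norm (suminf (a x)) \<le> (\<Sum>n. M * (M * norm x) * q ^ n)"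
        by (rule norm_suminf_le[OF a_norm geo])
      also have "\<dots> = M * (M * norm x) * (\<Sum>n. q ^ n)"
        by (rule suminf_mult) (use q in \<open>simp add: summable_geometric\<close>)
      also have "\<dots> = norm x * (M * M / (1 - q))"
        using q by (simp add: suminf_geometric)
      finally show ?thesis .
    qed
  qed (rule that)
  have T_lim: "(\<lambda>n. T (real n) x) \<longlonglongrightarrow> 0" for x
  proof (rule Lim_null_comparison)
    show "\<forall>\<^sub>F n in sequentially. norm (T (real n) x) \<le> M * q ^ n * norm x" using T_nat by auto
    have "(\<lambda>n. M * q ^ n * norm x) \<longlonglongrightarrow> M * 0 * norm x"
      using q by (intro tendsto_intros LIMSEQ_realpow_zero) auto
    then show "(\<lambda>n. M * q ^ n * norm x) \<longlonglongrightarrow> 0" by simp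
  qed
  \<comment> \<open>A applied to the partial sums telescopes to T(n) x - x.\<close>
  have part: "(\<Sum>k<n. a x k, T (real n) x - x) \<in> A" for x n
  proof (induction n)
    case 0 show ?case using A_scaleC[OF resolvent_in_A, of 0 0] by simp
  next
    case (Suc n)
    have "(V x, T 1 x - x) \<in> A" unfolding V_def by (rule prim_orbit_in_A) simp
    then have "(a x n, T (real n) (T 1 x - x)) \<in> A" unfolding a_def by (rule A_T) simp
    from A_add[OF Suc.IH this] show ?case using T_add[of "real n" 1 x] by (simp add: add.commute)
  qed
  \<comment> \<open>The limit is taken in x = R (\<beta> x - y), that is, by closedness of
    A.\<close>
  have P_A: "(P x, - x) \<in> A" for x
    unfolding A_iff
  proof (rule LIMSEQ_unique)
    have sum_lim: "(\<lambda>n. \<Sum>k<n. a x k) \<longlonglongrightarrow> P x"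
      unfolding P by (rule summable_LIMSEQ[OF a_summable])
    then show "(\<lambda>n. \<Sum>k<n. a x k) \<longlonglongrightarrow> P x" .
    have "(\<lambda>n. R (\<beta> *\<^sub>C (\<Sum>k<n. a x k) - (T (real n) x - x))) \<longlonglongrightarrow> R (\<beta> *\<^sub>C P x - (0 - x))"
      by (intro cblinfun.tendsto tendsto_const tendsto_diff sum_lim T_lim
          bounded_linear.tendsto[OF bounded_linear_scaleC])
    moreover have "R (\<beta> *\<^sub>C (\<Sum>k<n. a x k) - (T (real n) x - x)) = (\<Sum>k<n. a x k)" for n
      using part[of x n] unfolding A_iff by (rule sym)
    ultimately show "(\<lambda>n. \<Sum>k<n. a x k) \<longlonglongrightarrow> R (\<beta> *\<^sub>C P x - - x)"
      by (simp only: diff_0)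
  qed
  \<comment> \<open>A vector killed by A is fixed by every T(n), and T(n) tends to 0 on it.\<close>
  have "P (- y) = x" if "(x, y) \<in> A" for x y
  proof -
    have "(P (- y) - x, 0) \<in> A" using A_diff[OF P_A[of "- y"] that] by simp
    then have "T (real n) (P (- y) - x) = P (- y) - x" for n
      using T_eq_prim[of "P (- y) - x" 0 "real n"] by (simp add: prim_def del: cblinfun.diff_right)
    then have "(\<lambda>n::nat. P (- y) - x) \<longlonglongrightarrow> 0" using T_lim[of "P (- y) - x"] by simp
    then show ?thesis using LIMSEQ_unique[OF tendsto_const] by fastforce
  qed
  then have "is_resolvent A 0 P"
    unfolding is_resolvent_def using P_A by auto
  then show ?thesis unfolding resolvent_set_def by blast
qed

end

text \<open>Product rule at 0. Applied to the rescaled semigroup with -\<mu>, it also yields the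
  converse.\<close>

lemma generator_exp_shift:
  fixes T :: "real \<Rightarrow> 'x::cbanach \<Rightarrow>\<^sub>C\<^sub>L 'x"
  assumes "(x, y) \<in> generator T"
  shows "(x, y + \<mu> *\<^sub>C x) \<in> generator (\<lambda>t. exp (t *\<^sub>R \<mu>) *\<^sub>C T t)"
proof -
  have D: "((\<lambda>t. exp (t *\<^sub>R \<mu>)) has_vector_derivative \<mu>) (at 0 within {0..1})"
    using exp_scaleR_has_vector_derivative_right[of \<mu> 0 "{0..1}"] by simp
  have exp1: "((\<lambda>h. (1 / h) *\<^sub>R (exp (h *\<^sub>R \<mu>) - 1)) \<longlongrightarrow> \<mu>) (at_right 0)"
    using right_difference_quotient[OF D] by simp
  have "((\<lambda>h. exp (h *\<^sub>R \<mu>)) \<longlongrightarrow> exp (0 *\<^sub>R \<mu>)) (at_right 0)"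
    by (intro tendsto_intros)
  then have exp0: "((\<lambda>h. exp (h *\<^sub>R \<mu>)) \<longlongrightarrow> 1) (at_right 0)" by simp
  have "((\<lambda>h. exp (h *\<^sub>R \<mu>) *\<^sub>C ((1 / h) *\<^sub>R (T h x - x)) + ((1 / h) *\<^sub>R (exp (h *\<^sub>R \<mu>) - 1)) *\<^sub>C x)
      \<longlongrightarrow> 1 *\<^sub>C y + \<mu> *\<^sub>C x) (at_right 0)"
    using assms unfolding generator_def
    by (intro tendsto_add tendsto_scaleC exp0 exp1 tendsto_const) simp
  also have "(\<lambda>h. exp (h *\<^sub>R \<mu>) *\<^sub>C ((1 / h) *\<^sub>R (T h x - x)) + ((1 / h) *\<^sub>R (exp (h *\<^sub>R \<mu>) - 1)) *\<^sub>C x) =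
      (\<lambda>h. (1 / h) *\<^sub>R ((exp (h *\<^sub>R \<mu>) *\<^sub>C T h) x - x))"
    by (simp add: fun_eq_iff scaleC_scaleR_commute complex_vector.scale_right_diff_distrib
        scaleR_diff_right bounded_bilinear.scaleR_left[OF bounded_bilinear_scaleC]
        bounded_bilinear.diff_left[OF bounded_bilinear_scaleC] scaleC_one)
  finally show ?thesis by (simp add: generator_def scaleC_one)
qed

text \<open>Rescaling by e^{-\<nu> t} moves \<nu> to 0 and makes the semigroup decay at rate Re
  \<nu> - \<omega>, for an exponential bound \<omega> < Re \<nu>. The identity for the transfer
  function speaks of resolvents on this half-plane.\<close>

lemma half_plane_subset_resolvent_set:
  fixes T :: "real \<Rightarrow> 'x::cbanach \<Rightarrow>\<^sub>C\<^sub>L 'x"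
  assumes C0: "C0_semigroup T" and "\<beta> \<in> resolvent_set (generator T)"
    and \<nu>: "\<nu> \<in> half_plane (growth_bound T)"
  shows "\<nu> \<in> resolvent_set (generator T)"
proof -
  let ?A = "generator T"
  obtain R where R: "is_resolvent ?A \<beta> R" using assms(2) by (auto simp: resolvent_set_def)
  have "growth_bound T < ereal (Re \<nu>)" using \<nu> by (simp add: half_plane_def)
  then obtain \<omega> M where \<omega>: "\<omega> < Re \<nu>" and M: "\<And>t. t \<ge> 0 \<Longrightarrow> norm (T t) \<le> M * exp (\<omega> * t)"
    unfolding growth_bound_def INF_less_iff by auto
  define S where "S = (\<lambda>t. exp (t *\<^sub>R (- \<nu>)) *\<^sub>C T t)"
  define B where "B = generator S"
  have B_iff: "(x, y) \<in> B \<longleftrightarrow> (x, y + \<nu> *\<^sub>C x) \<in> ?A" for x y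
  proof
    assume "(x, y) \<in> B"
    then have "(x, y + \<nu> *\<^sub>C x) \<in> generator (\<lambda>t. exp (t *\<^sub>R \<nu>) *\<^sub>C S t)"
      unfolding B_def by (rule generator_exp_shift)
    then show "(x, y + \<nu> *\<^sub>C x) \<in> ?A"
      by (simp add: S_def scaleC_scaleC exp_add[symmetric] scaleC_one)
  next
    assume "(x, y + \<nu> *\<^sub>C x) \<in> ?A"
    from generator_exp_shift[OF this, of "- \<nu>"] show "(x, y) \<in> B"
      by (simp add: B_def S_def)
  qed
  have "C0_semigroup S"
    unfolding C0_semigroup_def
  proof (intro conjI allI impI)
    fix x
    show "S 0 x = x" using C0 by (simp add: S_def C0_semigroup_def scaleC_one)
    show "S (s + t) x = S s (S t x)" if "0 \<le> s" "0 \<le> t" for s t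
    proof -
      have "exp ((s + t) *\<^sub>R (- \<nu>)) = exp (s *\<^sub>R (- \<nu>)) * exp (t *\<^sub>R (- \<nu>))"
        by (simp only: scaleR_add_left exp_add)
      then show ?thesis
        using C0 that by (simp only: S_def C0_semigroup_def cblinfun_apply_scaleC cblinfun_scaleC_right scaleC_scaleC
            mult.commute)
    qed
    show "continuous_on {0..} (\<lambda>t. S t x)"
      unfolding S_def cblinfun_apply_scaleC
      by (rule continuous_on_scaleC, intro continuous_intros) (use C0 in \<open>simp add: C0_semigroup_def\<close>)
  qed
  \<comment> \<open>The given resolvent serves the shifted generator at \<beta> - \<nu>, as the
    locale asks for one.\<close>
  moreover have "is_resolvent B (\<beta> - \<nu>) R"
    using R unfolding is_resolvent_def
    by (fastforce simp: B_iff scaleC_add_left bounded_bilinear.diff_left[OF bounded_bilinear_scaleC] algebra_simps)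
  ultimately interpret S: C0_generator S B "\<beta> - \<nu>" R
    by unfold_locales (simp_all add: B_def)
  have "0 \<in> resolvent_set B"
  proof (rule S.zero_in_resolvent_set_if_exp_stable[of "Re \<nu> - \<omega>" M])
    fix t :: real assume t: "t \<ge> 0"
    have "norm (S t) = exp (- (t * Re \<nu>)) * norm (T t)"
      by (simp add: S_def norm_scaleC norm_exp_eq_Re)
    also have "\<dots> \<le> exp (- (t * Re \<nu>)) * (M * exp (\<omega> * t))"
      using M[OF t] by (intro mult_left_mono) auto
    also have "\<dots> = M * exp (- (Re \<nu> - \<omega>) * t)"
      by (simp add: exp_add[symmetric] algebra_simps)
    finally show "norm (S t) \<le> M * exp (- (Re \<nu> - \<omega>) * t)" .
  qed (use \<omega> in simp)
  then obtain P where P: "is_resolvent B 0 P" by (auto simp: resolvent_set_def)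
  have "is_resolvent ?A \<nu> P"
    unfolding is_resolvent_def
  proof (intro conjI ballI allI, clarify)
    fix x y assume "(x, y) \<in> ?A"
    then have "(x, y - \<nu> *\<^sub>C x) \<in> B" by (simp add: B_iff)
    then show "P (\<nu> *\<^sub>C x - y) = x" using P by (auto simp: is_resolvent_def)
  next
    fix v
    have "(P v, - v) \<in> B" using P by (simp add: is_resolvent_def)
    then show "(P v, \<nu> *\<^sub>C P v - v) \<in> ?A" by (simp add: B_iff)
  qed
  then show ?thesis unfolding resolvent_set_def by blast
qed

section \<open>The adjoint semigroup\<close>

text \<open>\<beta> turns into its conjugate because the functionals are conjugate-linear.\<close>

lemma is_resolvent_adjoint:
  assumes "is_resolvent A \<beta> R"
  shows "is_resolvent (operator_adjoint A) (cnj \<beta>) (cadjoint R)"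
  unfolding is_resolvent_def
proof (intro conjI ballI allI, clarify)
  note R = assms[unfolded is_resolvent_def]
  fix f g assume fg: "(f, g) \<in> operator_adjoint A"
  show "cadjoint R (cnj \<beta> *\<^sub>C f - g) = f"
  proof (rule cdual_eqI)
    fix x
    have "(R x, \<beta> *\<^sub>C R x - x) \<in> A" using R by simp
    then have "f (\<beta> *\<^sub>C R x - x) = g (R x)" using fg by (auto simp: operator_adjoint_def)
    then show "cdual_apply (cadjoint R (cnj \<beta> *\<^sub>C f - g)) x = f x" by (simp add: algebra_simps)
  qed
next
  note R = assms[unfolded is_resolvent_def]
  fix f
  show "(cadjoint R f, cnj \<beta> *\<^sub>C cadjoint R f - f) \<in> operator_adjoint A"
    unfolding operator_adjoint_def
  proof clarify
    fix x y assume "(x, y) \<in> A"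
    then have "R (\<beta> *\<^sub>C x - y) = x" using R by auto
    then have "R y = \<beta> *\<^sub>C R x - x" by (simp add: algebra_simps)
    then show "cadjoint R f y = (cnj \<beta> *\<^sub>C cadjoint R f - f) x" by simp
  qed
qed

text \<open>On the domains, the pairing of S(t - s) f with T(s) x has derivative zero in s, and its
  values at 0 and t are the two sides. Density extends this to all x, then to all f. The domain of
  an adjoint need not be norm dense; here it is, because A* generates a semigroup.\<close>

lemma adjoint_semigroup:
  assumes T: "C0_generator T A \<beta> R" and S: "C0_generator S (operator_adjoint A) \<beta>' R'"
    and t: "0 \<le> t"
  shows "S t = cadjoint (T t)"
proof -
  interpret T: C0_generator T A \<beta> R by (rule T)
  interpret S: C0_generator S "operator_adjoint A" \<beta>' R' by (rule S)
  have on_domain: "cdual_apply (S t f) x = f (T t x)"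
    if x: "(x, y) \<in> A" and f: "(f, g) \<in> operator_adjoint A" for x y f g
  proof -
    have "((\<lambda>s. cdual_apply (S (t - s) f) (T s x)) has_vector_derivative 0) (at s within {0..t})"
      if s: "s \<in> {0..t}" for s
    proof -
      have 1: "((\<lambda>s. t - s) has_vector_derivative - 1) (at s within {0..t})"
        by (auto intro!: derivative_eq_intros)
      have "(\<lambda>s. t - s) ` {0..t} = {0..t}"
        by simp
      then have "(S.orbit f has_vector_derivative S (t - s) g) (at (t - s) within (\<lambda>s. t - s) ` {0..t})"
        using S.T_has_vector_derivative[OF f, of "t - s" t] s by auto
      from vector_diff_chain_within[OF 1 this]
      have "((\<lambda>s. S (t - s) f) has_vector_derivative - S (t - s) g) (at s within {0..t})"
        by (simp add: o_def)
      then have "((\<lambda>s. cdual_apply (S (t - s) f) (T s x)) has_vector_derivative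
          cdual_apply (S (t - s) f) (T s y) + cdual_apply (- S (t - s) g) (T s x)) (at s within {0..t})"
        using T.T_has_vector_derivative[OF x, of s t] s by (intro cdual.has_vector_derivative) auto
      moreover have "cdual_apply (S (t - s) f) (T s y) = cdual_apply (S (t - s) g) (T s x)"
        using S.A_T[OF f, of "t - s"] T.A_T[OF x, of s] s by (auto simp: operator_adjoint_def)
      ultimately show ?thesis by simp
    qed
    from has_vector_derivative_zero_constant[OF _ this]
    obtain c where c: "\<And>s. s \<in> {0..t} \<Longrightarrow> cdual_apply (S (t - s) f) (T s x) = c" by auto
    from c[of 0] c[of t] t show ?thesis by simp
  qed
  have on_dual_domain: "cdual_apply (S t f) x = f (T t x)"
    if f: "(f, g) \<in> operator_adjoint A" for x f g
    by (rule continuous_eq_on_dense[OF _ _ T.Domain_dense])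
       (use on_domain[OF _ f] in \<open>auto intro!: cdual.continuous_on cblinfun.continuous_on continuous_intros\<close>)
  show ?thesis
  proof (intro cblinfun_eqI)
    fix f
    show "S t f = cadjoint (T t) f"
      by (rule continuous_eq_on_dense[OF _ _ S.Domain_dense])
         (use on_dual_domain in \<open>auto intro!: cdual_eqI cblinfun.continuous_on continuous_intros\<close>)
  qed
qed

lemma growth_bound_adjoint:
  assumes "C0_generator T A \<beta> R" "C0_generator S (operator_adjoint A) \<beta>' R'"
  shows "growth_bound S = growth_bound T"
  unfolding growth_bound_def by (simp add: adjoint_semigroup[OF assms] norm_cadjoint cong: all_cong)

section \<open>System nodes\<close>

lemma resolvent_identity:
  assumes "is_resolvent A \<mu> R" "is_resolvent A \<nu> S"
  shows "R v - S v = (\<nu> - \<mu>) *\<^sub>C R (S v)"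
proof -
  have "(S v, \<nu> *\<^sub>C S v - v) \<in> A" using assms(2) by (simp add: is_resolvent_def)
  then have "R (\<mu> *\<^sub>C S v - (\<nu> *\<^sub>C S v - v)) = S v" using assms(1) by (auto simp: is_resolvent_def)
  then show ?thesis
    by (simp add: bounded_bilinear.diff_left[OF bounded_bilinear_scaleC] algebra_simps)
qed

text \<open>The conditions on a node that concern only A and its two spaces. For the dual node they
  are available before the transfer identity, whose proof relies on them.\<close>

locale node_data =
  fixes N :: "('u::cbanach, 'x1::cbanach, 'x::cbanach, 'xm::cbanach, 'y::cbanach) node" and \<beta>0 R0
  assumes gen: "generates_C0_semigroup (gen N)" and res0: "is_resolvent (gen N) \<beta>0 R0"
    and X1: "is_X1 (gen N) \<beta>0 (emb1 N)" and Xm1: "is_Xm1 (gen N) \<beta>0 (embm1 N)"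
begin

abbreviation "A \<equiv> gen N"
abbreviation "T \<equiv> semigroup_of (gen N)"
abbreviation "i \<equiv> cblinfun_apply (emb1 N)"
abbreviation "j \<equiv> cblinfun_apply (embm1 N)"
abbreviation "B \<equiv> cblinfun_apply (inp N)"
abbreviation "C \<equiv> cblinfun_apply (outp N)"
abbreviation "Am \<equiv> cblinfun_apply (ext_gen N)"

sublocale C0_generator T A \<beta>0 R0
proof -
  have "C0_semigroup T \<and> generator T = A"
    unfolding semigroup_of_def
    using someI_ex[of "\<lambda>T. C0_semigroup T \<and> generator T = A"] gen
    unfolding generates_C0_semigroup_def by blast
  then show "C0_generator T A \<beta>0 R0" by unfold_locales (use res0 in auto)
qed

lemma i_inj: "i z = i z' \<Longrightarrow> z = z'"
  using X1 by (auto simp: is_X1_def inj_def)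

lemma range_i: "range i = Domain A"
  and norm_X1: "(i z, y) \<in> A \<Longrightarrow> norm z = norm (\<beta>0 *\<^sub>C i z - y)"
  using X1 by (auto simp: is_X1_def)

lemma norm_j: "norm (j x) = norm (R0 x)"
  and range_j_dense: "closure (range j) = UNIV"
  using Xm1 resolvent_eq[OF res0] by (auto simp: is_Xm1_def)

lemma j_inj: "j x = j y \<Longrightarrow> x = y"
proof -
  assume "j x = j y"
  then have "norm (R0 (x - y)) = 0" by (simp add: norm_j[symmetric] del: cblinfun.diff_right) simp
  then show "x = y" using is_resolvent_inj[OF res0 single_valued_A] by simp
qed

lemma is_resolvent_resolvent: "\<mu> \<in> resolvent_set A \<Longrightarrow> is_resolvent A \<mu> (resolvent A \<mu>)"
  using resolvent_eq by (auto simp: resolvent_set_def)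

lemma node_domain_resolvent_set: "\<alpha> \<in> node_domain N \<Longrightarrow> \<alpha> \<in> resolvent_set A"
  using half_plane_subset_resolvent_set[OF C0, of \<beta>0 \<alpha>] res0 generator
  by (auto simp: node_domain_def resolvent_set_def)

lemma range_R0_dense: "closure (range (cblinfun_apply R0)) = UNIV"
  using range_is_resolvent[OF res0] Domain_dense by simp

text \<open>The extension runs along R0, taken as a dense embedding: A R0 v = \<beta>0 R0 v - v is
  bounded in X_{-1} by a multiple of norm (R0 v), because j x has the norm of R0 x.\<close>

lemma ext_gen_apply: "(x, y) \<in> A \<Longrightarrow> Am x = j y"
proof -
  have bound: "norm (j (\<beta>0 *\<^sub>C R0 v - v)) \<le> (cmod \<beta>0 * norm R0 + 1) * norm (R0 v)" for v
  proof -
    have "norm (j (\<beta>0 *\<^sub>C R0 v - v)) = norm (\<beta>0 *\<^sub>C R0 (R0 v) - R0 v)"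
      by (simp add: norm_j del: cblinfun.diff_right) simp
    also have "\<dots> \<le> cmod \<beta>0 * norm (R0 (R0 v)) + norm (R0 v)"
      using norm_triangle_ineq4[of "\<beta>0 *\<^sub>C R0 (R0 v)" "R0 v"] by (simp add: norm_scaleC)
    also have "\<dots> \<le> cmod \<beta>0 * (norm R0 * norm (R0 v)) + norm (R0 v)"
      by (intro add_mono mult_left_mono norm_cblinfun) auto
    finally show ?thesis by (simp add: algebra_simps)
  qed
  obtain E where E: "\<And>v. cblinfun_apply E (R0 v) = j (\<beta>0 *\<^sub>C R0 v - v)"
    by (rule extension_exists[OF range_R0_dense, of "\<lambda>v. j (\<beta>0 *\<^sub>C R0 v - v)"
          "cmod \<beta>0 * norm R0 + 1"])
       (use bound in \<open>auto simp: scaleC_add_right complex_vector.scale_right_diff_distrib scaleC_scaleC mult.commute\<close>)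
  have on_A: "cblinfun_apply E x = j y" if "(x, y) \<in> A" for x y
    using E[of "\<beta>0 *\<^sub>C x - y"] unfolding that[unfolded A_iff, symmetric] by simp
  have "ext_gen N = E"
    unfolding ext_gen_def
  proof (rule the_equality)
    show "\<forall>(x, y)\<in>A. cblinfun_apply E x = j y" using on_A by auto
    fix E' :: "'x \<Rightarrow>\<^sub>C\<^sub>L 'xm" assume E': "\<forall>(x, y)\<in>A. cblinfun_apply E' x = j y"
    show "E' = E"
      by (rule cblinfun_eq_on_dense[OF range_R0_dense]) (use E' E resolvent_in_A in fastforce)
  qed
  then show "(x, y) \<in> A \<Longrightarrow> Am x = j y" using on_A by simp
qed

text \<open>Bounded in X_{-1} because T(t) commutes with R0.\<close>

lemma ext_semigroup_apply:
  assumes "0 \<le> t"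
  shows "ext_semigroup N t (j v) = j (T t v)"
  unfolding ext_semigroup_def
proof (rule extension_apply[OF range_j_dense, where K = "norm (T t)"])
  show "norm (j (T t x)) \<le> norm (T t) * norm (j x)" for x
    by (simp add: norm_j R_T[OF assms] norm_cblinfun)
qed simp_all

context
  fixes \<mu> assumes \<mu>: "\<mu> \<in> resolvent_set A"
begin

abbreviation "R \<equiv> cblinfun_apply (resolvent A \<mu>)"
abbreviation "Rm \<equiv> cblinfun_apply (ext_resolvent N \<mu>)"

lemmas R = is_resolvent_resolvent[OF \<mu>]

lemma R_in_A: "(R v, \<mu> *\<^sub>C R v - v) \<in> A"
  using R by (simp add: is_resolvent_def)

lemma R_eq: "(x, y) \<in> A \<Longrightarrow> R (\<mu> *\<^sub>C x - y) = x"
  using R by (auto simp: is_resolvent_def)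

text \<open>The resolvent identity controls R x by R0 x, that is, by the norm of j x.\<close>

lemma ext_resolvent_apply: "Rm (j v) = R v"
  unfolding ext_resolvent_def
proof (rule extension_apply[OF range_j_dense, where K = "1 + cmod (\<beta>0 - \<mu>) * norm (resolvent A \<mu>)"])
  fix x
  have "R x = R0 x + (\<beta>0 - \<mu>) *\<^sub>C R (R0 x)"
    using resolvent_identity[OF R res0, of x] by (simp add: algebra_simps)
  also have "norm \<dots> \<le> norm (R0 x) + cmod (\<beta>0 - \<mu>) * norm (R (R0 x))"
    by (rule order_trans[OF norm_triangle_ineq]) (simp add: norm_scaleC)
  also have "\<dots> \<le> norm (R0 x) + cmod (\<beta>0 - \<mu>) * (norm (resolvent A \<mu>) * norm (R0 x))"
    by (intro add_mono mult_left_mono norm_cblinfun) auto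
  finally show "norm (R x) \<le> (1 + cmod (\<beta>0 - \<mu>) * norm (resolvent A \<mu>)) * norm (j x)"
    by (simp add: norm_j algebra_simps)
qed simp_all

lemma ext_gen_ext_resolvent: "Am (Rm w) = \<mu> *\<^sub>C j (Rm w) - w"
  by (rule continuous_eq_on_dense[OF _ _ range_j_dense])
     (auto simp: ext_resolvent_apply ext_gen_apply[OF R_in_A]
       intro!: cblinfun.continuous_on continuous_intros continuous_on_scaleC)

lemma ext_resolvent_ext_semigroup:
  assumes "0 \<le> t"
  shows "Rm (ext_semigroup N t w) = T t (Rm w)"
proof (rule continuous_eq_on_dense[OF _ _ range_j_dense])
  have "R (T t v) = T t (R v)" for v
    using R_eq[OF A_T[OF R_in_A assms, of v]] by simp
  then show "Rm (ext_semigroup N t x) = T t (Rm x)" if "x \<in> range j" for x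
    using that assms by (auto simp: ext_semigroup_apply ext_resolvent_apply)
qed (auto intro!: cblinfun.continuous_on continuous_intros)

text \<open>T_{-1}(t) = (\<mu> - A_{-1}) T(t) (\<mu> - A_{-1})^{-1}; the factor in front does not
  depend on t, so convolutions can be computed in X.\<close>

lemma ext_semigroup_eq:
  assumes "0 \<le> t"
  shows "ext_semigroup N t w = \<mu> *\<^sub>C j (T t (Rm w)) - Am (T t (Rm w))"
  using ext_gen_ext_resolvent[of "ext_semigroup N t w"]
  by (simp add: ext_resolvent_ext_semigroup[OF assms])

lemma R_prim: "R (\<mu> *\<^sub>C prim (orbit x) t - T t x + x) = prim (orbit x) t" if "0 \<le> t"
  using R_eq[OF prim_orbit_in_A[OF that, of x]] by (simp add: algebra_simps)

text \<open>The X_1-norm of R v is the norm of (\<beta>0 - A) R v = (\<beta>0 - \<mu>) R v + v, so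
  the resolvent is bounded into X_1.\<close>

lemma lift1_exists: "\<exists>Q :: 'x \<Rightarrow>\<^sub>C\<^sub>L 'x1. \<forall>v. i (Q v) = R v"
proof -
  have "\<exists>z. i z = R v" for v
  proof -
    have "R v \<in> Domain A" using R_in_A by blast
    then show ?thesis unfolding range_i[symmetric] by auto
  qed
  then obtain q where q: "\<And>v. i (q v) = R v" by metis
  obtain Q :: "'x \<Rightarrow>\<^sub>C\<^sub>L 'x1" where "\<And>v. cblinfun_apply Q v = q v"
  proof (rule cblinfun_exists_norm[of q "cmod (\<beta>0 - \<mu>) * norm (resolvent A \<mu>) + 1"])
    show "q (x + y) = q x + q y" "q (c *\<^sub>C x) = c *\<^sub>C q x" for x y c
      by (rule i_inj, simp add: q)+
    show "norm (q v) \<le> norm v * (cmod (\<beta>0 - \<mu>) * norm (resolvent A \<mu>) + 1)" for v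
    proof -
      have "(i (q v), \<mu> *\<^sub>C i (q v) - v) \<in> A" using R_in_A by (simp add: q)
      from norm_X1[OF this] have "norm (q v) = norm ((\<beta>0 - \<mu>) *\<^sub>C R v + v)"
        by (simp add: q bounded_bilinear.diff_left[OF bounded_bilinear_scaleC] algebra_simps)
      also have "\<dots> \<le> cmod (\<beta>0 - \<mu>) * norm (R v) + norm v"
        by (rule order_trans[OF norm_triangle_ineq]) (simp add: norm_scaleC)
      also have "\<dots> \<le> cmod (\<beta>0 - \<mu>) * (norm (resolvent A \<mu>) * norm v) + norm v"
        by (intro add_mono mult_left_mono norm_cblinfun) auto
      finally show ?thesis by (simp add: algebra_simps)
    qed
  qed (rule that)
  then show ?thesis using q by (intro exI[of _ Q]) simp
qed

end

end

text \<open>The resolvent with values in X_1, where C can be applied; injectivity of the embedding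
  makes the choice unique.\<close>

definition resolvent1 :: "('u::cbanach, 'x1::cbanach, 'x::cbanach, 'xm::cbanach, 'y::cbanach) node \<Rightarrow>
    complex \<Rightarrow> 'x \<Rightarrow>\<^sub>C\<^sub>L 'x1"
  where "resolvent1 N \<mu> = (SOME Q. \<forall>v. emb1 N (cblinfun_apply Q v) = resolvent (gen N) \<mu> v)"

text \<open>The twice integrated impulse response: \<open>output_kernel N \<beta> a t\<close> is $C\&D$ applied to the pair of
  $\int_0^t (t - s) \mathbb{T}_{-1}(s) B a\,ds$ and $t a$. Writing $Ba = (\beta - A) r$ with
  $r = (\beta - A)^{-1} B a$ gives integrals that converge in $X$; \<open>state_kernel\<close> is
  $\beta - A$ applied to the argument of $C$.\<close>

definition state_kernel :: "('u::cbanach, 'x1::cbanach, 'x::cbanach, 'xm::cbanach, 'y::cbanach) node \<Rightarrow>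
    complex \<Rightarrow> 'u \<Rightarrow> real \<Rightarrow> 'x"
  where "state_kernel N \<beta> a = (\<lambda>\<tau>.
    let r = ext_resolvent N \<beta> (inp N a); \<phi> = (\<lambda>t. semigroup_of (gen N) t r) in
    \<beta> *\<^sub>C (\<beta> *\<^sub>C prim (prim \<phi>) \<tau> - prim \<phi> \<tau> + \<tau> *\<^sub>R r) - (\<beta> *\<^sub>C prim \<phi> \<tau> - \<phi> \<tau> + r))"

definition output_kernel :: "('u::cbanach, 'x1::cbanach, 'x::cbanach, 'xm::cbanach, 'y::cbanach) node \<Rightarrow>
    complex \<Rightarrow> 'u \<Rightarrow> real \<Rightarrow> 'y"
  where "output_kernel N \<beta> a = (\<lambda>\<tau>. outp N (resolvent1 N \<beta> (state_kernel N \<beta> a \<tau>)) + transfer_fun N \<beta> (\<tau> *\<^sub>R a))"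

text \<open>The state for zero initial value.\<close>

definition forced_state :: "('u::cbanach, 'x1::cbanach, 'x::cbanach, 'xm::cbanach, 'y::cbanach) node \<Rightarrow>
    (real \<Rightarrow> 'u) \<Rightarrow> real \<Rightarrow> 'xm"
  where "forced_state N u t = integral {0..t} (\<lambda>s. ext_semigroup N (t - s) (inp N (u s)))"

section \<open>States and outputs as convolutions\<close>

locale system = node_data N \<beta>0 R0
  for N :: "('u::cbanach, 'x1::cbanach, 'x::cbanach, 'xm::cbanach, 'y::cbanach) node" and \<beta>0 R0 +
  assumes system: "system_node N"
begin

lemma transfer_identity:
  assumes "\<alpha> \<in> node_domain N" "\<beta> \<in> node_domain N"
  obtains z where "i z = ext_resolvent N \<alpha> (B u) - ext_resolvent N \<beta> (B u)"
    "transfer_fun N \<alpha> u - transfer_fun N \<beta> u = C z"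
  using assms system unfolding system_node_def by blast

context
  fixes \<beta> assumes \<beta>: "\<beta> \<in> node_domain N"
begin

lemmas \<beta>' = node_domain_resolvent_set[OF \<beta>]

abbreviation "Rb \<equiv> cblinfun_apply (resolvent A \<beta>)"
abbreviation "Rbm \<equiv> cblinfun_apply (ext_resolvent N \<beta>)"
abbreviation "Q \<equiv> cblinfun_apply (resolvent1 N \<beta>)"

lemma i_Q: "i (Q v) = Rb v"
  using someI_ex[OF lift1_exists[OF \<beta>']] unfolding resolvent1_def by blast

text \<open>The transfer identity compensates a change of \<beta> in the definition of C&D, so one
  fixed \<beta> describes the whole graph.\<close>

lemma CD_iff: "((x, u), h) \<in> CD N \<longleftrightarrow> (\<exists>\<zeta>. i \<zeta> = x - Rbm (B u) \<and> h = C \<zeta> + transfer_fun N \<beta> u)"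
proof
  assume "((x, u), h) \<in> CD N"
  then obtain \<zeta>1 \<beta>1 where \<beta>1: "\<beta>1 \<in> node_domain N" and \<zeta>1: "i \<zeta>1 = x - ext_resolvent N \<beta>1 (B u)"
    and h: "h = C \<zeta>1 + transfer_fun N \<beta>1 u"
    unfolding CD_def by auto
  obtain z where z: "i z = ext_resolvent N \<beta>1 (B u) - Rbm (B u)"
    "transfer_fun N \<beta>1 u - transfer_fun N \<beta> u = C z"
    using transfer_identity[OF \<beta>1 \<beta>] by blast
  show "\<exists>\<zeta>. i \<zeta> = x - Rbm (B u) \<and> h = C \<zeta> + transfer_fun N \<beta> u"
    by (rule exI[of _ "\<zeta>1 + z"]) (simp add: \<zeta>1 z(1) z(2)[symmetric] h)
next
  assume "\<exists>\<zeta>. i \<zeta> = x - Rbm (B u) \<and> h = C \<zeta> + transfer_fun N \<beta> u"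
  then obtain \<zeta> where \<zeta>: "i \<zeta> = x - Rbm (B u)" "h = C \<zeta> + transfer_fun N \<beta> u" by blast
  have "i \<zeta> \<in> Domain A" unfolding range_i[symmetric] by simp
  then obtain y where y: "(i \<zeta>, y) \<in> A" by blast
  have "x = i \<zeta> + Rbm (B u)" using \<zeta>(1) by simp
  \<comment> \<open>A_{-1} Rbm (B u) = \<beta> Rbm (B u) - B u cancels B u and leaves an element of
    X.\<close>
  then have "Am x + B u = j (y + \<beta> *\<^sub>C Rbm (B u))"
    by (simp add: ext_gen_apply[OF y] ext_gen_ext_resolvent[OF \<beta>'])
  then have "Am x + B u \<in> range j" by (rule range_eqI)
  with \<zeta> \<beta> show "((x, u), h) \<in> CD N" unfolding CD_def by blast
qed

lemma CD_unique: "((x, u), h) \<in> CD N \<Longrightarrow> ((x, u), h') \<in> CD N \<Longrightarrow> h = h'"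
  unfolding CD_iff using i_inj by metis

lemma CD_sum:
  assumes "finite K" "\<And>k. k \<in> K \<Longrightarrow> ((x k, u k), h k) \<in> CD N"
  shows "((\<Sum>k\<in>K. x k, \<Sum>k\<in>K. u k), \<Sum>k\<in>K. h k) \<in> CD N"
proof -
  have "\<forall>k\<in>K. \<exists>\<zeta>. i \<zeta> = x k - Rbm (B (u k)) \<and> h k = C \<zeta> + transfer_fun N \<beta> (u k)"
    using assms(2) by (simp add: CD_iff)
  then obtain \<zeta> where "\<And>k. k \<in> K \<Longrightarrow> i (\<zeta> k) = x k - Rbm (B (u k)) \<and> h k = C (\<zeta> k) + transfer_fun N \<beta> (u k)"
    by metis
  then show ?thesis
    unfolding CD_iff
    by (intro exI[of _ "\<Sum>k\<in>K. \<zeta> k"]) (simp add: cblinfun.sum_right sum.distrib sum_subtractf)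
qed

text \<open>This is \<beta> - A_{-1}, from X to X_{-1}; it undoes \<open>Rbm\<close> and, being
  bounded, passes through integrals.\<close>

definition E where "E x = \<beta> *\<^sub>C j x - Am x"

lemma bounded_linear_E: "bounded_linear E"
  unfolding E_def
  by (intro bounded_linear_sub cblinfun.bounded_linear_right
      bounded_linear_compose[OF bounded_linear_scaleC cblinfun.bounded_linear_right])

context
  fixes w :: "real \<Rightarrow> complex" and a :: 'u
  assumes w: "locally_integrable w"
begin

abbreviation "r \<equiv> Rbm (B a)"
abbreviation "\<phi> \<equiv> orbit r"

lemma input_integrand:
  assumes "0 \<le> s" "s \<le> t"
  shows "ext_semigroup N (t - s) (B (w s *\<^sub>C a)) = E (w s *\<^sub>C \<phi> (t - s))"
  using assms by (simp add: ext_semigroup_eq[OF \<beta>'] E_def scaleC_scaleC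
      complex_vector.scale_right_diff_distrib mult.commute)

lemma input_integrable: "(\<lambda>s. ext_semigroup N (t - s) (B (w s *\<^sub>C a))) integrable_on {0..t}"
proof (rule integrable_eq)
  show "(\<lambda>s. E (w s *\<^sub>C \<phi> (t - s))) integrable_on {0..t}"
    using integrable_linear[OF conv_integrable[OF w T_continuous] bounded_linear_E]
    by (simp add: o_def)
qed (simp add: input_integrand del: cblinfun_scaleC_right)

lemma forced_state_eq: "forced_state N (\<lambda>s. w s *\<^sub>C a) t = E (conv w \<phi> t)"
proof -
  have "forced_state N (\<lambda>s. w s *\<^sub>C a) t = integral {0..t} (\<lambda>s. E (w s *\<^sub>C \<phi> (t - s)))"
    unfolding forced_state_def by (rule integral_cong) (simp add: input_integrand del: cblinfun_scaleC_right)
  also have "\<dots> = E (conv w \<phi> t)"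
    unfolding conv_def using integral_linear[OF conv_integrable[OF w T_continuous] bounded_linear_E]
    by (simp add: o_def)
  finally show ?thesis .
qed

lemma continuous_on_forced_state: "continuous_on {0..} (forced_state N (\<lambda>s. w s *\<^sub>C a))"
  unfolding forced_state_eq[abs_def]
  by (intro bounded_linear.continuous_on[OF bounded_linear_E] continuous_on_conv w T_continuous)

text \<open>With q, q1, p the convolutions of w with \<phi> and its first two primitives, the state
  is E q and its second integral E p. As p lies in the domain of A, E p = j z with z in X; and z
  minus the input term u2 lies in that domain again, so C can be applied. All terms are convolutions
  with w, hence so is the result.\<close>

lemma forced_output:
  assumes t: "0 \<le> t"
  shows "\<exists>z. j z = integral {0..t} (\<lambda>s. (t - s) *\<^sub>R forced_state N (\<lambda>s. w s *\<^sub>C a) s) \<and>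
    ((z, integral {0..t} (\<lambda>s. (t - s) *\<^sub>R (w s *\<^sub>C a))), conv w (output_kernel N \<beta> a) t) \<in> CD N"
proof -
  note \<phi> = T_continuous[of r]
  note \<phi>1 = continuous_on_prim[OF \<phi>]
  note \<phi>2 = continuous_on_prim[OF \<phi>1]
  note cont = \<phi> \<phi>1 \<phi>2
  define q where "q = conv w \<phi> t"
  define q1 where "q1 = conv w (prim \<phi>) t"
  define p where "p = conv w (prim (prim \<phi>)) t"
  define u1 where "u1 = conv w (\<lambda>_. r) t"
  define u2 where "u2 = conv w (\<lambda>\<tau>. \<tau> *\<^sub>R r) t"
  note scale_cont = bounded_linear.continuous_on[OF bounded_linear_scaleC]
  note all_cont = continuous_on_add continuous_on_diff continuous_on_const scale_cont cont
    continuous_on_scaleR continuous_on_id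
  have R1: "Rb (\<beta> *\<^sub>C prim \<phi> \<tau> - \<phi> \<tau> + r) = prim \<phi> \<tau>" if "0 \<le> \<tau>" for \<tau>
    by (rule R_prim[OF \<beta>' that])
  \<comment> \<open>The relation R1, integrated over [0, \<tau>].\<close>
  have R2: "Rb (\<beta> *\<^sub>C prim (prim \<phi>) \<tau> - prim \<phi> \<tau> + \<tau> *\<^sub>R r) = prim (prim \<phi>) \<tau>" if "0 \<le> \<tau>" for \<tau>
  proof -
    have "prim (prim \<phi>) \<tau> = prim (\<lambda>s. Rb (\<beta> *\<^sub>C prim \<phi> s - \<phi> s + r)) \<tau>"
      unfolding prim_def[of _ \<tau>] by (rule integral_cong) (simp only: R1 atLeastAtMost_iff)
    also have "\<dots> = Rb (prim (\<lambda>s. \<beta> *\<^sub>C prim \<phi> s - \<phi> s + r) \<tau>)"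
      by (rule prim_linear[symmetric, OF _ cblinfun.bounded_linear_right]) (intro all_cont)
    also have "prim (\<lambda>s. \<beta> *\<^sub>C prim \<phi> s - \<phi> s + r) \<tau> = \<beta> *\<^sub>C prim (prim \<phi>) \<tau> - prim \<phi> \<tau> + \<tau> *\<^sub>R r"
    proof -
      have "prim (\<lambda>s. \<beta> *\<^sub>C prim \<phi> s - \<phi> s + r) \<tau> =
          prim (\<lambda>s. \<beta> *\<^sub>C prim \<phi> s) \<tau> - prim \<phi> \<tau> + integral {0..\<tau>} (\<lambda>_. r)"
        unfolding prim_def[of _ \<tau>]
        by (subst integral_add, (intro integrable_on_if_continuous_atLeast all_cont)+,
            subst integral_diff, (intro integrable_on_if_continuous_atLeast all_cont)+, rule refl)
      then show ?thesis
        using prim_linear[OF \<phi>1 bounded_linear_scaleC, of \<beta> \<tau>] that by simp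
    qed
    finally show ?thesis by (rule sym)
  qed
  have pos: "conv w f t = conv w g t" if "\<And>\<tau>. 0 \<le> \<tau> \<Longrightarrow> f \<tau> = g \<tau>" for f g :: "real \<Rightarrow> 'x"
    unfolding conv_def by (rule integral_cong) (simp add: that)
  have q1: "Rb (\<beta> *\<^sub>C q1 - q + u1) = q1"
  proof -
    have "Rb (\<beta> *\<^sub>C q1 - q + u1) = conv w (\<lambda>\<tau>. Rb (\<beta> *\<^sub>C prim \<phi> \<tau> - \<phi> \<tau> + r)) t"
      unfolding q1_def q_def u1_def
      by (subst conv_cblinfun[OF w, symmetric], intro all_cont,
          subst conv_add[OF w], (intro all_cont)+, subst conv_diff[OF w], (intro all_cont)+,
          subst conv_scaleC[OF w], (intro all_cont)+, rule refl)
    also have "\<dots> = q1" unfolding q1_def by (rule pos) (rule R1)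
    finally show ?thesis .
  qed
  have p: "Rb (\<beta> *\<^sub>C p - q1 + u2) = p"
  proof -
    have "Rb (\<beta> *\<^sub>C p - q1 + u2) = conv w (\<lambda>\<tau>. Rb (\<beta> *\<^sub>C prim (prim \<phi>) \<tau> - prim \<phi> \<tau> + \<tau> *\<^sub>R r)) t"
      unfolding q1_def p_def u2_def
      by (subst conv_cblinfun[OF w, symmetric], intro all_cont,
          subst conv_add[OF w], (intro all_cont)+, subst conv_diff[OF w], (intro all_cont)+,
          subst conv_scaleC[OF w], (intro all_cont)+, rule refl)
    also have "\<dots> = p" unfolding p_def by (rule pos) (rule R2)
    finally show ?thesis .
  qed
  \<comment> \<open>z is (\<beta> - A) p, read off from p = Rb z.\<close>
  define z where "z = \<beta> *\<^sub>C p - q1 + u2"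
  have "(p, \<beta> *\<^sub>C p - z) \<in> A" using R_in_A[OF \<beta>', of z] p by (simp add: z_def del: cblinfun.add_right cblinfun.diff_right)
  then have Ep: "E p = j z" by (simp add: E_def ext_gen_apply)
  have jz: "j z = integral {0..t} (\<lambda>s. (t - s) *\<^sub>R forced_state N (\<lambda>s. w s *\<^sub>C a) s)"
  proof -
    have qc: "continuous_on {0..} (conv w \<phi>)" by (intro continuous_on_conv w \<phi>)
    have "integral {0..t} (\<lambda>s. (t - s) *\<^sub>R forced_state N (\<lambda>s. w s *\<^sub>C a) s) =
        integral {0..t} (E \<circ> (\<lambda>s. (t - s) *\<^sub>R conv w \<phi> s))"
      by (simp add: forced_state_eq o_def linear_cmul[OF bounded_linear.linear[OF bounded_linear_E]])
    also have "\<dots> = E (integral {0..t} (\<lambda>s. (t - s) *\<^sub>R conv w \<phi> s))"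
      by (intro integral_linear bounded_linear_E integrable_on_if_continuous_atLeast
          continuous_intros qc)
    also have "integral {0..t} (\<lambda>s. (t - s) *\<^sub>R conv w \<phi> s) = prim (prim (conv w \<phi>)) t"
      by (rule integral_prim[OF qc t])
    also have "\<dots> = prim (conv w (prim \<phi>)) t"
      unfolding prim_def[of _ t] by (rule integral_cong) (simp add: prim_conv[OF w \<phi>])
    also have "\<dots> = p" unfolding p_def by (rule prim_conv[OF w \<phi>1 t])
    finally show ?thesis by (simp add: Ep)
  qed
  have input2: "integral {0..t} (\<lambda>s. (t - s) *\<^sub>R (w s *\<^sub>C a)) = conv w (\<lambda>\<tau>. \<tau> *\<^sub>R a) t"
    by (simp add: conv_def scaleC_scaleR_commute)
  have u2: "Rbm (B (conv w (\<lambda>\<tau>. \<tau> *\<^sub>R a) t)) = u2"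
    unfolding u2_def by (simp add: conv_cblinfun[OF w] continuous_intros)
  \<comment> \<open>s is (\<beta> - A) applied to z - u2 = \<beta> p - q1, where (\<beta> - A) p = z
    and (\<beta> - A) q1 = \<beta> q1 - q + u1.\<close>
  define s where "s = \<beta> *\<^sub>C (\<beta> *\<^sub>C p - q1 + u2) - (\<beta> *\<^sub>C q1 - q + u1)"
  have s: "s = conv w (state_kernel N \<beta> a) t"
    unfolding s_def state_kernel_def Let_def q1_def q_def p_def u1_def u2_def
    by (subst conv_diff[OF w], (intro all_cont)+,
        subst conv_scaleC[OF w], (intro all_cont)+,
        subst conv_add[OF w], (intro all_cont)+, subst conv_diff[OF w], (intro all_cont)+,
        subst conv_scaleC[OF w], (intro all_cont)+,
        subst conv_add[OF w], (intro all_cont)+, subst conv_diff[OF w], (intro all_cont)+,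
        subst conv_scaleC[OF w], (intro all_cont)+, rule refl)
  have sk_cont: "continuous_on {0..} (state_kernel N \<beta> a)"
    unfolding state_kernel_def Let_def by (intro all_cont)
  have "Rb s = \<beta> *\<^sub>C Rb (\<beta> *\<^sub>C p - q1 + u2) - Rb (\<beta> *\<^sub>C q1 - q + u1)"
    by (simp only: s_def cblinfun.diff_right cblinfun_scaleC_right)
  then have Rs: "Rb s = \<beta> *\<^sub>C p - q1" by (simp only: p q1)
  have "((z, conv w (\<lambda>\<tau>. \<tau> *\<^sub>R a) t), conv w (output_kernel N \<beta> a) t) \<in> CD N"
    unfolding CD_iff
  proof (intro exI[of _ "Q s"] conjI)
    show "i (Q s) = z - Rbm (B (conv w (\<lambda>\<tau>. \<tau> *\<^sub>R a) t))"
      by (simp only: i_Q Rs u2) (simp add: z_def)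
    show "conv w (output_kernel N \<beta> a) t = C (Q s) + transfer_fun N \<beta> (conv w (\<lambda>\<tau>. \<tau> *\<^sub>R a) t)"
    proof -
      have Qs_cont: "continuous_on {0..} (\<lambda>\<tau>. Q (state_kernel N \<beta> a \<tau>))"
        by (intro cblinfun.continuous_on continuous_on_const sk_cont)
      have a_cont: "continuous_on {0..} (\<lambda>\<tau>. \<tau> *\<^sub>R a)" by (intro all_cont)
      have "conv w (output_kernel N \<beta> a) t = conv w (\<lambda>\<tau>. C (Q (state_kernel N \<beta> a \<tau>))) t +
          conv w (\<lambda>\<tau>. transfer_fun N \<beta> (\<tau> *\<^sub>R a)) t"
        unfolding output_kernel_def
        by (intro conv_add w cblinfun.continuous_on continuous_on_const sk_cont a_cont)
      also have "\<dots> = C (Q s) + transfer_fun N \<beta> (conv w (\<lambda>\<tau>. \<tau> *\<^sub>R a) t)"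
        unfolding s conv_cblinfun[OF w sk_cont] conv_cblinfun[OF w Qs_cont] conv_cblinfun[OF w a_cont] ..
      finally show ?thesis .
    qed
  qed
  then show ?thesis unfolding input2 jz[symmetric] by blast
qed

end

lemma continuous_on_kernel: "continuous_on {0..} (output_kernel N \<beta> a)"
  unfolding output_kernel_def state_kernel_def Let_def
  by (intro continuous_intros cblinfun.continuous_on bounded_linear.continuous_on[OF bounded_linear_scaleC]
      T_continuous continuous_on_prim)

text \<open>Inputs with values in a finite-dimensional space are such finite sums; since the graph
  of C&D is linear, states and outputs add up.\<close>

lemma superposition:
  assumes K: "finite K" and w: "\<And>k. k \<in> K \<Longrightarrow> locally_integrable (w k)"
    and u: "\<And>s. u s = (\<Sum>k\<in>K. w k s *\<^sub>C a k)"
  shows "continuous_on {0..} (forced_state N u)"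
    and "0 \<le> t \<Longrightarrow> \<exists>z. j z = integral {0..t} (\<lambda>s. (t - s) *\<^sub>R forced_state N u s) \<and>
      ((z, integral {0..t} (\<lambda>s. (t - s) *\<^sub>R u s)), \<Sum>k\<in>K. conv (w k) (output_kernel N \<beta> (a k)) t) \<in> CD N"
proof -
  define x where "x k = forced_state N (\<lambda>s. w k s *\<^sub>C a k)" for k
  have fs: "forced_state N u t = (\<Sum>k\<in>K. x k t)" for t
  proof -
    have "forced_state N u t =
        integral {0..t} (\<lambda>s. \<Sum>k\<in>K. ext_semigroup N (t - s) (B (w k s *\<^sub>C a k)))"
      unfolding forced_state_def u cblinfun.sum_right ..
    also have "\<dots> = (\<Sum>k\<in>K. x k t)"
      unfolding x_def forced_state_def by (rule integral_sum[OF K]) (rule input_integrable[OF w])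
    finally show ?thesis .
  qed
  have x_cont: "continuous_on {0..} (x k)" if "k \<in> K" for k
    unfolding x_def by (intro continuous_on_forced_state w that)
  then show "continuous_on {0..} (forced_state N u)"
    unfolding fs[abs_def] by (rule continuous_on_sum)
  assume t: "0 \<le> t"
  have "\<forall>k\<in>K. \<exists>z. j z = integral {0..t} (\<lambda>s. (t - s) *\<^sub>R x k s) \<and>
    ((z, integral {0..t} (\<lambda>s. (t - s) *\<^sub>R (w k s *\<^sub>C a k))), conv (w k) (output_kernel N \<beta> (a k)) t) \<in> CD N"
    unfolding x_def by (intro ballI forced_output[OF w t])
  from bchoice[OF this] obtain z
    where "\<forall>k\<in>K. j (z k) = integral {0..t} (\<lambda>s. (t - s) *\<^sub>R x k s) \<and>
      ((z k, integral {0..t} (\<lambda>s. (t - s) *\<^sub>R (w k s *\<^sub>C a k))), conv (w k) (output_kernel N \<beta> (a k)) t) \<in> CD N" ..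
  then have z: "\<And>k. k \<in> K \<Longrightarrow> j (z k) = integral {0..t} (\<lambda>s. (t - s) *\<^sub>R x k s)"
    and CD: "\<And>k. k \<in> K \<Longrightarrow> ((z k, integral {0..t} (\<lambda>s. (t - s) *\<^sub>R (w k s *\<^sub>C a k))),
      conv (w k) (output_kernel N \<beta> (a k)) t) \<in> CD N"
    by blast+
  have "j (\<Sum>k\<in>K. z k) = integral {0..t} (\<lambda>s. (t - s) *\<^sub>R forced_state N u s)"
  proof -
    have "j (\<Sum>k\<in>K. z k) = (\<Sum>k\<in>K. integral {0..t} (\<lambda>s. (t - s) *\<^sub>R x k s))"
      unfolding cblinfun.sum_right by (rule sum.cong[OF refl z])
    also have "\<dots> = integral {0..t} (\<lambda>s. \<Sum>k\<in>K. (t - s) *\<^sub>R x k s)"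
      by (rule integral_sum[symmetric, OF K])
         (intro integrable_on_if_continuous_atLeast continuous_on_scaleR continuous_on_diff
           continuous_on_const continuous_on_id x_cont)
    finally show ?thesis unfolding fs scaleR_sum_right .
  qed
  moreover have "integral {0..t} (\<lambda>s. (t - s) *\<^sub>R u s) = (\<Sum>k\<in>K. integral {0..t} (\<lambda>s. (t - s) *\<^sub>R (w k s *\<^sub>C a k)))"
    unfolding u scaleR_sum_right
  proof (rule integral_sum[OF K])
    fix k assume "k \<in> K"
    from conv_integrable[OF w[OF this], of "\<lambda>\<tau>. \<tau> *\<^sub>R a k" t]
    show "(\<lambda>s. (t - s) *\<^sub>R (w k s *\<^sub>C a k)) integrable_on {0..t}"
      by (simp add: scaleC_scaleR_commute continuous_intros)
  qed
  moreover have "((\<Sum>k\<in>K. z k, \<Sum>k\<in>K. integral {0..t} (\<lambda>s. (t - s) *\<^sub>R (w k s *\<^sub>C a k))),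
      \<Sum>k\<in>K. conv (w k) (output_kernel N \<beta> (a k)) t) \<in> CD N"
    by (rule CD_sum[where x = z and u = "\<lambda>k. integral {0..t} (\<lambda>s. (t - s) *\<^sub>R (w k s *\<^sub>C a k))", OF K CD])
  ultimately show "\<exists>z. j z = integral {0..t} (\<lambda>s. (t - s) *\<^sub>R forced_state N u s) \<and>
      ((z, integral {0..t} (\<lambda>s. (t - s) *\<^sub>R u s)), \<Sum>k\<in>K. conv (w k) (output_kernel N \<beta> (a k)) t) \<in> CD N"
    by (intro exI[of _ "\<Sum>k\<in>K. z k"]) simp
qed

end

end

section \<open>The dual system node\<close>

lemma continuous_le_on_dense:
  fixes f g :: "'a::topological_space \<Rightarrow> real"
  assumes "continuous_on UNIV f" "continuous_on UNIV g"
    and "closure S = UNIV" and "\<And>x. x \<in> S \<Longrightarrow> f x \<le> g x"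
  shows "f x \<le> g x"
proof -
  have "closed {x. f x \<le> g x}"
    using assms by (intro closed_Collect_le)
  then have "closure S \<subseteq> {x. f x \<le> g x}"
    using assms(4) by (intro closure_minimal) auto
  then show ?thesis using assms(3) by auto
qed

lemma dual_node_sel [simp]:
  "gen (dual_node N) = operator_adjoint (gen N)"
  "emb1 (dual_node N) = cadjoint (embm1 N)"
  "embm1 (dual_node N) = cadjoint (emb1 N)"
  "inp (dual_node N) = cadjoint (outp N)"
  "outp (dual_node N) = cadjoint (inp N)"
  "transfer_fun (dual_node N) s = cadjoint (transfer_fun N (cnj s))"
  by (simp_all add: dual_node_def)

locale dual_system = system N \<beta>0 R0
  for N :: "('u::cbanach, 'x1::cbanach, 'x::cbanach, 'xm::cbanach, 'y::cbanach) node" and \<beta>0 R0 +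
  assumes dual_gen: "generates_C0_semigroup (operator_adjoint (gen N))"
begin

abbreviation "M \<equiv> dual_node N"
abbreviation "A' \<equiv> operator_adjoint A"
abbreviation "T' \<equiv> semigroup_of A'"

lemma res0_set: "\<beta>0 \<in> resolvent_set A"
  using res0 by (auto simp: resolvent_set_def)

lemma Rm0: "ext_resolvent N \<beta>0 (j x) = R0 x"
  using ext_resolvent_apply[OF res0_set, of x] by (simp add: resolvent_eq[OF res0])

lemma dual_generator: "C0_generator T' A' (cnj \<beta>0) (cadjoint R0)"
proof -
  have "C0_semigroup T' \<and> generator T' = A'"
    unfolding semigroup_of_def
    using someI_ex[of "\<lambda>T. C0_semigroup T \<and> generator T = A'"] dual_gen
    unfolding generates_C0_semigroup_def by blast
  then show ?thesis by unfold_locales (use is_resolvent_adjoint[OF res0] in auto)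
qed

lemma dual_semigroup: "0 \<le> t \<Longrightarrow> T' t = cadjoint (T t)"
  using C0_generator_axioms dual_generator by (rule adjoint_semigroup)

lemma dual_node_domain: "node_domain M = node_domain N"
  using growth_bound_adjoint[OF C0_generator_axioms dual_generator]
  by (simp add: node_domain_def)

lemma cnj_node_domain: "cnj \<alpha> \<in> node_domain N \<longleftrightarrow> \<alpha> \<in> node_domain N"
  by (simp add: node_domain_def half_plane_def)

section \<open>The spaces X*_1 and X*_{-1} as duals of X_{-1} and X_1\<close>

lemma norm_Rm0: "norm (ext_resolvent N \<beta>0 w) = norm w"
  by (rule continuous_eq_on_dense[OF _ _ range_j_dense])
     (auto simp: Rm0 norm_j intro!: continuous_on_norm cblinfun.continuous_on continuous_intros)

lemma adjoint_iff: "(f, g) \<in> A' \<longleftrightarrow> f = cadjoint R0 (cnj \<beta>0 *\<^sub>C f - g)"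
  using C0_generator.A_iff[OF dual_generator] .

text \<open>The domain of A* is the range of the adjoint of R0, and R0 is
  \<open>ext_resolvent N \<beta>0\<close> after j; hence its elements are the functionals that
  factor through j. The norms agree because \<open>ext_resolvent N \<beta>0\<close> is isometric
  from X_{-1} into X with dense range.\<close>

lemma dual_X1: "is_X1 A' (cnj \<beta>0) (cadjoint (embm1 N))"
  unfolding is_X1_def
proof (intro conjI allI impI)
  have eqI: "f = g" if "\<And>x. f (j x) = g (j x)" for f g :: "'xm cdual"
  proof (rule cdual_eqI)
    show "f w = g w" for w
      by (rule continuous_eq_on_dense[OF _ _ range_j_dense, of "cdual_apply f" "cdual_apply g"])
         (use that in \<open>auto intro!: cdual.continuous_on continuous_intros\<close>)
  qed
  show "inj (cblinfun_apply (cadjoint (embm1 N)))"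
  proof (rule injI, rule eqI)
    fix f g x assume "cadjoint (embm1 N) f = cadjoint (embm1 N) g"
    then have "cadjoint (embm1 N) f x = cadjoint (embm1 N) g x" by simp
    then show "f (j x) = g (j x)" by simp
  qed
  show "range (cblinfun_apply (cadjoint (embm1 N))) = Domain A'"
  proof (intro equalityI subsetI)
    fix F assume "F \<in> range (cblinfun_apply (cadjoint (embm1 N)))"
    then obtain f where F: "F = cadjoint (embm1 N) f" by blast
    \<comment> \<open>A* F is the adjoint of A_{-1}, as an operator from X to X_{-1}, applied to
      f.\<close>
    have "(F, cadjoint (ext_gen N) f) \<in> A'"
      by (auto simp: operator_adjoint_def F ext_gen_apply)
    then show "F \<in> Domain A'" by blast
  next
    fix F assume "F \<in> Domain A'"
    then obtain g where "(F, g) \<in> A'" by blast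
    then obtain G where F: "F = cadjoint R0 G" using adjoint_iff by blast
    have "cadjoint R0 G = cadjoint (embm1 N) (cadjoint (ext_resolvent N \<beta>0) G)"
      by (intro cdual_eqI) (simp add: Rm0)
    then show "F \<in> range (cblinfun_apply (cadjoint (embm1 N)))" unfolding F by (rule range_eqI)
  qed
  fix f y assume "(cadjoint (embm1 N) f, y) \<in> A'"
  define G where "G = cnj \<beta>0 *\<^sub>C cadjoint (embm1 N) f - y"
  have "cadjoint (embm1 N) f = cadjoint R0 G"
    using \<open>(cadjoint (embm1 N) f, y) \<in> A'\<close> unfolding adjoint_iff G_def .
  from arg_cong[OF this, of "\<lambda>F. cdual_apply F _"] have fG: "f (j x) = G (R0 x)" for x by simp
  then have f: "f = cadjoint (ext_resolvent N \<beta>0) G" by (intro eqI) (simp add: Rm0)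
  show "norm f = norm (cnj \<beta>0 *\<^sub>C cadjoint (embm1 N) f - y)"
    unfolding G_def[symmetric]
  proof (rule antisym)
    show "norm f \<le> norm G"
    proof (rule norm_cdual_bound)
      show "cmod (f w) \<le> norm G * norm w" for w
        using norm_cdual[of G "ext_resolvent N \<beta>0 w"] by (simp add: f norm_Rm0)
    qed simp
    \<comment> \<open>G is tested on the dense range of R0, where G (R0 x) = f (j x) and norm (j x)
      = norm (R0 x).\<close>
    show "norm G \<le> norm f"
    proof (rule norm_cdual_bound)
      show "cmod (G v) \<le> norm f * norm v" for v
      proof (rule continuous_le_on_dense[OF _ _ range_R0_dense])
        fix v assume "v \<in> range (cblinfun_apply R0)"
        then obtain x where "v = R0 x" by blast
        then show "cmod (G v) \<le> norm f * norm v"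
          using norm_cdual[of f "j x"] by (simp add: fG norm_j)
      qed (intro continuous_intros continuous_on_norm cdual.continuous_on)+
    qed simp
  qed
qed

text \<open>P is \<beta>0 - A as an isometry of X_1 onto X, Q0 its inverse, and R0 P = i. Hence i* f
  and R0* f have equal norms, and P* maps the domain of A* into the range of i*. That domain is
  dense and P* is onto, so the range of i* is dense.\<close>

lemma dual_Xm1: "is_Xm1 A' (cnj \<beta>0) (cadjoint (emb1 N))"
  unfolding is_Xm1_def
proof (intro conjI allI)
  have "\<exists>w. i z = R0 w \<and> norm w = norm z" for z
  proof -
    have "i z \<in> Domain A" unfolding range_i[symmetric] by simp
    then obtain y where y: "(i z, y) \<in> A" by blast
    then show ?thesis
      using norm_X1[OF y] unfolding A_iff by (intro exI[of _ "\<beta>0 *\<^sub>C i z - y"]) simp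
  qed
  then obtain p where p: "\<And>z. R0 (p z) = i z" "\<And>z. norm (p z) = norm z" by metis
  have R0_inj: "R0 v = R0 w \<Longrightarrow> v = w" for v w
    using is_resolvent_inj[OF res0 single_valued_A] .
  have p_surj: "\<exists>z. p z = v" for v
  proof -
    have "R0 v \<in> range i" unfolding range_i using resolvent_in_A by blast
    then obtain z where "R0 v = i z" by blast
    then have "R0 (p z) = R0 v" by (simp add: p)
    then show ?thesis using R0_inj by blast
  qed
  obtain P :: "'x1 \<Rightarrow>\<^sub>C\<^sub>L 'x" where P: "\<And>z. P z = p z"
  proof (rule cblinfun_exists_norm[of p 1])
    show "p (x + y) = p x + p y" "p (c *\<^sub>C x) = c *\<^sub>C p x" for x y c
      by (rule R0_inj, simp add: p)+
  qed (simp add: p, rule that)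
  obtain q where q: "\<And>v. p (q v) = v" using p_surj by metis
  have iq: "i (q v) = R0 v" for v by (metis p(1) q)
  have nq: "norm (q v) = norm v" for v by (metis p(2) q)
  obtain Q0 :: "'x \<Rightarrow>\<^sub>C\<^sub>L 'x1" where Q0: "\<And>v. Q0 v = q v"
  proof (rule cblinfun_exists_norm[of q 1])
    show "q (x + y) = q x + q y" "q (c *\<^sub>C x) = c *\<^sub>C q x" for x y c
      by (rule i_inj, simp add: iq)+
  qed (simp add: nq, rule that)
  have qp: "q (p z) = z" for z by (rule i_inj) (simp add: iq p)
  fix f
  have "norm (cadjoint (emb1 N) f) = norm (cadjoint R0 f)"
  proof (rule antisym)
    show "norm (cadjoint (emb1 N) f) \<le> norm (cadjoint R0 f)"
    proof (rule norm_cdual_bound)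
      show "cmod (cadjoint (emb1 N) f z) \<le> norm (cadjoint R0 f) * norm z" for z
        using norm_cdual[of "cadjoint R0 f" "p z"] by (simp add: p)
    qed simp
    show "norm (cadjoint R0 f) \<le> norm (cadjoint (emb1 N) f)"
    proof (rule norm_cdual_bound)
      show "cmod (cadjoint R0 f v) \<le> norm (cadjoint (emb1 N) f) * norm v" for v
        using norm_cdual[of "cadjoint (emb1 N) f" "q v"] by (simp add: iq nq)
    qed simp
  qed
  then show "norm (cadjoint (emb1 N) f) = norm (resolvent A' (cnj \<beta>0) f)"
    by (simp add: resolvent_eq[OF is_resolvent_adjoint[OF res0]])
  show "closure (range (cblinfun_apply (cadjoint (emb1 N)))) = UNIV"
  proof -
    let ?T = "closure (range (cblinfun_apply (cadjoint (emb1 N))))"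
    have "cblinfun_apply (cadjoint P) ` closure (Domain A') \<subseteq> ?T"
    proof (rule image_closure_subset)
      show "cblinfun_apply (cadjoint P) ` Domain A' \<subseteq> ?T"
      proof clarify
        fix F g assume "(F, g) \<in> A'"
        then obtain G where F: "F = cadjoint R0 G" using adjoint_iff by blast
        have "cadjoint P F = cadjoint (emb1 N) G"
          by (intro cdual_eqI) (simp add: F P p)
        then have "cadjoint P F \<in> range (cblinfun_apply (cadjoint (emb1 N)))" by (rule range_eqI)
        then show "cadjoint P F \<in> ?T" by (rule subsetD[OF closure_subset])
      qed
    qed (auto intro!: cblinfun.continuous_on continuous_intros)
    moreover have "F \<in> cblinfun_apply (cadjoint P) ` closure (Domain A')" for F
    proof
      show "F = cadjoint P (cadjoint Q0 F)" by (intro cdual_eqI) (simp add: P Q0 qp)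
      show "cadjoint Q0 F \<in> closure (Domain A')" by (simp add: C0_generator.Domain_dense[OF dual_generator])
    qed
    ultimately show ?thesis by blast
  qed
qed

lemma dual_node_data: "node_data M (cnj \<beta>0) (cadjoint R0)"
  by unfold_locales (simp_all add: dual_gen is_resolvent_adjoint[OF res0] dual_X1 dual_Xm1)

lemma dual_range_j_dense: "closure (range (cblinfun_apply (cadjoint (emb1 N)))) = UNIV"
  using node_data.range_j_dense[OF dual_node_data] by simp

section \<open>Resolvents, transfer function and kernel of the dual node\<close>

lemma dual_resolvent: "\<alpha> \<in> resolvent_set A \<Longrightarrow> resolvent A' (cnj \<alpha>) = cadjoint (resolvent A \<alpha>)"
  by (intro resolvent_eq is_resolvent_adjoint is_resolvent_resolvent)

text \<open>Duality exchanges the two resolvents: the extension to X*_{-1}, the dual of X_1, is the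
  adjoint of the resolvent into X_1. The next lemma is the reverse exchange.\<close>

lemma dual_ext_resolvent:
  assumes "\<alpha> \<in> node_domain N"
  shows "ext_resolvent M (cnj \<alpha>) = cadjoint (resolvent1 N \<alpha>)"
  unfolding ext_resolvent_def dual_node_sel dual_resolvent[OF node_domain_resolvent_set[OF assms]]
  by (intro extension_eq dual_range_j_dense cdual_eqI) (simp add: i_Q[OF assms])

lemma dual_resolvent1:
  assumes "\<alpha> \<in> node_domain N"
  shows "resolvent1 M (cnj \<alpha>) = cadjoint (ext_resolvent N \<alpha>)"
proof -
  note \<alpha> = node_domain_resolvent_set[OF assms]
  have "cnj \<alpha> \<in> resolvent_set A'"
    unfolding resolvent_set_def using is_resolvent_adjoint[OF is_resolvent_resolvent[OF \<alpha>]] by blast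
  then have *: "cadjoint (embm1 N) (resolvent1 M (cnj \<alpha>) F) = cadjoint (resolvent A \<alpha>) F" for F
    using someI_ex[OF node_data.lift1_exists[OF dual_node_data, of "cnj \<alpha>"]]
    unfolding resolvent1_def by (simp add: dual_resolvent[OF \<alpha>])
  show ?thesis
  proof (intro cblinfun_eqI)
    fix F
    have "cadjoint (embm1 N) (resolvent1 M (cnj \<alpha>) F) = cadjoint (embm1 N) (cadjoint (ext_resolvent N \<alpha>) F)"
      unfolding * by (intro cdual_eqI) (simp add: ext_resolvent_apply[OF \<alpha>])
    then show "resolvent1 M (cnj \<alpha>) F = cadjoint (ext_resolvent N \<alpha>) F"
      using node_data.i_inj[OF dual_node_data] by simp
  qed
qed

text \<open>Two conjugations cancel: the difference quotient of the dual transfer function at z is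
  the adjoint of the original one at cnj z, and taking adjoints is continuous.\<close>

lemma dual_analytic: "analytic_map (transfer_fun M) (node_domain M)"
  unfolding analytic_map_def dual_node_domain
proof
  fix z assume "z \<in> node_domain N"
  then have "cnj z \<in> node_domain N" by (simp add: cnj_node_domain)
  then obtain D where D: "((\<lambda>w. inverse (w - cnj z) *\<^sub>C (transfer_fun N w - transfer_fun N (cnj z))) \<longlongrightarrow> D) (at (cnj z))"
    using system unfolding system_node_def analytic_map_def by blast
  have cnj_lim: "filterlim cnj (at (cnj z)) (at z)"
    unfolding filterlim_at by (auto intro!: tendsto_intros simp: eventually_at_filter)
  have "((\<lambda>w. cadjoint (inverse (cnj w - cnj z) *\<^sub>C (transfer_fun N (cnj w) - transfer_fun N (cnj z)))) \<longlongrightarrow> cadjoint D) (at z)"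
    by (rule bounded_linear.tendsto[OF bounded_linear_cadjoint filterlim_compose[OF D cnj_lim]])
  then show "\<exists>D. ((\<lambda>w. inverse (w - z) *\<^sub>C (transfer_fun M w - transfer_fun M z)) \<longlongrightarrow> D) (at z)"
    by (intro exI) (simp add: cadjoint_scaleC cadjoint_diff)
qed

text \<open>The difference of the extended resolvents maps X_{-1} into X_1; with S this operator,
  the difference of the transfer functions is C S B. Its adjoint is B* S* C*, and S* is the
  corresponding difference for the dual node.\<close>

lemma dual_transfer_identity:
  assumes "\<alpha> \<in> node_domain N" "\<beta> \<in> node_domain N"
  shows "\<exists>z. cadjoint (embm1 N) z = ext_resolvent M (cnj \<alpha>) (cadjoint (outp N) v) - ext_resolvent M (cnj \<beta>) (cadjoint (outp N) v) \<and>
    cadjoint (transfer_fun N \<alpha>) v - cadjoint (transfer_fun N \<beta>) v = cadjoint (inp N) z"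
proof -
  note \<alpha> = node_domain_resolvent_set[OF assms(1)] and \<beta> = node_domain_resolvent_set[OF assms(2)]
  \<comment> \<open>The product from the resolvent identity: the inner factor maps X_{-1} to X, the
    outer one X to X_1.\<close>
  define S where "S = (\<beta> - \<alpha>) *\<^sub>C ccompose (resolvent1 N \<alpha>) (ext_resolvent N \<beta>)"
  have iS: "i (S w) = ext_resolvent N \<alpha> w - ext_resolvent N \<beta> w" for w
  proof (rule continuous_eq_on_dense[OF _ _ range_j_dense])
    fix w assume "w \<in> range j"
    then obtain x where w: "w = j x" by blast
    show "i (S w) = ext_resolvent N \<alpha> w - ext_resolvent N \<beta> w"
      using resolvent_identity[OF is_resolvent_resolvent[OF \<alpha>] is_resolvent_resolvent[OF \<beta>], of x]
      by (simp add: S_def w i_Q[OF assms(1)] ext_resolvent_apply[OF \<alpha>] ext_resolvent_apply[OF \<beta>])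
  qed (intro continuous_intros cblinfun.continuous_on)+
  have Sj: "S (j x) = resolvent1 N \<alpha> x - resolvent1 N \<beta> x" for x
    by (rule i_inj)
       (simp add: iS i_Q[OF assms(1)] i_Q[OF assms(2)] ext_resolvent_apply[OF \<alpha>] ext_resolvent_apply[OF \<beta>])
  show ?thesis
  proof (intro exI[of _ "cadjoint S (cadjoint (outp N) v)"] conjI cdual_eqI)
    fix x
    show "cadjoint (embm1 N) (cadjoint S (cadjoint (outp N) v)) x =
        (ext_resolvent M (cnj \<alpha>) (cadjoint (outp N) v) - ext_resolvent M (cnj \<beta>) (cadjoint (outp N) v)) x"
      by (simp add: dual_ext_resolvent assms Sj)
  next
    fix u
    obtain z where z: "i z = ext_resolvent N \<alpha> (B u) - ext_resolvent N \<beta> (B u)"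
      "transfer_fun N \<alpha> u - transfer_fun N \<beta> u = C z"
      using transfer_identity[OF assms] by blast
    have "S (B u) = z" by (rule i_inj) (simp add: iS z)
    then show "(cadjoint (transfer_fun N \<alpha>) v - cadjoint (transfer_fun N \<beta>) v) u =
        cadjoint (inp N) (cadjoint S (cadjoint (outp N) v)) u"
      using z(2)[symmetric] by simp
  qed
qed

lemma dual_system_node: "system_node M"
  unfolding system_node_def
proof (intro conjI ballI allI)
  show "\<exists>\<beta>\<in>resolvent_set (gen M). is_X1 (gen M) \<beta> (emb1 M) \<and> is_Xm1 (gen M) \<beta> (embm1 M)"
    using dual_X1 dual_Xm1 is_resolvent_adjoint[OF res0] unfolding resolvent_set_def by auto
  fix \<alpha> \<beta> v assume "\<alpha> \<in> node_domain M" "\<beta> \<in> node_domain M"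
  then show "\<exists>z. emb1 M z = ext_resolvent M \<alpha> (inp M v) - ext_resolvent M \<beta> (inp M v) \<and>
      transfer_fun M \<alpha> v - transfer_fun M \<beta> v = outp M z"
    using dual_transfer_identity[of "cnj \<alpha>" "cnj \<beta>" v] by (simp add: dual_node_domain cnj_node_domain)
qed (simp_all add: dual_gen dual_analytic)

lemma dual: "system M (cnj \<beta>0) (cadjoint R0)"
  using dual_node_data dual_system_node by (simp add: system_def system_axioms_def)

text \<open>The state kernel is a linear expression in the orbit of r, the dual one the same
  expression in the orbit of r' with conjugated coefficients. As r' is l C (\<beta> - A)^{-1} and
  T'(t) is the adjoint of T(t), pairing the dual one with r equals pairing r' with the original. The
  pairing with r is what B* and the dual resolvent into X*_1 amount to at a.\<close>

lemma dual_kernel: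
  assumes \<beta>: "\<beta> \<in> node_domain N" and \<tau>: "0 \<le> \<tau>"
  shows "cdual_apply (output_kernel M (cnj \<beta>) l \<tau>) a = cdual_apply l (output_kernel N \<beta> a \<tau>)"
proof -
  define r where "r = ext_resolvent N \<beta> (B a)"
  define r' where "r' = ext_resolvent M (cnj \<beta>) (cadjoint (outp N) l)"
  have r': "cdual_apply r' v = l (C (resolvent1 N \<beta> v))" for v
    by (simp add: r'_def dual_ext_resolvent[OF \<beta>])
  note cont = T_continuous[of r] and cont' = C0_generator.T_continuous[OF dual_generator, of r']
  have \<phi>: "cdual_apply (T' t r') r = r' (T t r)" if "0 \<le> t" for t
    by (simp add: dual_semigroup[OF that])
  have \<phi>1: "cdual_apply (prim (\<lambda>t. T' t r') t) r = r' (prim (orbit r) t)" for t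
  proof -
    have "cdual_apply (prim (\<lambda>t. T' t r') t) r = prim (\<lambda>t. cdual_apply (T' t r') r) t"
      by (rule prim_linear[OF cont' cdual.bounded_linear_left])
    also have "\<dots> = prim (\<lambda>t. r' (T t r)) t"
      unfolding prim_def by (rule integral_cong) (simp add: \<phi>)
    also have "\<dots> = r' (prim (orbit r) t)"
      by (rule prim_linear[symmetric, OF cont cdual.bounded_linear_right])
    finally show ?thesis .
  qed
  have \<phi>2: "cdual_apply (prim (prim (\<lambda>t. T' t r')) t) r = r' (prim (prim (orbit r)) t)" for t
  proof -
    have "cdual_apply (prim (prim (\<lambda>t. T' t r')) t) r = prim (\<lambda>t. cdual_apply (prim (\<lambda>t. T' t r') t) r) t"
      by (rule prim_linear[OF continuous_on_prim[OF cont'] cdual.bounded_linear_left])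
    also have "\<dots> = prim (\<lambda>t. r' (prim (orbit r) t)) t"
      by (simp only: \<phi>1)
    also have "\<dots> = r' (prim (prim (orbit r)) t)"
      by (rule prim_linear[symmetric, OF continuous_on_prim[OF cont] cdual.bounded_linear_right])
    finally show ?thesis .
  qed
  have state: "cdual_apply (state_kernel M (cnj \<beta>) l \<tau>) r = r' (state_kernel N \<beta> a \<tau>)"
    unfolding state_kernel_def Let_def dual_node_sel r_def[symmetric] r'_def[symmetric]
    by (simp only: cdual.diff_left cdual.add_left cdual.diff_right cdual.add_right cdual_apply_scaleC
        cdual_scaleC_right cdual.scaleR_left cdual.scaleR_right \<phi>[OF \<tau>] \<phi>1 \<phi>2)
  have "cdual_apply (output_kernel M (cnj \<beta>) l \<tau>) a =
      cdual_apply (state_kernel M (cnj \<beta>) l \<tau>) r + \<tau> *\<^sub>R l (transfer_fun N \<beta> a)"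
    by (simp add: output_kernel_def dual_resolvent1[OF \<beta>] r_def)
  also have "\<dots> = l (output_kernel N \<beta> a \<tau>)"
    by (simp add: state r' output_kernel_def)
  finally show ?thesis .
qed

end

section \<open>Finite-dimensional spaces\<close>

text \<open>A finite generating set with bounded coordinate functionals, which need not be unique. The
  conjugation appears because \<^typ>\<open>'a cdual\<close> consists of conjugate-linear functionals.\<close>

definition frame :: "'a::complex_normed_vector set \<Rightarrow> ('a \<Rightarrow> 'a cdual) \<Rightarrow> bool"
  where "frame S l \<longleftrightarrow> finite S \<and> (\<forall>x. x = (\<Sum>e\<in>S. cnj (cdual_apply (l e) x) *\<^sub>C e))"

text \<open>p maps the whole space boundedly into the span of S and is the identity there. For b
  outside the span, c = b - p b is therefore nonzero, and a functional norming c, composed with id -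
  p, vanishes on the span but not at b.\<close>

lemma span_coordinates:
  fixes S :: "'a::complex_normed_vector set"
  assumes "finite S"
  shows "\<exists>l :: 'a \<Rightarrow> 'a cdual. \<forall>x\<in>cspan S. x = (\<Sum>e\<in>S. cnj (cdual_apply (l e) x) *\<^sub>C e)"
  using assms
proof (induction S rule: finite_induct)
  case empty
  show ?case by simp
next
  case (insert b S)
  then obtain l :: "'a \<Rightarrow> 'a cdual"
    where l: "\<And>x. x \<in> cspan S \<Longrightarrow> x = (\<Sum>e\<in>S. cnj (cdual_apply (l e) x) *\<^sub>C e)" by blast
  define p where "p x = (\<Sum>e\<in>S. cnj (cdual_apply (l e) x) *\<^sub>C e)" for x
  have sum_insert: "(\<Sum>e\<in>insert b S. cnj (cdual_apply (l' e) x) *\<^sub>C e) =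
      cnj (cdual_apply (l' b) x) *\<^sub>C b + (\<Sum>e\<in>S. cnj (cdual_apply (l' e) x) *\<^sub>C e)" for l' :: "'a \<Rightarrow> 'a cdual" and x
    using insert.hyps by simp
  show ?case
  proof (cases "b \<in> cspan S")
    case True
    \<comment> \<open>A redundant generator gets the coordinate 0.\<close>
    have same: "(\<Sum>e\<in>S. cnj (cdual_apply ((l(b := 0)) e) x) *\<^sub>C e) = (\<Sum>e\<in>S. cnj (cdual_apply (l e) x) *\<^sub>C e)" for x
      by (rule sum.cong) (use insert.hyps in auto)
    have "x = (\<Sum>e\<in>insert b S. cnj (cdual_apply ((l(b := 0)) e) x) *\<^sub>C e)" if "x \<in> cspan (insert b S)" for x
      unfolding sum_insert same
      using l[of x] that complex_vector.span_redundant[OF True] by simp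
    then show ?thesis by blast
  next
    case False
    have p_in: "p x \<in> cspan S" for x
      unfolding p_def by (intro complex_vector.span_sum complex_vector.span_scale complex_vector.span_base)
    define c where "c = b - p b"
    have c0: "c \<noteq> 0" using False p_in[of b] by (auto simp: c_def)
    obtain f :: "'a cdual" where f: "cdual_apply f c = norm c" by (rule norming_functional)
    \<comment> \<open>f after id - p, scaled so that b has coordinate 1.\<close>
    define m where "m = (1 / norm c) *\<^sub>C (f - (\<Sum>e\<in>S. cdual_apply f e *\<^sub>C l e))"
    have m: "cdual_apply m x = cdual_apply f (x - p x) / norm c" for x
      by (simp add: m_def p_def cdual.sum_right cdual.sum_left mult.commute)
    have m_b: "cdual_apply m b = 1" using c0 f by (simp add: m c_def[symmetric] del: cdual.diff_right)
    have m_S: "cdual_apply m y = 0" if "y \<in> cspan S" for y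
      using l[OF that] by (simp add: m p_def[symmetric])
    \<comment> \<open>The correction evaluates the old coordinates of x at x - k b, where k = cnj (m
      x).\<close>
    define l' where "l' e = (if e = b then m else l e - cdual_apply (l e) b *\<^sub>C m)" for e
    have "x = (\<Sum>e\<in>insert b S. cnj (cdual_apply (l' e) x) *\<^sub>C e)" if x: "x \<in> cspan (insert b S)" for x
    proof -
      obtain k where k: "x - k *\<^sub>C b \<in> cspan S"
        using x unfolding complex_vector.span_insert by blast
      have "cdual_apply m x = cdual_apply m (x - k *\<^sub>C b) + cnj k * cdual_apply m b" by simp
      then have mx: "cdual_apply m x = cnj k" using m_S[OF k] m_b by simp
      have "(\<Sum>e\<in>S. cnj (cdual_apply (l' e) x) *\<^sub>C e) =
          (\<Sum>e\<in>S. cnj (cdual_apply (l e) (x - k *\<^sub>C b)) *\<^sub>C e)"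
        by (rule sum.cong) (use insert.hyps in \<open>auto simp: l'_def mx mult.commute\<close>)
      also have "\<dots> = x - k *\<^sub>C b" by (rule l[OF k, symmetric])
      finally show ?thesis unfolding sum_insert by (simp add: l'_def mx)
    qed
    then show ?thesis by blast
  qed
qed

lemma frame_exists:
  assumes "finite_dimensional (UNIV :: 'a::complex_normed_vector set)"
  obtains S and l :: "'a::complex_normed_vector \<Rightarrow> 'a cdual" where "frame S l"
proof -
  obtain S :: "'a set" where S: "finite S" "cspan S = UNIV"
    using assms by (auto simp: finite_dimensional_def)
  obtain l :: "'a \<Rightarrow> 'a cdual" where "\<forall>x\<in>cspan S. x = (\<Sum>e\<in>S. cnj (cdual_apply (l e) x) *\<^sub>C e)"
    using span_coordinates[OF S(1)] by blast
  then have "frame S l" using S unfolding frame_def by simp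
  then show thesis by (rule that)
qed

lemma frame_expand: "frame S l \<Longrightarrow> x = (\<Sum>e\<in>S. cnj (cdual_apply (l e) x) *\<^sub>C e)"
  unfolding frame_def by blast

lemma frame_finite: "frame S l \<Longrightarrow> finite S"
  unfolding frame_def by blast

lemma frame_dual_expand:
  assumes "frame S l"
  shows "F = (\<Sum>e\<in>S. cdual_apply F e *\<^sub>C l e)"
proof (rule cdual_eqI)
  fix x
  have "cdual_apply F x = cdual_apply F (\<Sum>e\<in>S. cnj (cdual_apply (l e) x) *\<^sub>C e)"
    by (rule arg_cong[OF frame_expand[OF assms]])
  also have "\<dots> = cdual_apply (\<Sum>e\<in>S. cdual_apply F e *\<^sub>C l e) x"
    by (simp add: cdual.sum_right cdual.sum_left mult.commute)
  finally show "cdual_apply F x = cdual_apply (\<Sum>e\<in>S. cdual_apply F e *\<^sub>C l e) x" .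
qed

lemma frame_integrable:
  fixes f :: "real \<Rightarrow> 'a::cbanach"
  assumes fr: "frame S l" and int: "\<And>e. e \<in> S \<Longrightarrow> (\<lambda>t. cdual_apply (l e) (f t)) integrable_on I"
  shows "f integrable_on I"
proof -
  have "(\<lambda>t. \<Sum>e\<in>S. cnj (cdual_apply (l e) (f t)) *\<^sub>C e) integrable_on I"
  proof (rule integrable_sum[OF frame_finite[OF fr]])
    fix e assume "e \<in> S"
    have "bounded_linear (\<lambda>c. cnj c *\<^sub>C e)"
      by (rule bounded_linear_compose[OF bounded_linear_scaleC_left bounded_linear_cnj])
    from integrable_linear[OF int[OF \<open>e \<in> S\<close>] this]
    show "(\<lambda>t. cnj (cdual_apply (l e) (f t)) *\<^sub>C e) integrable_on I" by (simp add: o_def)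
  qed
  then show ?thesis using frame_expand[OF fr, symmetric] by simp
qed

section \<open>Locally essentially bounded functions and test functions\<close>

lemma measurable_on_bounded_linear:
  assumes "f measurable_on S" "bounded_linear L"
  shows "(\<lambda>x. L (f x)) measurable_on S"
  using measurable_on_compose_continuous_0[OF assms(1) linear_continuous_on[OF assms(2)]]
    linear_0[OF bounded_linear.linear[OF assms(2)]] by (simp add: o_def)

lemma measurable_on_borel:
  fixes f :: "real \<Rightarrow> 'a::euclidean_space"
  assumes "f measurable_on {0..}"
  shows "f \<in> borel_measurable (lebesgue_on {0..t})"
  by (rule measurable_restrict_mono[OF measurable_on_imp_borel_measurable_lebesgue[OF assms]]) auto

lemma measurable_on_norm_borel:
  fixes f :: "real \<Rightarrow> 'a::real_normed_vector"
  assumes "f measurable_on {0..}"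
  shows "(\<lambda>s. norm (f s)) \<in> borel_measurable (lebesgue_on {0..t})"
proof (rule measurable_on_borel)
  show "(\<lambda>s. norm (f s)) measurable_on {0..}"
    using measurable_on_compose_continuous_0[OF assms, of norm]
    by (simp add: o_def continuous_on_norm continuous_on_id)
qed

lemma Linf_norm_le_iff:
  fixes f :: "real \<Rightarrow> 'a::banach"
  assumes "f measurable_on {0..}"
  shows "Linf_norm t f \<le> ereal c \<longleftrightarrow> (AE s in lebesgue_on {0..t}. norm (f s) \<le> c)"
proof
  assume *: "Linf_norm t f \<le> ereal c"
  have "AE s in lebesgue_on {0..t}. ereal (norm (f s)) \<le> Linf_norm t f"
    unfolding Linf_norm_def by (rule esssup_AE)
  then show "AE s in lebesgue_on {0..t}. norm (f s) \<le> c"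
    by eventually_elim (use * order_trans in fastforce)
next
  assume *: "AE s in lebesgue_on {0..t}. norm (f s) \<le> c"
  then show "Linf_norm t f \<le> ereal c"
    unfolding Linf_norm_def using measurable_on_norm_borel[OF assms, of t]
    by (intro esssup_I) auto
qed

text \<open>For t > 0 the interval has positive measure, which keeps the essential supremum away
  from -\<infinity>.\<close>

lemma Linf_norm_nonneg:
  fixes f :: "real \<Rightarrow> 'a::banach"
  assumes "f measurable_on {0..}" "t > 0"
  shows "0 \<le> Linf_norm t f"
proof -
  have "emeasure (lebesgue_on {0..t}) (space (lebesgue_on {0..t})) \<noteq> 0"
    using assms(2) by (simp add: emeasure_restrict_space)
  then have "0 = esssup (lebesgue_on {0..t}) (\<lambda>_. 0 :: ereal)" by (simp add: esssup_const)
  also have "\<dots> \<le> Linf_norm t f"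
    unfolding Linf_norm_def by (rule esssup_mono) auto
  finally show ?thesis .
qed

lemma Linf_norm_real:
  fixes f :: "real \<Rightarrow> 'a::banach"
  assumes "Linf_loc f" "t > 0"
  obtains V where "V \<ge> 0" "Linf_norm t f = ereal V" "AE s in lebesgue_on {0..t}. norm (f s) \<le> V"
proof -
  have f: "f measurable_on {0..}" and "Linf_norm t f < \<infinity>" using assms by (auto simp: Linf_loc_def)
  moreover have "0 \<le> Linf_norm t f" by (rule Linf_norm_nonneg[OF f assms(2)])
  ultimately obtain V where V: "Linf_norm t f = ereal V" "V \<ge> 0" by (cases "Linf_norm t f") auto
  then show thesis using that Linf_norm_le_iff[OF f, of t V] by simp
qed

lemma Linf_loc_bounded:
  fixes f :: "real \<Rightarrow> 'a::banach" and g :: "real \<Rightarrow> 'b::banach"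
  assumes f: "Linf_loc f" and g: "g measurable_on {0..}" and le: "\<And>s. norm (g s) \<le> c * norm (f s)" and c: "c \<ge> 0"
  shows "Linf_loc g" and "t > 0 \<Longrightarrow> Linf_norm t g \<le> ereal c * Linf_norm t f"
proof -
  have *: "Linf_norm t g \<le> ereal c * Linf_norm t f" if t: "t > 0" for t
  proof -
    obtain V where V: "V \<ge> 0" "Linf_norm t f = ereal V" "AE s in lebesgue_on {0..t}. norm (f s) \<le> V"
      using Linf_norm_real[OF f t] by blast
    have "AE s in lebesgue_on {0..t}. norm (g s) \<le> c * V"
      using V(3) by eventually_elim (rule order_trans[OF le mult_left_mono[OF _ c]])
    then show ?thesis using Linf_norm_le_iff[OF g, of t "c * V"] V(2) by simp
  qed
  then show "t > 0 \<Longrightarrow> Linf_norm t g \<le> ereal c * Linf_norm t f" .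
  have "Linf_norm t g < \<infinity>" if t: "t > 0" for t
  proof -
    obtain V where "Linf_norm t f = ereal V" using Linf_norm_real[OF f t] by blast
    then show ?thesis using *[OF t] by auto
  qed
  then show "Linf_loc g" using g by (simp add: Linf_loc_def)
qed

lemma L1_loc_bounded:
  fixes f :: "real \<Rightarrow> 'a::banach" and g :: "real \<Rightarrow> 'b::banach"
  assumes f: "L1_loc f" and g: "g measurable_on {0..}" and le: "\<And>s. norm (g s) \<le> c * norm (f s)"
  shows "L1_loc g"
  unfolding L1_loc_def
proof (intro conjI allI impI g)
  fix t :: real assume "t > 0"
  then have "(\<lambda>s. c * norm (f s)) integrable_on {0..t}"
    using f by (intro integrable_on_mult_right) (simp add: L1_loc_def)
  then have "(\<lambda>s. norm (g s)) absolutely_integrable_on {0..t}"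
    using measurable_on_norm_borel[OF g] le
    by (intro measurable_bounded_by_integrable_imp_absolutely_integrable) auto
  then show "(\<lambda>s. norm (g s)) integrable_on {0..t}"
    by (simp add: absolutely_integrable_on_def)
qed

lemma L1_loc_imp_locally_integrable:
  assumes "L1_loc w"
  shows "locally_integrable w"
  unfolding locally_integrable_def
proof
  fix t :: real
  \<comment> \<open>\<open>L1_loc\<close> speaks of t > 0 only, hence
    \<open>max t 1\<close>.\<close>
  have "(\<lambda>s. norm (w s)) integrable_on {0..max t 1}" using assms by (simp add: L1_loc_def)
  then have "w absolutely_integrable_on {0..max t 1}"
    using measurable_on_borel[of w] assms
    by (intro measurable_bounded_by_integrable_imp_absolutely_integrable[where g = "\<lambda>s. norm (w s)"])
       (auto simp: L1_loc_def)
  then show "w absolutely_integrable_on {0..t}" by (rule set_integrable_subset) auto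
qed

section \<open>Test functions and integrals against them\<close>

lemma deriv_eq_0_outside:
  fixes f :: "real \<Rightarrow> real"
  assumes "\<And>t. t < a \<or> b < t \<Longrightarrow> f t = 0" "t < a \<or> b < t"
  shows "deriv f t = 0"
proof -
  have "(f has_field_derivative 0) (at t)"
  proof (rule has_field_derivative_transform_within_open)
    show "((\<lambda>_. 0) has_field_derivative 0) (at t)" by simp
    show "open ({..<a} \<union> {b<..})" by (intro open_Un) auto
  qed (use assms in auto)
  then show ?thesis by (rule DERIV_imp_deriv)
qed

lemma test_function_deriv2:
  assumes "test_function \<phi>"
  shows "continuous_on UNIV \<phi>" "continuous_on UNIV (deriv (deriv \<phi>))"
    and "\<exists>b. (\<forall>t>b. \<phi> t = 0) \<and> (\<forall>t>b. deriv (deriv \<phi>) t = 0)"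
proof -
  have *: "continuous_on UNIV ((deriv ^^ n) \<phi>)" for n
    using assms unfolding test_function_def by (blast intro: differentiable_imp_continuous_on)
  from *[of 0] *[of 2] show "continuous_on UNIV \<phi>" "continuous_on UNIV (deriv (deriv \<phi>))"
    by (simp_all add: numeral_2_eq_2)
  obtain a b where ab: "\<And>t. \<phi> t \<noteq> 0 \<Longrightarrow> a \<le> t \<and> t \<le> b"
    using assms unfolding test_function_def by blast
  have 0: "\<phi> t = 0" if "t < a \<or> b < t" for t using ab[of t] that by force
  have 1: "deriv \<phi> t = 0" if "t < a \<or> b < t" for t using deriv_eq_0_outside[of a b \<phi>] 0 that by blast
  have 2: "deriv (deriv \<phi>) t = 0" if "t < a \<or> b < t" for t using deriv_eq_0_outside[of a b "deriv \<phi>"] 1 that by blast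
  show "\<exists>b. (\<forall>t>b. \<phi> t = 0) \<and> (\<forall>t>b. deriv (deriv \<phi>) t = 0)" using 0 2 by blast
qed

lemma integrable_on_atLeast_if_supported:
  fixes f :: "real \<Rightarrow> 'a::banach"
  assumes "f integrable_on {0..b}" "\<And>t. t > b \<Longrightarrow> f t = 0"
  shows "f integrable_on {0..}"
proof -
  have "(\<lambda>t. if t \<in> {0..b} then f t else 0) integrable_on {0..b}"
    by (rule integrable_eq[OF assms(1)]) simp
  then have "(\<lambda>t. if t \<in> {0..b} then f t else 0) integrable_on {0..}"
    by (rule integrable_on_superset) auto
  then show ?thesis
    by (rule integrable_eq) (use assms(2) in auto)
qed

lemma regular_integrable_continuous:
  fixes h :: "real \<Rightarrow> 'a::banach"
  assumes \<phi>: "test_function \<phi>" and h: "continuous_on {0..} h"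
  shows "(\<lambda>t. deriv (deriv \<phi>) t *\<^sub>R h t) integrable_on {0..}"
proof -
  note t = test_function_deriv2[OF \<phi>]
  obtain b where b: "\<And>t. t > b \<Longrightarrow> deriv (deriv \<phi>) t = 0" using t(3) by blast
  show ?thesis
    by (rule integrable_on_atLeast_if_supported[of _ b])
       (use b in \<open>auto intro!: integrable_on_if_continuous_atLeast continuous_intros
         continuous_on_subset[OF t(2)] h\<close>)
qed

text \<open>Linear maps can be moved through the integral only once it is known to exist. For
  bounded g this is reduced to complex coordinates, where measurability and boundedness on a finite
  interval suffice.\<close>

lemma regular_integrable_Linf:
  fixes g :: "real \<Rightarrow> 'a::cbanach"
  assumes \<phi>: "test_function \<phi>" and g: "Linf_loc g" and fr: "frame S (l :: 'a \<Rightarrow> 'a cdual)"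
  shows "(\<lambda>t. \<phi> t *\<^sub>R g t) integrable_on {0..}"
proof (rule frame_integrable[OF fr])
  note t = test_function_deriv2[OF \<phi>]
  obtain b where b: "\<And>t. t > b \<Longrightarrow> \<phi> t = 0" using t(3) by blast
  \<comment> \<open>Positive, as the essential bound on [0, b'] requires.\<close>
  define b' where "b' = max b 1"
  fix e
  let ?f = "\<lambda>t. cdual_apply (l e) (\<phi> t *\<^sub>R g t)"
  have g_meas: "g measurable_on {0..}" using g by (simp add: Linf_loc_def)
  have "\<phi> measurable_on {0..}"
    by (rule measurable_on_UNIV[THEN iffD1, OF measurable_on_restrict[OF continuous_imp_measurable_on[OF t(1)]]]) simp
  then have "(\<lambda>t. \<phi> t *\<^sub>R g t) measurable_on {0..}" using g_meas by (rule measurable_on_scaleR)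
  then have f_meas: "?f measurable_on {0..}"
    by (rule measurable_on_bounded_linear[OF _ cdual.bounded_linear_right])
  obtain V where V: "V \<ge> 0" "AE s in lebesgue_on {0..b'}. norm (g s) \<le> V"
    by (rule Linf_norm_real[OF g, of b']) (simp add: b'_def)
  have "bounded (\<phi> ` {0..b'})"
    by (intro compact_imp_bounded compact_continuous_image continuous_on_subset[OF t(1)]) auto
  then obtain m where m: "m > 0" "\<And>s. s \<in> {0..b'} \<Longrightarrow> \<bar>\<phi> s\<bar> \<le> m"
    unfolding bounded_pos by auto
  have "integrable (lebesgue_on {0..b'}) ?f"
  proof (rule integrableI_bounded_set)
    show "{0..b'} \<in> sets (lebesgue_on {0..b'})" by (simp add: sets_restrict_space_iff)
    show "?f \<in> borel_measurable (lebesgue_on {0..b'})" by (rule measurable_on_borel[OF f_meas])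
    show "emeasure (lebesgue_on {0..b'}) {0..b'} < \<infinity>"
      by (simp add: emeasure_restrict_space b'_def)
    show "AE x in lebesgue_on {0..b'}. x \<in> {0..b'} \<longrightarrow> norm (?f x) \<le> norm (l e) * (m * V)"
      using V(2)
    proof eventually_elim
      case (elim x)
      show ?case
      proof
        assume "x \<in> {0..b'}"
        then have "norm (\<phi> x *\<^sub>R g x) \<le> m * V"
          using m elim by (simp add: mult_mono)
        then show "norm (?f x) \<le> norm (l e) * (m * V)"
          by (intro order_trans[OF norm_cdual] mult_left_mono) auto
      qed
    qed
    show "AE x in lebesgue_on {0..b'}. x \<notin> {0..b'} \<longrightarrow> ?f x = 0"
      by (rule AE_I2) simp
  qed
  then have "?f integrable_on {0..b'}" by (rule integrable_on_lebesgue_on) simp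
  then show "?f integrable_on {0..}"
    by (rule integrable_on_atLeast_if_supported) (simp add: b b'_def)
qed

lemma regular_distribution_linear_sum:
  fixes f :: "'k \<Rightarrow> real \<Rightarrow> 'a::banach" and L :: "'k \<Rightarrow> 'a \<Rightarrow> 'b::banach"
  assumes K: "finite K" and int: "\<And>k. k \<in> K \<Longrightarrow> (\<lambda>t. \<phi> t *\<^sub>R f k t) integrable_on {0..}"
    and L: "\<And>k. k \<in> K \<Longrightarrow> bounded_linear (L k)"
  shows "regular_distribution (\<lambda>t. \<Sum>k\<in>K. L k (f k t)) \<phi> = (\<Sum>k\<in>K. L k (regular_distribution (f k) \<phi>))"
proof -
  have scale: "L k (\<phi> t *\<^sub>R f k t) = \<phi> t *\<^sub>R L k (f k t)" if "k \<in> K" for k t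
    using linear_cmul[OF bounded_linear.linear[OF L[OF that]]] by simp
  have int': "(\<lambda>t. \<phi> t *\<^sub>R L k (f k t)) integrable_on {0..}"
    and eq: "integral {0..} (\<lambda>t. \<phi> t *\<^sub>R L k (f k t)) = L k (regular_distribution (f k) \<phi>)" if "k \<in> K" for k
    using integrable_linear[OF int[OF that] L[OF that]] integral_linear[OF int[OF that] L[OF that]]
    by (simp_all add: o_def scale[OF that] regular_distribution_def)
  show ?thesis
    unfolding regular_distribution_def[of "\<lambda>t. \<Sum>k\<in>K. L k (f k t)"] scaleR_sum_right
    by (subst integral_sum[OF K int']) (auto intro: sum.cong eq)
qed

section \<open>Stability of the dual system node\<close>

context system
begin

text \<open>Provides the solutions to which the stability hypothesis is applied.\<close>

lemma generalised_solution_exists: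
  assumes \<beta>: "\<beta> \<in> node_domain N" and u: "L1_loc (\<lambda>s. w s *\<^sub>C a)" and w: "locally_integrable w"
  shows "generalised_solution N (\<lambda>s. w s *\<^sub>C a) (forced_state N (\<lambda>s. w s *\<^sub>C a))
    (\<lambda>\<psi>. distribution_deriv (distribution_deriv (regular_distribution (conv w (output_kernel N \<beta> a)))) \<psi>)"
  unfolding generalised_solution_def
proof (intro conjI exI)
  show "\<forall>t\<ge>0. forced_state N (\<lambda>s. w s *\<^sub>C a) t = j (T t 0) +
      integral {0..t} (\<lambda>s. ext_semigroup N (t - s) (B (w s *\<^sub>C a)))"
    unfolding forced_state_def by simp
  show "\<forall>t\<ge>0. \<exists>z. j z = integral {0..t} (\<lambda>s. (t - s) *\<^sub>R forced_state N (\<lambda>s. w s *\<^sub>C a) s) \<and>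
      ((z, integral {0..t} (\<lambda>s. (t - s) *\<^sub>R (w s *\<^sub>C a))), conv w (output_kernel N \<beta> a) t) \<in> CD N"
    using forced_output[OF \<beta> w] by blast
qed (use u continuous_on_forced_state[OF \<beta> w] in auto)

lemma forced_state_0 [simp]: "forced_state N u 0 = 0"
  by (simp add: forced_state_def)

text \<open>j is injective, so x 0 = 0 kills the initial value in X and determines z; C&D is
  single-valued, so h is the sum of convolutions.\<close>

lemma generalised_solution_output:
  assumes sol: "generalised_solution N u x y" and x0: "x 0 = 0" and \<beta>: "\<beta> \<in> node_domain N"
    and K: "finite K" and w: "\<And>k. k \<in> K \<Longrightarrow> locally_integrable (w k)"
    and u: "\<And>s. u s = (\<Sum>k\<in>K. w k s *\<^sub>C a k)" and \<psi>: "test_function \<psi>"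
  shows "y \<psi> = regular_distribution (\<lambda>t. \<Sum>k\<in>K. conv (w k) (output_kernel N \<beta> (a k)) t) (deriv (deriv \<psi>))"
proof -
  obtain x1 where x1: "\<And>t. 0 \<le> t \<Longrightarrow> x t = j (T t x1) + forced_state N u t"
    using sol unfolding generalised_solution_def forced_state_def by blast
  have "j x1 = j 0" using x1[of 0] x0 by simp
  then have "x1 = 0" by (rule j_inj)
  then have x: "x t = forced_state N u t" if "0 \<le> t" for t using x1[OF that] by simp
  obtain h where h: "\<And>t. 0 \<le> t \<Longrightarrow> \<exists>z. j z = integral {0..t} (\<lambda>s. (t - s) *\<^sub>R x s) \<and>
        ((z, integral {0..t} (\<lambda>s. (t - s) *\<^sub>R u s)), h t) \<in> CD N"
    and y: "\<And>\<phi>. test_function \<phi> \<Longrightarrow> y \<phi> = distribution_deriv (distribution_deriv (regular_distribution h)) \<phi>"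
    using sol unfolding generalised_solution_def by blast
  have h_eq: "h t = (\<Sum>k\<in>K. conv (w k) (output_kernel N \<beta> (a k)) t)" if t: "0 \<le> t" for t
  proof -
    obtain z where z: "j z = integral {0..t} (\<lambda>s. (t - s) *\<^sub>R x s)"
      "((z, integral {0..t} (\<lambda>s. (t - s) *\<^sub>R u s)), h t) \<in> CD N"
      using h[OF t] by blast
    obtain z' where z': "j z' = integral {0..t} (\<lambda>s. (t - s) *\<^sub>R forced_state N u s)"
      "((z', integral {0..t} (\<lambda>s. (t - s) *\<^sub>R u s)), \<Sum>k\<in>K. conv (w k) (output_kernel N \<beta> (a k)) t) \<in> CD N"
      using superposition(2)[OF \<beta> K w u t] by blast
    have "integral {0..t} (\<lambda>s. (t - s) *\<^sub>R x s) = integral {0..t} (\<lambda>s. (t - s) *\<^sub>R forced_state N u s)"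
      by (rule integral_cong) (simp add: x)
    then have "j z = j z'" by (simp only: z(1) z'(1))
    then have "z = z'" by (rule j_inj)
    then show ?thesis using CD_unique[OF \<beta> z(2)] z'(2) by blast
  qed
  have "y \<psi> = regular_distribution h (deriv (deriv \<psi>))"
    by (simp add: y[OF \<psi>] distribution_deriv_def)
  also have "\<dots> = regular_distribution (\<lambda>t. \<Sum>k\<in>K. conv (w k) (output_kernel N \<beta> (a k)) t) (deriv (deriv \<psi>))"
    unfolding regular_distribution_def by (rule integral_cong) (simp add: h_eq)
  finally show ?thesis .
qed

text \<open>Membership in the graph of C&D includes a \<beta> of the half-plane, so a single value h
  t provides one. Over an empty half-plane there are no solutions and stability is vacuous.\<close>

lemma node_domain_nonempty:
  assumes "generalised_solution N u x y"
  shows "node_domain N \<noteq> {}"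
proof -
  have "CD N \<noteq> {}" using assms unfolding generalised_solution_def by (metis empty_iff order_refl)
  then show ?thesis unfolding CD_def by auto
qed

end

context dual_system
begin

text \<open>Moving w across the conjugate-linear l turns it into its conjugate.\<close>

lemma dual_conv_kernel:
  assumes \<beta>: "\<beta> \<in> node_domain N" and w: "locally_integrable w"
    and cw: "locally_integrable (\<lambda>s. cnj (w s))" and t: "0 \<le> t"
  shows "cdual_apply (conv w (output_kernel M (cnj \<beta>) l) t) a = cdual_apply l (conv (\<lambda>s. cnj (w s)) (output_kernel N \<beta> a) t)"
proof -
  have \<beta>': "cnj \<beta> \<in> node_domain M" using \<beta> by (simp add: dual_node_domain cnj_node_domain)
  have "cdual_apply (conv w (output_kernel M (cnj \<beta>) l) t) a =
      integral {0..t} (\<lambda>s. cdual_apply (w s *\<^sub>C output_kernel M (cnj \<beta>) l (t - s)) a)"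
    unfolding conv_def
    using integral_linear[OF conv_integrable[OF w system.continuous_on_kernel[OF dual \<beta>']] cdual.bounded_linear_left]
    by (simp add: o_def)
  also have "\<dots> = integral {0..t} (\<lambda>s. cdual_apply l (cnj (w s) *\<^sub>C output_kernel N \<beta> a (t - s)))"
    by (rule integral_cong) (simp add: dual_kernel[OF \<beta>])
  also have "\<dots> = cdual_apply l (conv (\<lambda>s. cnj (w s)) (output_kernel N \<beta> a) t)"
    unfolding conv_def
    using integral_linear[OF conv_integrable[OF cw continuous_on_kernel[OF \<beta>]] cdual.bounded_linear_right]
    by (simp add: o_def)
  finally show ?thesis .
qed

text \<open>Each pair p = (k, a) of frame vectors asks N for its response to the input cnj (w k s)
  a, reads off the coordinate at k and contributes that multiple of lU a to the dual output. The sum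
  over all pairs represents y, with a constant independent of v.\<close>

theorem dual_Linf_BIBO_stable:
  assumes U: "frame (I :: 'u set) lU" and Y: "frame (K :: 'y set) lY"
    and stable: "Linf_BIBO_stable N"
  shows "Linf_BIBO_stable M"
proof (cases "node_domain N = {}")
  case True
  then have "\<not> generalised_solution M u x y" for u x y
    using system.node_domain_nonempty[OF dual] dual_node_domain by metis
  then show ?thesis unfolding Linf_BIBO_stable_def by (intro exI[of _ 1]) auto
next
  case False
  then obtain \<beta> where \<beta>: "\<beta> \<in> node_domain N" by blast
  then have \<beta>': "cnj \<beta> \<in> node_domain M" by (simp add: dual_node_domain cnj_node_domain)
  obtain c where c: "c > 0" and BIBO: "\<And>u x y. generalised_solution N u x y \<Longrightarrow> Linf_loc u \<Longrightarrow> x 0 = 0 \<Longrightarrow>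
      \<exists>g. Linf_loc g \<and> (\<forall>\<phi>. test_function \<phi> \<longrightarrow> y \<phi> = regular_distribution g \<phi>) \<and>
        (\<forall>t>0. Linf_norm t g \<le> ereal c * Linf_norm t u)"
    using stable unfolding Linf_BIBO_stable_def by blast
  note fin = frame_finite[OF U] frame_finite[OF Y]
  define P where "P = K \<times> I"
  have P: "finite P" using fin by (simp add: P_def)
  \<comment> \<open>A matrix unit of the transposed system: the coordinate of y at k, attached to
    the functional lU a.\<close>
  define L where "L p y = cdual_apply (lY (fst p)) y *\<^sub>C lU (snd p)" for p :: "'y \<times> 'u" and y
  have L: "bounded_linear (L p)" for p
    unfolding L_def by (rule bounded_linear_compose[OF bounded_linear_scaleC_left cdual.bounded_linear_right])
  define m where "m p = norm (lY (fst p)) * norm (lU (snd p))" for p :: "'y \<times> 'u"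
  have L_norm: "norm (L p y) \<le> m p * norm y" for p y
    using mult_right_mono[OF norm_cdual[of "lY (fst p)" y] norm_ge_zero[of "lU (snd p)"]]
    by (simp add: L_def m_def norm_scaleC mult_ac)
  define d where "d p = norm (fst p) * norm (snd p)" for p :: "'y \<times> 'u"
  have md0: "m p \<ge> 0" "d p \<ge> 0" for p by (simp_all add: m_def d_def)
  \<comment> \<open>m p and d p are the costs of output and input coordinates; the 1 keeps c'
    positive even if the sum vanishes.\<close>
  define c' where "c' = 1 + (\<Sum>p\<in>P. m p * (c * d p))"
  have c'_ge: "(\<Sum>p\<in>P. m p * (c * d p)) \<le> c'" by (simp add: c'_def)
  have c': "c' > 0"
    using sum_nonneg[of P "\<lambda>p. m p * (c * d p)"] md0 c by (auto simp: c'_def intro: add_pos_nonneg)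
  show ?thesis
    unfolding Linf_BIBO_stable_def
  proof (intro exI[of _ c'] conjI allI impI c')
    fix v x y assume "generalised_solution M v x y \<and> Linf_loc v \<and> x 0 = 0"
    then have sol: "generalised_solution M v x y" and v: "Linf_loc v" and x0: "x 0 = 0" by auto
    have v1: "L1_loc v" and v_meas: "v measurable_on {0..}"
      using sol by (auto simp: generalised_solution_def L1_loc_def)
    \<comment> \<open>The coordinates of v with respect to the functionals lY are its values on K,
      without conjugation.\<close>
    define w where "w k s = cdual_apply (v s) k" for k s
    have v_expand: "v s = (\<Sum>k\<in>K. w k s *\<^sub>C lY k)" for s
      unfolding w_def by (rule frame_dual_expand[OF Y])
    have w_meas: "w k measurable_on {0..}" for k
      unfolding w_def[abs_def] by (rule measurable_on_bounded_linear[OF v_meas cdual.bounded_linear_left])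
    have cw_meas: "(\<lambda>s. cnj (w k s)) measurable_on {0..}" for k
      by (rule measurable_on_bounded_linear[OF w_meas bounded_linear_cnj])
    have w_le: "cmod (w k s) \<le> norm k * norm (v s)" for k s
      using norm_cdual[of "v s" k] by (simp add: w_def mult.commute)
    have w_loc: "locally_integrable (w k)" for k
      by (intro L1_loc_imp_locally_integrable L1_loc_bounded[OF v1 w_meas w_le])
    have cw_loc: "locally_integrable (\<lambda>s. cnj (w k s))" for k
      by (rule L1_loc_imp_locally_integrable, rule L1_loc_bounded[OF v1 cw_meas, where c = "norm k"])
         (use w_le in simp)
    define u where "u p s = cnj (w (fst p) s) *\<^sub>C snd p" for p :: "'y \<times> 'u" and s
    have u_meas: "u p measurable_on {0..}" for p
      unfolding u_def[abs_def] by (rule measurable_on_bounded_linear[OF cw_meas bounded_linear_scaleC_left])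
    have u_le: "norm (u p s) \<le> d p * norm (v s)" for p s
      using mult_right_mono[OF w_le[of "fst p" s] norm_ge_zero[of "snd p"]]
      by (simp add: u_def d_def norm_scaleC mult_ac)
    define h where "h p = conv (\<lambda>s. cnj (w (fst p) s)) (output_kernel N \<beta> (snd p))" for p :: "'y \<times> 'u"
    have h_cont: "continuous_on {0..} (h p)" for p
      unfolding h_def by (intro continuous_on_conv cw_loc continuous_on_kernel[OF \<beta>])
    have "\<exists>g. Linf_loc g \<and>
        (\<forall>\<phi>. test_function \<phi> \<longrightarrow> regular_distribution (h p) (deriv (deriv \<phi>)) = regular_distribution g \<phi>) \<and>
        (\<forall>t>0. Linf_norm t g \<le> ereal c * Linf_norm t (u p))" for p
    proof -
      have "L1_loc (u p)" by (rule L1_loc_bounded[OF v1 u_meas u_le])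
      then have "generalised_solution N (u p) (forced_state N (u p))
          (\<lambda>\<psi>. distribution_deriv (distribution_deriv (regular_distribution (h p))) \<psi>)"
        unfolding u_def[abs_def] h_def
        by (rule generalised_solution_exists[OF \<beta> _ cw_loc])
      from BIBO[OF this Linf_loc_bounded(1)[OF v u_meas u_le md0(2)] forced_state_0]
      show ?thesis by (simp add: distribution_deriv_def)
    qed
    then obtain g where g: "\<And>p. Linf_loc (g p)"
      and g_dist: "\<And>p \<phi>. test_function \<phi> \<Longrightarrow> regular_distribution (h p) (deriv (deriv \<phi>)) = regular_distribution (g p) \<phi>"
      and g_norm: "\<And>p t. t > 0 \<Longrightarrow> Linf_norm t (g p) \<le> ereal c * Linf_norm t (u p)"
      by metis
    have g_meas: "g p measurable_on {0..}" for p using g by (simp add: Linf_loc_def)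
    define G where "G t = (\<Sum>p\<in>P. L p (g p t))" for t
    have G_meas: "G measurable_on {0..}"
      unfolding G_def[abs_def] by (intro measurable_on_sum P measurable_on_bounded_linear[OF g_meas L])
    have G_norm: "Linf_norm t G \<le> ereal c' * Linf_norm t v" if t: "t > 0" for t
    proof -
      obtain V where V: "V \<ge> 0" "Linf_norm t v = ereal V"
        using Linf_norm_real[OF v t] by blast
      have "AE s in lebesgue_on {0..t}. norm (g p s) \<le> c * (d p * V)" for p
      proof -
        have "Linf_norm t (u p) \<le> ereal (d p * V)"
          using Linf_loc_bounded(2)[OF v u_meas u_le md0(2) t] V(2) by simp
        then have "ereal c * Linf_norm t (u p) \<le> ereal c * ereal (d p * V)"
          using c by (intro ereal_mult_left_mono) auto
        then have "Linf_norm t (g p) \<le> ereal (c * (d p * V))"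
          using g_norm[OF t, of p] by (simp add: order_trans)
        then show ?thesis using Linf_norm_le_iff[OF g_meas] by blast
      qed
      then have "AE s in lebesgue_on {0..t}. \<forall>p\<in>P. norm (g p s) \<le> c * (d p * V)"
        using P by (simp add: AE_ball_countable countable_finite)
      then have "AE s in lebesgue_on {0..t}. norm (G s) \<le> c' * V"
      proof eventually_elim
        case (elim s)
        have "norm (G s) \<le> (\<Sum>p\<in>P. m p * (c * (d p * V)))"
          unfolding G_def
          by (rule sum_norm_le, rule order_trans[OF L_norm mult_left_mono[OF _ md0(1)]]) (use elim in auto)
        also have "\<dots> = (\<Sum>p\<in>P. m p * (c * d p)) * V"
          by (simp add: sum_distrib_left sum_distrib_right mult_ac)
        also have "\<dots> \<le> c' * V" by (rule mult_right_mono[OF c'_ge V(1)])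
        finally show ?case .
      qed
      then show ?thesis using Linf_norm_le_iff[OF G_meas] V(2) by simp
    qed
    have "Linf_loc G"
      unfolding Linf_loc_def
    proof (intro conjI allI impI G_meas)
      fix t :: real assume t: "t > 0"
      obtain V where "Linf_norm t v = ereal V" using Linf_norm_real[OF v t] by blast
      then show "Linf_norm t G < \<infinity>" using G_norm[OF t] by auto
    qed
    moreover have "y \<phi> = regular_distribution G \<phi>" if \<phi>: "test_function \<phi>" for \<phi>
    proof -
      have "y \<phi> = regular_distribution (\<lambda>t. \<Sum>k\<in>K. conv (w k) (output_kernel M (cnj \<beta>) (lY k)) t) (deriv (deriv \<phi>))"
        by (rule system.generalised_solution_output[OF dual sol x0 \<beta>' fin(2) w_loc v_expand \<phi>])
      also have "\<dots> = regular_distribution (\<lambda>t. \<Sum>p\<in>P. L p (h p t)) (deriv (deriv \<phi>))"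
        unfolding regular_distribution_def
      proof (rule integral_cong)
        fix t :: real assume "t \<in> {0..}"
        then have t: "0 \<le> t" by simp
        \<comment> \<open>An element of U* is the sum of its values at a times lU a; by
          \<open>dual_conv_kernel\<close> the value at a is lY k of the original
          convolution.\<close>
        have "conv (w k) (output_kernel M (cnj \<beta>) (lY k)) t = (\<Sum>a\<in>I. L (k, a) (h (k, a) t))" for k
          by (subst frame_dual_expand[OF U])
             (simp add: dual_conv_kernel[OF \<beta> w_loc cw_loc t] L_def h_def)
        then show "deriv (deriv \<phi>) t *\<^sub>R (\<Sum>k\<in>K. conv (w k) (output_kernel M (cnj \<beta>) (lY k)) t) =
            deriv (deriv \<phi>) t *\<^sub>R (\<Sum>p\<in>P. L p (h p t))"
          by (simp add: P_def sum.cartesian_product split_def)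
      qed
      \<comment> \<open>The maps L p are pulled out for the continuous h p and put back for the
        bounded g p; in between stands the stability of N.\<close>
      also have "\<dots> = (\<Sum>p\<in>P. L p (regular_distribution (h p) (deriv (deriv \<phi>))))"
        by (intro regular_distribution_linear_sum P L regular_integrable_continuous[OF \<phi> h_cont])
      also have "\<dots> = (\<Sum>p\<in>P. L p (regular_distribution (g p) \<phi>))"
        by (simp only: g_dist[OF \<phi>])
      also have "\<dots> = regular_distribution G \<phi>"
        unfolding G_def[abs_def]
        by (intro regular_distribution_linear_sum[symmetric] P L regular_integrable_Linf[OF \<phi> g Y])
      finally show ?thesis .
    qed
    ultimately show "\<exists>g. Linf_loc g \<and> (\<forall>\<phi>. test_function \<phi> \<longrightarrow> y \<phi> = regular_distribution g \<phi>) \<and>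
        (\<forall>t>0. Linf_norm t g \<le> ereal c' * Linf_norm t v)"
      using G_norm by blast
  qed
qed

end

theorem proposition3p3:
  fixes N :: "('u::cbanach, 'x1::cbanach, 'x::cbanach, 'xm::cbanach, 'y::cbanach) node"
  assumes "system_node N"
    and "finite_dimensional (UNIV :: 'u set)"
    and "finite_dimensional (UNIV :: 'y set)"
    and "generates_C0_semigroup (operator_adjoint (gen N))"
    and "Linf_BIBO_stable N"
  shows "system_node (dual_node N) \<and> Linf_BIBO_stable (dual_node N)"
proof -
  obtain \<beta>0 where \<beta>0: "\<beta>0 \<in> resolvent_set (gen N)" "is_X1 (gen N) \<beta>0 (emb1 N)" "is_Xm1 (gen N) \<beta>0 (embm1 N)"
    and gen: "generates_C0_semigroup (gen N)"
    using assms(1) unfolding system_node_def by blast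
  obtain R0 where R0: "is_resolvent (gen N) \<beta>0 R0" using \<beta>0(1) by (auto simp: resolvent_set_def)
  interpret dual_system N \<beta>0 R0
    by unfold_locales (use assms \<beta>0 R0 gen in auto)
  obtain I and lU :: "'u \<Rightarrow> 'u cdual" where U: "frame I lU" using frame_exists[OF assms(2)] .
  obtain K and lY :: "'y \<Rightarrow> 'y cdual" where Y: "frame K lY" using frame_exists[OF assms(3)] .
  show ?thesis using dual_system_node dual_Linf_BIBO_stable[OF U Y assms(5)] by blast
qed

end
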